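(* Let $d\ge1$ be an integer. There exists a function $h\in\mathcal{S}(\mathbb{H}^d)$ such that, if $u$ denotes the solution of the free heat equation on the Heisenberg group $$\begin{cases}\partial_tu-\Delta_{\mathbb{H}^d}u=0&\text{in }\mathbb{R}^+\times\mathbb{H}^d,\\ u_{|t=0}=u_0,\end{cases}$$ then we have $$u(t,\cdot)=u_0\star h_t,$$ where $\star$ denotes the convolution on the Heisenberg group, while $h_t$ is defined by $$h_t(x,y,s)=\frac{1}{t^{d+1}}\,h\Big(\frac{x}{\sqrt t},\frac{y}{\sqrt t},\frac{s}{t}\Big).$$
   Context: The Heisenberg group $\mathbb{H}^d$ is $\mathbb{C}^d\times\mathbb{R}$ with the product $(z,s)\cdot(z',s')=(z+z',\,s+s'+2\,\mathrm{Im}(z\cdot\overline{z'}))$, where $z\cdot\overline{z'}=\sum_{j=1}^d z_j\overline{z'_j}$; points are written $(z,s)$ or $(x,y,s)$ with $z=x+iy$, $x,y\in\mathbb{R}^d$. Its Haar measure is Lebesgue measure $dx\,dy\,ds$. For $1\le j\le d$ let $Z_j=\partial_{z_j}+i\overline{z}_j\partial_s$ and $\overline{Z}_j=\partial_{\overline{z}_j}-iz_j\partial_s$ (left invariant vector fields), and $\Delta_{\mathbb{H}^d}=2\sum_{j=1}^d(Z_j\overline{Z}_j+\overline{Z}_jZ_j)$. The Schwartz space $\mathcal{S}(\mathbb{H}^d)$ coincides with $\mathcal{S}(\mathbb{R}^{2d+1})$. Convolution is $$f\star g(w)=\int_{\mathbb{H}^d}f(wv^{-1})g(v)\,dv=\int_{\mathbb{H}^d}f(v)g(v^{-1}w)\,dv.$$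 Heat semigroup. The semigroup associated with the heat equation is denoted $e^{t\Delta_{\mathbb{H}^d}}$. It is described on the Fourier side as follows. For $\lambda\in\mathbb{R}\setminus\{0\}$ let $\mathcal{H}_\lambda$ be the Hilbert space of holomorphic functions $F$ on $\mathbb{C}^d$ with $$\|F\|_{\mathcal{H}_\lambda}^2=\Big(\frac{2|\lambda|}{\pi}\Big)^d\int_{\mathbb{C}^d}e^{-2|\lambda||\xi|^2}|F(\xi)|^2\,d\xi<\infty,$$ with orthonormal basis $F_{\alpha,\lambda}(\xi)=\frac{(\sqrt{2|\lambda|}\,\xi)^\alpha}{\sqrt{\alpha!}}$, $\alpha\in\mathbb{N}^d$. With $\xi\cdot z=\sum_j\xi_jz_j$, put $$u^\lambda_{z,s}F(\xi)=F(\xi-\overline{z})e^{i\lambda s+2\lambda(\xi\cdot z-|z|^2/2)}\ (\lambda>0),\qquad u^\lambda_{z,s}F(\xi)=F(\xi-z)e^{i\lambda s-2\lambda(\xi\cdot\overline{z}-|z|^2/2)}\ (\lambda<0).$$ The Fourier transform is $\mathcal{F}(f)(\lambda)=\int_{\mathbb{H}^d}f(z,s)u^\lambda_{z,s}\,dz\,ds$ for $f\in L^1(\mathbb{H}^d)$, extended to $L^2(\mathbb{H}^d)$ by the Plancherel theorem, and one has $\mathcal{F}(e^{t\Delta_{\mathbb{H}^d}}f)(\lambda)F_{\alpha,\lambda}=e^{-4t|\lambda|(2|\alpha|+d)}\mathcal{F}(f)(\lambda)F_{\alpha,\lambda}$. *)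

theory Defs
  imports "HOL-Analysis.Analysis"
begin

section \<open>The Heisenberg group\<close>

text \<open>The dimension \<open>d \<ge> 1\<close> is \<open>CARD('d)\<close>. The Borel measure \<^term>\<open>lborel\<close> on this type is the
  Lebesgue measure \<open>dx dy ds\<close> and is the Haar measure of the group.\<close>

type_synonym 'd heis = "(complex ^ 'd) \<times> real"

definition heis_mult :: "'d::finite heis \<Rightarrow> 'd heis \<Rightarrow> 'd heis"
  where "heis_mult w v =
    (fst w + fst v, snd w + snd v + 2 * Im (\<Sum>j\<in>UNIV. fst w $ j * cnj (fst v $ j)))"

definition heis_inv :: "'d::finite heis \<Rightarrow> 'd heis"
  where "heis_inv w = (- fst w, - snd w)"

definition heis_conv ::
    "('d::finite heis \<Rightarrow> complex) \<Rightarrow> ('d heis \<Rightarrow> complex) \<Rightarrow> 'd heis \<Rightarrow> complex"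
  where "heis_conv f g w = (\<integral>v. f v * g (heis_mult (heis_inv v) w) \<partial>lborel)"

definition heis_dilate :: "real \<Rightarrow> ('d::finite heis \<Rightarrow> complex) \<Rightarrow> 'd heis \<Rightarrow> complex"
  where "heis_dilate t h w =
    complex_of_real (1 / t ^ (CARD('d) + 1)) * h ((1 / sqrt t) *\<^sub>R fst w, snd w / t)"


section \<open>Smooth functions and the Schwartz space\<close>

definition dir_deriv :: "'a::euclidean_space \<Rightarrow> ('a \<Rightarrow> complex) \<Rightarrow> 'a \<Rightarrow> complex"
  where "dir_deriv v f x = frechet_derivative f (at x) v"

text \<open>Multi-indices are encoded as lists of coordinate directions; the list \<open>[v\<^sub>1, \<dots>, v\<^sub>k]\<close> stands
  for the iterated derivative along \<open>v\<^sub>k\<close> first and \<open>v\<^sub>1\<close> last.\<close>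

definition iter_deriv :: "'a::euclidean_space list \<Rightarrow> ('a \<Rightarrow> complex) \<Rightarrow> 'a \<Rightarrow> complex"
  where "iter_deriv vs f = foldr dir_deriv vs f"

definition smooth :: "('a::euclidean_space \<Rightarrow> complex) \<Rightarrow> bool"
  where "smooth f \<longleftrightarrow>
    (\<forall>vs. set vs \<subseteq> Basis \<longrightarrow> (\<forall>x. iter_deriv vs f differentiable (at x)))"

definition schwartz :: "('a::euclidean_space \<Rightarrow> complex) \<Rightarrow> bool"
  where "schwartz f \<longleftrightarrow> smooth f \<and>
    (\<forall>vs k. set vs \<subseteq> Basis \<longrightarrow>
      (\<exists>C. \<forall>x. (1 + norm x) ^ k * norm (iter_deriv vs f x) \<le> C))"


section \<open>The left invariant vector fields and the sublaplacian\<close>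

text \<open>The fields are \<open>Z\<^sub>j = \<partial>\<^bsub>z\<^sub>j\<^esub> + i z\<^sub>j\<^sup>* \<partial>\<^sub>s\<close> and \<open>\<partial>\<^bsub>z\<^sub>j\<^sup>*\<^esub> - i z\<^sub>j \<partial>\<^sub>s\<close>, where a star denotes
  the complex conjugate, \<open>\<partial>\<^sub>z = (\<partial>\<^sub>x - i \<partial>\<^sub>y) / 2\<close> and \<open>\<partial>\<^bsub>z\<^sup>*\<^esub> = (\<partial>\<^sub>x + i \<partial>\<^sub>y) / 2\<close>.\<close>

definition d_x :: "'d::finite \<Rightarrow> ('d heis \<Rightarrow> complex) \<Rightarrow> 'd heis \<Rightarrow> complex"
  where "d_x j = dir_deriv (axis j 1, 0)"

definition d_y :: "'d::finite \<Rightarrow> ('d heis \<Rightarrow> complex) \<Rightarrow> 'd heis \<Rightarrow> complex"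
  where "d_y j = dir_deriv (axis j \<i>, 0)"

definition d_s :: "('d::finite heis \<Rightarrow> complex) \<Rightarrow> 'd heis \<Rightarrow> complex"
  where "d_s = dir_deriv (0, 1)"

definition d_z :: "'d::finite \<Rightarrow> ('d heis \<Rightarrow> complex) \<Rightarrow> 'd heis \<Rightarrow> complex"
  where "d_z j f w = (d_x j f w - \<i> * d_y j f w) / 2"

definition d_zbar :: "'d::finite \<Rightarrow> ('d heis \<Rightarrow> complex) \<Rightarrow> 'd heis \<Rightarrow> complex"
  where "d_zbar j f w = (d_x j f w + \<i> * d_y j f w) / 2"

definition heis_Z :: "'d::finite \<Rightarrow> ('d heis \<Rightarrow> complex) \<Rightarrow> 'd heis \<Rightarrow> complex"
  where "heis_Z j f w = d_z j f w + \<i> * cnj (fst w $ j) * d_s f w"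

definition heis_Zbar :: "'d::finite \<Rightarrow> ('d heis \<Rightarrow> complex) \<Rightarrow> 'd heis \<Rightarrow> complex"
  where "heis_Zbar j f w = d_zbar j f w - \<i> * (fst w $ j) * d_s f w"

definition heis_laplacian :: "('d::finite heis \<Rightarrow> complex) \<Rightarrow> 'd heis \<Rightarrow> complex"
  where "heis_laplacian f w =
    2 * (\<Sum>j\<in>UNIV. heis_Z j (heis_Zbar j f) w + heis_Zbar j (heis_Z j f) w)"


section \<open>The Cauchy problem for the heat equation\<close>

definition mem_Lp :: "real \<Rightarrow> ('a::euclidean_space \<Rightarrow> complex) \<Rightarrow> bool"
  where "mem_Lp p f \<longleftrightarrow>
    f \<in> borel_measurable lborel \<and> integrable lborel (\<lambda>x. norm (f x) powr p)"

text \<open>Test functions on \<open>]0,\<infinity>[ \<times> \<H>\<^sup>d\<close>, extended by \<open>0\<close> to all times.\<close>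

definition test_function :: "(real \<Rightarrow> 'd::finite heis \<Rightarrow> complex) \<Rightarrow> bool"
  where "test_function \<phi> \<longleftrightarrow> smooth (\<lambda>(t, w). \<phi> t w) \<and>
    (\<exists>K. compact K \<and> K \<subseteq> {0<..} \<times> UNIV \<and> (\<forall>t w. (t, w) \<notin> K \<longrightarrow> \<phi> t w = 0))"

text \<open>\<open>\<partial>\<^sub>t u - \<Delta> u = 0\<close> in the sense of distributions on \<open>]0,\<infinity>[ \<times> \<H>\<^sup>d\<close>. The fields \<open>Z\<^sub>j\<close> and their
  conjugates are divergence free, so their transposes for the bilinear pairing are their
  negatives; hence \<open>\<Delta>\<close> is its own transpose and that of \<open>\<partial>\<^sub>t - \<Delta>\<close> is \<open>- (\<partial>\<^sub>t + \<Delta>)\<close>.\<close>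

definition weak_heat_equation :: "(real \<Rightarrow> 'd::finite heis \<Rightarrow> complex) \<Rightarrow> bool"
  where "weak_heat_equation u \<longleftrightarrow>
    (\<forall>\<phi>. test_function \<phi> \<longrightarrow>
      (LINT t:{0<..}|lborel. (LINT w|lborel.
        u t w * (- vector_derivative (\<lambda>\<tau>. \<phi> \<tau> w) (at t) - heis_laplacian (\<phi> t) w))) = 0)"

text \<open>\<open>u\<close> lies in \<open>C([0,\<infinity>[; L\<^sup>p(\<H>\<^sup>d))\<close>, satisfies the heat equation for positive times, and has
  initial value \<open>u\<^sub>0\<close>. Only the values of \<open>u\<close> at times \<open>t \<ge> 0\<close> matter.\<close>

definition heat_solution ::
    "real \<Rightarrow> ('d::finite heis \<Rightarrow> complex) \<Rightarrow> (real \<Rightarrow> 'd heis \<Rightarrow> complex) \<Rightarrow> bool"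
  where "heat_solution p u0 u \<longleftrightarrow>
    (\<forall>t\<ge>0. mem_Lp p (u t)) \<and>
    (\<forall>t0\<ge>0. ((\<lambda>t. LINT w|lborel. norm (u t w - u t0 w) powr p) \<longlongrightarrow> 0) (at t0 within {0..})) \<and>
    weak_heat_equation u \<and>
    (AE w in lborel. u 0 w = u0 w)"

end

theory Submission
  imports Defs "HOL-Probability.Probability" "HOL-Real_Asymp.Real_Asymp"
begin

text \<open>The kernel is given by Gaveau's formula: up to a constant, \<open>h(z,s)\<close> is the integral over
  \<open>\<lambda>\<close> of \<open>e\<^bsup>i\<lambda>s/4\<^esup> (\<lambda> / sinh \<lambda>)\<^sup>d e\<^bsup>- \<lambda> coth \<lambda> |z|\<^sup>2 / 4\<^esup>\<close>. Integrals of this kind, with polynomial factors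
  in \<open>z\<close> and further amplitudes in \<open>\<lambda>\<close>, are closed under derivatives and, by integration by parts
  in \<open>\<lambda>\<close>, under multiplication by \<open>s\<close>; hence \<open>h\<close> is a Schwartz function. The heat equation for the
  rescaled kernels \<open>h\<^sub>t\<close> reduces to \<open>\<kappa> - \<lambda>\<kappa>' = \<kappa>\<^sup>2 - \<lambda>\<^sup>2\<close> for \<open>\<kappa> = \<lambda> coth \<lambda>\<close>.

  For the representation formula let \<open>u\<close> be a solution. A curve in \<open>C([0,\<infinity>[; L\<^sup>p)\<close> is also continuous
  with values in \<open>L\<^sup>1\<close> for a polynomially decaying weight. Testing the equation against
  \<open>h\<^bsub>T-t\<^esub>(w\<^sup>-\<^sup>1v)\<close>, cut off in \<open>v\<close> by dilations of a bump function, shows that \<open>(u(t) \<star> h\<^bsub>T-t\<^esub>)(w)\<close>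
  does not depend on \<open>t < T\<close>. It equals \<open>(u\<^sub>0 \<star> h\<^sub>T)(w)\<close> at \<open>t = 0\<close> and tends weakly to \<open>u(T)\<close>
  as \<open>t\<close> tends to \<open>T\<close>, because \<open>h\<close> has mass \<open>1\<close>.\<close>

section \<open>Smooth functions\<close>

text \<open>In the convolution the kernel is taken at v^(-1) w, which is minus w^(-1) v. Since h is
  even, it may be taken at w^(-1) v, a left translate of v, and left translations commute with the
  sublaplacian; thus the kernel solves the backward heat equation in the variable v in which a
  solution is tested. A claim about every solution is a uniqueness theorem, and this duality with an
  explicit kernel replaces the semigroup and the Plancherel formula. The weighted space is the
  common ground for all exponents: it contains every L^p with p >= 1, while each function paired
  with u is bounded by a multiple of the weight. The cutoffs use the dilations of the group because
  the fields are homogeneous for them: each field that hits the cutoff yields a factor r, so all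
  error terms vanish as r tends to 0. As for the constants, the fields are d_x + 2y d_s and d_y - 2x
  d_s, with commutator -4 d_s; this 4 is why the frequency in s is \<lambda>/4 when the hyperbolic
  functions have argument \<lambda> at time 1.\<close>

lemma iter_deriv_simps [simp]:
  "iter_deriv [] f = f"
  "iter_deriv (v # vs) f = dir_deriv v (iter_deriv vs f)"
  "iter_deriv (vs @ ws) f = iter_deriv vs (iter_deriv ws f)"
  by (simp_all add: iter_deriv_def)

lemma dir_deriv_eq: "(f has_derivative D) (at x) \<Longrightarrow> dir_deriv v f x = D v"
  by (metis dir_deriv_def frechet_derivative_at)

lemma dir_deriv_cong_open:
  assumes "open U" "x \<in> U" "\<And>y. y \<in> U \<Longrightarrow> f y = g y"
  shows "dir_deriv v f x = dir_deriv v g x"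
proof -
  \<comment> \<open>Both Frechet derivatives are choices from the same set of derivatives, so they
    agree even where that set is empty.\<close>
  have "(f has_derivative D) (at x) \<longleftrightarrow> (g has_derivative D) (at x)" for D
    using assms by (metis has_derivative_transform_within_open)
  then show ?thesis by (simp add: dir_deriv_def frechet_derivative_def)
qed

lemma differentiable_cong_open:
  assumes "open U" "x \<in> U" "\<And>y. y \<in> U \<Longrightarrow> f y = g y" "f differentiable (at x)"
  shows "g differentiable (at x)"
  using assms unfolding differentiable_def by (metis has_derivative_transform_within_open)

text \<open>A local form is needed because the backward kernels are smooth only before their final
  time; their extension by zero is glued from two open pieces.\<close>

definition smooth_on :: "'a::euclidean_space set \<Rightarrow> ('a \<Rightarrow> complex) \<Rightarrow> bool"
  where "smooth_on U f \<longleftrightarrow>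
    (\<forall>vs. set vs \<subseteq> Basis \<longrightarrow> (\<forall>x\<in>U. iter_deriv vs f differentiable (at x)))"

lemma smooth_iff: "smooth f \<longleftrightarrow> smooth_on UNIV f"
  by (simp add: smooth_def smooth_on_def)

text \<open>By induction on the list, each iterated derivative agrees on \<open>U\<close> with a
  member of \<open>P\<close>. Agreement on \<open>U\<close> alone survives differentiation because
  \<open>U\<close> is open.\<close>

lemma smooth_on_coinduct:
  assumes "open U" "P f"
    and "\<And>f x. P f \<Longrightarrow> x \<in> U \<Longrightarrow> f differentiable (at x)"
    and "\<And>f b. P f \<Longrightarrow> b \<in> Basis \<Longrightarrow> \<exists>g. P g \<and> (\<forall>x\<in>U. dir_deriv b f x = g x)"
  shows "smooth_on U f"
  unfolding smooth_on_def
proof (intro allI impI)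
  fix vs :: "'a list" assume "set vs \<subseteq> Basis"
  then have "\<exists>g. P g \<and> (\<forall>x\<in>U. iter_deriv vs f x = g x)"
  proof (induction vs)
    case Nil then show ?case using assms(2) by auto
  next
    case (Cons b vs)
    then obtain g where g: "P g" "\<forall>x\<in>U. iter_deriv vs f x = g x" by auto
    obtain g' where "P g'" "\<forall>x\<in>U. dir_deriv b g x = g' x"
      using assms(4)[OF g(1), of b] Cons.prems by auto
    moreover have "dir_deriv b (iter_deriv vs f) x = dir_deriv b g x" if "x \<in> U" for x
      by (rule dir_deriv_cong_open[OF assms(1) that]) (use g in auto)
    ultimately show ?case by auto
  qed
  then obtain g where g: "P g" "\<forall>x\<in>U. iter_deriv vs f x = g x" by auto
  show "\<forall>x\<in>U. iter_deriv vs f differentiable (at x)"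
  proof
    fix x assume x: "x \<in> U"
    show "iter_deriv vs f differentiable (at x)"
      by (rule differentiable_cong_open[OF assms(1) x _ assms(3)[OF g(1) x]]) (use g in auto)
  qed
qed

lemma smooth_on_cong:
  assumes "open U" "\<And>x. x \<in> U \<Longrightarrow> f x = g x" "smooth_on U f"
  shows "smooth_on U g"
proof -
  have eq: "\<forall>x\<in>U. iter_deriv vs f x = iter_deriv vs g x" for vs
  proof (induction vs)
    case (Cons b vs)
    then show ?case by (auto intro!: dir_deriv_cong_open[OF assms(1)])
  qed (use assms in auto)
  show ?thesis
    unfolding smooth_on_def
  proof (intro allI impI ballI)
    fix vs :: "'a list" and x assume "set vs \<subseteq> Basis" "x \<in> U"
    with assms(3) have "iter_deriv vs f differentiable (at x)" by (auto simp: smooth_on_def)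
    with eq \<open>x \<in> U\<close> assms(1) show "iter_deriv vs g differentiable (at x)"
      by (metis differentiable_cong_open)
  qed
qed

lemma smooth_on_subset: "smooth_on U f \<Longrightarrow> V \<subseteq> U \<Longrightarrow> smooth_on V f"
  by (auto simp: smooth_on_def)

lemma smooth_on_Un: "smooth_on U f \<Longrightarrow> smooth_on V f \<Longrightarrow> smooth_on (U \<union> V) f"
  by (auto simp: smooth_on_def)

lemma smooth_on_dir_deriv: "smooth_on U f \<Longrightarrow> b \<in> Basis \<Longrightarrow> smooth_on U (dir_deriv b f)"
  unfolding smooth_on_def
proof (intro allI impI ballI)
  fix vs :: "'a list" and x assume *: "\<forall>vs. set vs \<subseteq> Basis \<longrightarrow> (\<forall>x\<in>U. iter_deriv vs f differentiable at x)"
    "b \<in> Basis" "set vs \<subseteq> Basis" "x \<in> U"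
  from *(1)[rule_format, of "vs @ [b]" x] *(2-) show "iter_deriv vs (dir_deriv b f) differentiable at x"
    by simp
qed

lemma smooth_on_differentiable: "smooth_on U f \<Longrightarrow> x \<in> U \<Longrightarrow> f differentiable (at x)"
  by (metis smooth_on_def iter_deriv_simps(1) empty_set empty_subsetI)

lemma smooth_on_has_derivative:
  "smooth_on U f \<Longrightarrow> x \<in> U \<Longrightarrow> (f has_derivative (\<lambda>v. dir_deriv v f x)) (at x)"
  using smooth_on_differentiable frechet_derivative_works unfolding dir_deriv_def by fastforce

lemma smooth_on_continuous_on: "smooth_on U f \<Longrightarrow> continuous_on U f"
  by (meson smooth_on_differentiable continuous_at_imp_continuous_on differentiable_imp_continuous_within)

lemma smooth_on_const [intro]: "smooth_on U (\<lambda>x. c)"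
proof -
  have "smooth_on UNIV (\<lambda>x::'a. c)"
    by (rule smooth_on_coinduct[where P="\<lambda>f. \<exists>c. f = (\<lambda>x. c)"])
      (auto simp: dir_deriv_eq[OF has_derivative_const])
  then show ?thesis using smooth_on_subset by blast
qed

text \<open>The closure of given smooth functions under sums, products and composition with \<open>g\<close>
  is stable under differentiation, hence consists of smooth functions.\<close>

inductive smooth_gen ::
  "'a::euclidean_space set \<Rightarrow> 'b::euclidean_space set \<Rightarrow> ('a \<Rightarrow> 'b) \<Rightarrow> ('a \<Rightarrow> complex) \<Rightarrow> bool"
  for U V g where
  base: "smooth_on U f \<Longrightarrow> smooth_gen U V g f"
| comp: "smooth_on V F \<Longrightarrow> smooth_gen U V g (\<lambda>x. F (g x))"
| add: "smooth_gen U V g f \<Longrightarrow> smooth_gen U V g f' \<Longrightarrow> smooth_gen U V g (\<lambda>x. f x + f' x)"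
| mult: "smooth_gen U V g f \<Longrightarrow> smooth_gen U V g f' \<Longrightarrow> smooth_gen U V g (\<lambda>x. f x * f' x)"

lemma smooth_gen_sum:
  "finite A \<Longrightarrow> (\<And>i. i \<in> A \<Longrightarrow> smooth_gen U V g (f i)) \<Longrightarrow> smooth_gen U V g (\<lambda>x. \<Sum>i\<in>A. f i x)"
proof (induction A rule: finite_induct)
  case empty
  then show ?case using smooth_gen.base[OF smooth_on_const] by simp
next
  case (insert i A)
  then show ?case using smooth_gen.add[of U V g "f i" "\<lambda>x. \<Sum>i\<in>A. f i x"] by simp
qed

text \<open>The only case beyond the sum and product rules is the chain rule. Expanding
  \<open>g\<close> in the basis writes a derivative of \<open>F (g x)\<close> as a sum of products
  of derivatives of components of \<open>g\<close> with partial derivatives of \<open>F\<close> at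
  \<open>g x\<close>, which stays in the closure.\<close>

lemma smooth_gen_deriv:
  assumes g: "\<And>x. x \<in> U \<Longrightarrow> g x \<in> V"
    and comp: "\<And>e. e \<in> Basis \<Longrightarrow> smooth_on U (\<lambda>x. complex_of_real (g x \<bullet> e))"
    and "smooth_gen U V g f"
  shows "(\<forall>x\<in>U. f differentiable (at x)) \<and>
    (\<forall>b\<in>Basis. \<exists>f'. smooth_gen U V g f' \<and> (\<forall>x\<in>U. dir_deriv b f x = f' x))"
  using assms(3)
proof (induction rule: smooth_gen.induct)
  case (base f)
  then have "smooth_gen U V g (dir_deriv b f)" if "b \<in> Basis" for b
    using that by (intro smooth_gen.base smooth_on_dir_deriv)
  with base show ?case
    by (auto intro: smooth_on_differentiable)
next
  case (comp F)
  define Dg where "Dg x v = (\<Sum>e\<in>Basis. Re (dir_deriv v (\<lambda>x. complex_of_real (g x \<bullet> e)) x) *\<^sub>R e)" for x v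
  have ge: "((\<lambda>x. g x \<bullet> e) has_derivative (\<lambda>v. Re (dir_deriv v (\<lambda>x. complex_of_real (g x \<bullet> e)) x))) (at x)"
    if "x \<in> U" "e \<in> Basis" for x e
    using has_derivative_Re[OF smooth_on_has_derivative[OF assms(2)[OF that(2)] that(1)]] by simp
  have gd: "(g has_derivative Dg x) (at x)" if "x \<in> U" for x
  proof -
    have "((\<lambda>x. \<Sum>e\<in>Basis. (g x \<bullet> e) *\<^sub>R e) has_derivative Dg x) (at x)"
      unfolding Dg_def using ge[OF that] by (intro has_derivative_sum has_derivative_scaleR_left)
    then show ?thesis by (simp add: euclidean_representation)
  qed
  \<comment> \<open>The components of \<open>g\<close> are real but enter as complex functions, the
    only ones for which smoothness is defined. Their derivatives are real, so passing to
    \<open>Re\<close> and back loses nothing.\<close>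
  have Re_eq: "complex_of_real (Re (dir_deriv v (\<lambda>x. complex_of_real (g x \<bullet> e)) x)) =
      dir_deriv v (\<lambda>x. complex_of_real (g x \<bullet> e)) x" if "x \<in> U" "e \<in> Basis" for x e v
  proof -
    have "((\<lambda>x. complex_of_real (g x \<bullet> e)) has_derivative
      (\<lambda>v. complex_of_real (Re (dir_deriv v (\<lambda>x. complex_of_real (g x \<bullet> e)) x)))) (at x)"
      by (rule has_derivative_of_real[OF ge[OF that]])
    from dir_deriv_eq[OF this, of v] show ?thesis by simp
  qed
  have D: "((\<lambda>x. F (g x)) has_derivative (\<lambda>v. dir_deriv (Dg x v) F (g x))) (at x)" if "x \<in> U" for x
    using has_derivative_compose[OF gd[OF that] smooth_on_has_derivative[OF comp g[OF that]]] .
  have lin: "dir_deriv (Dg x v) F (g x) =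
     (\<Sum>e\<in>Basis. dir_deriv v (\<lambda>x. complex_of_real (g x \<bullet> e)) x * dir_deriv e F (g x))"
    if "x \<in> U" for x v
  proof -
    have l: "linear (\<lambda>v. dir_deriv v F (g x))"
      using smooth_on_has_derivative[OF comp g[OF that]] has_derivative_linear by blast
    show ?thesis unfolding Dg_def
      by (simp add: linear_sum[OF l] linear_scale[OF l] scaleR_conv_of_real Re_eq that)
  qed
  have "\<exists>f'. smooth_gen U V g f' \<and> (\<forall>x\<in>U. dir_deriv b (\<lambda>x. F (g x)) x = f' x)" if "b \<in> Basis" for b
  proof (intro exI conjI ballI)
    show "smooth_gen U V g (\<lambda>x. \<Sum>e\<in>Basis. dir_deriv b (\<lambda>x. complex_of_real (g x \<bullet> e)) x * dir_deriv e F (g x))"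
      by (intro smooth_gen_sum smooth_gen.mult smooth_gen.base smooth_gen.comp smooth_on_dir_deriv
          assms comp that) auto
    show "dir_deriv b (\<lambda>x. F (g x)) x = (\<Sum>e\<in>Basis. dir_deriv b (\<lambda>x. complex_of_real (g x \<bullet> e)) x * dir_deriv e F (g x))"
      if "x \<in> U" for x
      using dir_deriv_eq[OF D[OF that]] lin[OF that] by simp
  qed
  with D[THEN differentiableI] show ?case by simp
next
  case (add f h)
  note dF = add(3)[THEN conjunct1, rule_format, THEN frechet_derivative_works[THEN iffD1]]
  note dH = add(4)[THEN conjunct1, rule_format, THEN frechet_derivative_works[THEN iffD1]]
  note D = has_derivative_add[OF dF dH]
  have "\<exists>f'. smooth_gen U V g f' \<and> (\<forall>x\<in>U. dir_deriv b (\<lambda>x. f x + h x) x = f' x)" if "b \<in> Basis" for b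
  proof -
    obtain f' h' where *: "smooth_gen U V g f'" "\<forall>x\<in>U. dir_deriv b f x = f' x"
      "smooth_gen U V g h'" "\<forall>x\<in>U. dir_deriv b h x = h' x" using add.IH \<open>b \<in> Basis\<close> by blast
    then show ?thesis
      by (intro exI[of _ "\<lambda>x. f' x + h' x"])
        (auto intro: smooth_gen.add simp: dir_deriv_eq[OF D] simp flip: dir_deriv_def)
  qed
  with D[THEN differentiableI] show ?case by simp
next
  case (mult f h)
  note dF = mult(3)[THEN conjunct1, rule_format, THEN frechet_derivative_works[THEN iffD1]]
  note dH = mult(4)[THEN conjunct1, rule_format, THEN frechet_derivative_works[THEN iffD1]]
  note D = has_derivative_mult[OF dF dH]
  have "\<exists>f'. smooth_gen U V g f' \<and> (\<forall>x\<in>U. dir_deriv b (\<lambda>x. f x * h x) x = f' x)" if "b \<in> Basis" for b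
  proof -
    obtain f' h' where *: "smooth_gen U V g f'" "\<forall>x\<in>U. dir_deriv b f x = f' x"
      "smooth_gen U V g h'" "\<forall>x\<in>U. dir_deriv b h x = h' x" using mult.IH \<open>b \<in> Basis\<close> by blast
    have "smooth_gen U V g (\<lambda>x. f x * h' x + f' x * h x)"
      by (intro smooth_gen.add smooth_gen.mult mult(1,2) *)
    moreover have "\<forall>x\<in>U. dir_deriv b (\<lambda>x. f x * h x) x = f x * h' x + f' x * h x"
      using *(2,4) by (simp add: dir_deriv_eq[OF D] flip: dir_deriv_def)
    ultimately show ?thesis by (intro exI conjI)
  qed
  with D[THEN differentiableI] show ?case by simp
qed

lemma smooth_gen_smooth_on:
  assumes "open U" "\<And>x. x \<in> U \<Longrightarrow> g x \<in> V"
    and "\<And>e. e \<in> Basis \<Longrightarrow> smooth_on U (\<lambda>x. complex_of_real (g x \<bullet> e))"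
    and "smooth_gen U V g f"
  shows "smooth_on U f"
proof (rule smooth_on_coinduct[where P="smooth_gen U V g"])
  fix f b assume f: "smooth_gen U V g f"
  note * = smooth_gen_deriv[OF assms(2,3) f]
  show "f differentiable (at x)" if "x \<in> U" for x using * that by blast
  show "\<exists>f'. smooth_gen U V g f' \<and> (\<forall>x\<in>U. dir_deriv b f x = f' x)" if "b \<in> Basis"
    using * that by blast
qed (use assms in auto)

lemma smooth_on_compose:
  assumes "open U" "\<And>x. x \<in> U \<Longrightarrow> g x \<in> V"
    and "\<And>e. e \<in> Basis \<Longrightarrow> smooth_on U (\<lambda>x. complex_of_real (g x \<bullet> e))"
    and "smooth_on V F"
  shows "smooth_on U (\<lambda>x. F (g x))"
  by (rule smooth_gen_smooth_on[OF assms(1-3) smooth_gen.comp[OF assms(4)]])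

lemma
  assumes "open U" "smooth_on U f" "smooth_on U h"
  shows smooth_on_add: "smooth_on U (\<lambda>x. f x + h x)"
    and smooth_on_mult: "smooth_on U (\<lambda>x. f x * h x)"
proof -
  \<comment> \<open>With a constant map in place of \<open>g\<close>, every composition is constant,
    and what remains is the closure under sums and products.\<close>
  note * = smooth_gen_smooth_on[where g="\<lambda>x. 0::real" and V=UNIV, OF assms(1)]
  show "smooth_on U (\<lambda>x. f x + h x)"
    by (rule *) (use assms(2,3) in \<open>auto intro: smooth_gen.add smooth_gen.base\<close>)
  show "smooth_on U (\<lambda>x. f x * h x)"
    by (rule *) (use assms(2,3) in \<open>auto intro: smooth_gen.mult smooth_gen.base\<close>)
qed

lemma smooth_on_sum:
  "open U \<Longrightarrow> finite A \<Longrightarrow> (\<And>i. i \<in> A \<Longrightarrow> smooth_on U (f i)) \<Longrightarrow> smooth_on U (\<lambda>x. \<Sum>i\<in>A. f i x)"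
  by (rule smooth_gen_smooth_on[where g="\<lambda>x. 0::real" and V=UNIV])
    (auto intro: smooth_gen_sum smooth_gen.base)

lemma smooth_on_cmult: "open U \<Longrightarrow> smooth_on U f \<Longrightarrow> smooth_on U (\<lambda>x. c * f x)"
  by (auto intro: smooth_on_mult)

lemma smooth_on_diff:
  "open U \<Longrightarrow> smooth_on U f \<Longrightarrow> smooth_on U h \<Longrightarrow> smooth_on U (\<lambda>x. f x - h x)"
  using smooth_on_add[OF _ _ smooth_on_cmult[of U h "-1"], of f] by simp

lemma smooth_on_linear:
  assumes "bounded_linear f"
  shows "smooth_on U f"
proof -
  have "smooth_on UNIV f"
    by (rule smooth_on_coinduct[where P="\<lambda>h. h = f \<or> (\<exists>c. h = (\<lambda>x. c))"])
      (auto simp: dir_deriv_eq[OF has_derivative_const]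
        dir_deriv_eq[OF bounded_linear_imp_has_derivative[OF assms]]
        intro: bounded_linear_imp_differentiable assms)
  then show ?thesis using smooth_on_subset by blast
qed

lemma smooth_on_inner: "smooth_on U (\<lambda>x. complex_of_real (x \<bullet> e))"
  by (intro smooth_on_linear bounded_linear_compose[OF bounded_linear_of_real] bounded_linear_inner_left)

lemma smooth_on_real_deriv:
  fixes f f' :: "real \<Rightarrow> complex"
  assumes "open U" "P f"
    and "\<And>f. P f \<Longrightarrow> \<exists>g. P g \<and> (\<forall>x\<in>U. (f has_vector_derivative g x) (at x))"
  shows "smooth_on U f"
proof (rule smooth_on_coinduct[where P=P])
  show "f differentiable at x" if "P f" "x \<in> U" for f x
    using assms(3)[OF that(1)] that(2) by (metis differentiableI_vector)
  show "\<exists>g. P g \<and> (\<forall>x\<in>U. dir_deriv b f x = g x)" if "P f" "b \<in> Basis" for f b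
  proof -
    obtain g where "P g" "\<forall>x\<in>U. (f has_vector_derivative g x) (at x)"
      using assms(3)[OF \<open>P f\<close>] by blast
    then show ?thesis
      using that(2) by (auto simp: has_vector_derivative_def dir_deriv_eq intro!: exI[of _ g])
  qed
qed (use assms in auto)


section \<open>A criterion for membership in the Schwartz space\<close>

text \<open>Weights of all orders arise from coordinate multiplications, because the norm is at most
  the sum of the absolute coordinates. So plain boundedness on a class closed under these operations
  and under derivatives controls all seminorms.\<close>

lemma schwartz_coinduct:
  fixes f :: "'a::euclidean_space \<Rightarrow> complex"
  assumes "P f"
    and bd: "\<And>f. P f \<Longrightarrow> \<exists>C. \<forall>x. norm (f x) \<le> C"
    and diff: "\<And>f x. P f \<Longrightarrow> f differentiable (at x)"
    and deriv: "\<And>f b. P f \<Longrightarrow> b \<in> Basis \<Longrightarrow> P (dir_deriv b f)"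
    and mult: "\<And>f b. P f \<Longrightarrow> b \<in> Basis \<Longrightarrow> P (\<lambda>x. complex_of_real (x \<bullet> b) * f x)"
  shows "schwartz f"
proof -
  have "smooth f" unfolding smooth_iff
  proof (rule smooth_on_coinduct[where P=P])
    show "\<exists>g. P g \<and> (\<forall>x\<in>UNIV. dir_deriv b f x = g x)" if "P f" "b \<in> Basis" for f b
      using deriv[OF that] by blast
  qed (use assms(1) diff in auto)
  moreover have it: "set vs \<subseteq> Basis \<Longrightarrow> P (iter_deriv vs f)" for vs
    by (induction vs) (auto intro: deriv assms(1))
  moreover have "P f \<Longrightarrow> \<exists>C. \<forall>x. (1 + norm x) ^ k * norm (f x) \<le> C" for f k
  proof (induction k arbitrary: f)
    case 0
    then show ?case using bd by auto
  next
    case (Suc k)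
    obtain C0 where C0: "\<And>x. (1 + norm x) ^ k * norm (f x) \<le> C0" using Suc by blast
    have "\<forall>b\<in>Basis. \<exists>C. \<forall>x. (1 + norm x) ^ k * norm (complex_of_real (x \<bullet> b) * f x) \<le> C"
      using Suc mult by blast
    then obtain C where C: "\<And>b x. b \<in> Basis \<Longrightarrow> (1 + norm x) ^ k * norm (complex_of_real (x \<bullet> b) * f x) \<le> C b"
      by metis
    have "(1 + norm x) ^ Suc k * norm (f x) \<le> C0 + (\<Sum>b\<in>Basis. C b)" for x
    proof -
      have "(1 + norm x) ^ Suc k * norm (f x) \<le> (1 + (\<Sum>b\<in>Basis. \<bar>x \<bullet> b\<bar>)) * ((1 + norm x) ^ k * norm (f x))"
        unfolding power_Suc mult.assoc
        by (intro mult_right_mono) (auto intro: norm_le_l1)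
      also have "\<dots> = (1 + norm x) ^ k * norm (f x) + (\<Sum>b\<in>Basis. (1 + norm x) ^ k * norm (complex_of_real (x \<bullet> b) * f x))"
        by (simp add: distrib_right distrib_left sum_distrib_right sum_distrib_left norm_mult mult_ac)
      also have "\<dots> \<le> C0 + (\<Sum>b\<in>Basis. C b)"
        using C0 C by (intro add_mono sum_mono) auto
      finally show ?thesis .
    qed
    then show ?case by blast
  qed
  ultimately show ?thesis unfolding schwartz_def by blast
qed

section \<open>Domination, differentiation under the integral, and integrals of derivatives\<close>

lemma integrable_dominated:
  fixes f :: "'a \<Rightarrow> 'b::{banach, second_countable_topology}"
  assumes "integrable M g" "f \<in> borel_measurable M" "\<And>x. norm (f x) \<le> g x"
  shows "integrable M f"
  by (rule Bochner_Integration.integrable_bound[OF assms(1,2)])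
    (simp add: order_trans[OF assms(3) abs_ge_self])

text \<open>Dominated convergence for the difference quotients. The bound \<open>G\<close> holds at
  every point of the space, so by the mean value inequality it bounds the increments as well, and
  the normalised remainder is at most \<open>2 * G y\<close>.\<close>

lemma has_derivative_integral_dominated:
  fixes f :: "'a::{real_normed_vector, perfect_space} \<Rightarrow> 'b \<Rightarrow> 'c::{banach, second_countable_topology}"
  assumes int: "\<And>x. integrable M (f x)"
    and D: "\<And>x y. ((\<lambda>x. f x y) has_derivative D x y) (at x)"
    and meas: "\<And>x v. (\<lambda>y. D x y v) \<in> borel_measurable M"
    and bd: "\<And>x y v. norm (D x y v) \<le> G y * norm v"
    and G: "integrable M G"
  shows "((\<lambda>x. \<integral>y. f x y \<partial>M) has_derivative (\<lambda>v. \<integral>y. D x y v \<partial>M)) (at x)"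
proof (rule has_derivativeI)
  have Di: "integrable M (\<lambda>y. D x y v)" for x v
    by (rule integrable_dominated[OF integrable_mult_left[OF G, of "norm v"] meas bd])
  have lin: "linear (D x y)" for x y using D has_derivative_linear by blast
  show "bounded_linear (\<lambda>v. \<integral>y. D x y v \<partial>M)"
  proof (rule bounded_linear_intro[where K="\<integral>y. G y \<partial>M"])
    show "(\<integral>y. D x y (u + v) \<partial>M) = (\<integral>y. D x y u \<partial>M) + (\<integral>y. D x y v \<partial>M)" for u v
      by (simp add: linear_add[OF lin] Di)
    show "(\<integral>y. D x y (r *\<^sub>R v) \<partial>M) = r *\<^sub>R (\<integral>y. D x y v \<partial>M)" for r v
      by (simp add: linear_scale[OF lin])
    show "norm (\<integral>y. D x y v \<partial>M) \<le> norm v * (\<integral>y. G y \<partial>M)" for v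
    proof -
      have "norm (\<integral>y. D x y v \<partial>M) \<le> (\<integral>y. norm (D x y v) \<partial>M)" by simp
      also have "\<dots> \<le> (\<integral>y. G y * norm v \<partial>M)"
        using bd G by (intro integral_mono integrable_norm Di integrable_mult_left) auto
      finally show ?thesis using G by (simp add: mult.commute)
    qed
  qed
  have mvt: "norm (f z y - f x y) \<le> G y * norm (z - x)" for y z
  proof (rule differentiable_bound[of UNIV "\<lambda>x. f x y" "\<lambda>x. D x y"])
    show "onorm (D x y) \<le> G y" for x by (rule onorm_le) (rule bd)
  qed (use D in \<open>auto intro: has_derivative_at_withinI\<close>)
  show "((\<lambda>z. ((\<integral>y. f z y \<partial>M) - (\<integral>y. f x y \<partial>M) - (\<integral>y. D x y (z - x) \<partial>M)) /\<^sub>R norm (z - x)) \<longlongrightarrow> 0) (at x)"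
    unfolding tendsto_at_iff_sequentially
  proof (intro allI impI)
    fix X assume X: "\<forall>i::nat. X i \<in> UNIV - {x}" "X \<longlonglongrightarrow> x"
    have "(\<lambda>i. \<integral>y. (f (X i) y - f x y - D x y (X i - x)) /\<^sub>R norm (X i - x) \<partial>M) \<longlonglongrightarrow> (\<integral>y. 0 \<partial>M)"
    proof (rule integral_dominated_convergence[where w="\<lambda>y. 2 * G y"])
      show "(\<lambda>y. 0) \<in> borel_measurable M" by simp
      show "integrable M (\<lambda>y. 2 * G y)" using G by simp
      show "(\<lambda>y. (f (X i) y - f x y - D x y (X i - x)) /\<^sub>R norm (X i - x)) \<in> borel_measurable M" for i
        using int Di by auto
      show "AE y in M. (\<lambda>i. (f (X i) y - f x y - D x y (X i - x)) /\<^sub>R norm (X i - x)) \<longlonglongrightarrow> 0"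
      proof (rule AE_I2)
        fix y
        have "((\<lambda>z. (f z y - f x y - D x y (z - x)) /\<^sub>R norm (z - x)) \<longlongrightarrow> 0) (at x)"
          using D[of y x] unfolding has_derivative_at_within by auto
        then show "(\<lambda>i. (f (X i) y - f x y - D x y (X i - x)) /\<^sub>R norm (X i - x)) \<longlonglongrightarrow> 0"
          using X unfolding tendsto_at_iff_sequentially comp_def by blast
      qed
      show "AE y in M. norm ((f (X i) y - f x y - D x y (X i - x)) /\<^sub>R norm (X i - x)) \<le> 2 * G y" for i
      proof (rule AE_I2)
        fix y
        have pos: "norm (X i - x) > 0" using X by auto
        have "norm (f (X i) y - f x y - D x y (X i - x)) \<le> norm (f (X i) y - f x y) + norm (D x y (X i - x))"
          by (rule norm_triangle_ineq4)
        also have "\<dots> \<le> 2 * G y * norm (X i - x)"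
          using mvt[of "X i" y] bd[of x y "X i - x"] by simp
        finally show "norm ((f (X i) y - f x y - D x y (X i - x)) /\<^sub>R norm (X i - x)) \<le> 2 * G y"
          using pos by (simp add: inverse_eq_divide divide_le_eq)
      qed
    qed
    then show "((\<lambda>z. ((\<integral>y. f z y \<partial>M) - (\<integral>y. f x y \<partial>M) - (\<integral>y. D x y (z - x) \<partial>M)) /\<^sub>R norm (z - x)) \<circ> X) \<longlonglongrightarrow> 0"
      using int Di by (simp add: comp_def)
  qed
qed

lemma integrable_inverse_1_plus_square_lborel: "integrable lborel (\<lambda>x::real. 1 / (1 + x\<^sup>2))"
  using integrable_inverse_1_plus_square by (simp add: set_integrable_def divide_inverse)

lemma integral_deriv_eq_0:
  fixes F f :: "real \<Rightarrow> complex"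
  assumes "\<And>x. (F has_vector_derivative f x) (at x)" "continuous_on UNIV f"
    and "integrable lborel f" "(F \<longlongrightarrow> 0) at_top" "(F \<longlongrightarrow> 0) at_bot"
  shows "(\<integral>x. f x \<partial>lborel) = 0"
proof -
  have "(LBINT x=-\<infinity>..\<infinity>. f x) = 0 - 0"
  proof (rule interval_integral_FTC_integrable)
    show "isCont f x" for x using assms(2) by (simp add: continuous_on_eq_continuous_at)
    show "set_integrable lborel (einterval (-\<infinity>) \<infinity>) f" using assms(3) by (simp add: set_integrable_def)
  qed (use assms in \<open>simp_all add: ereal_tendsto_simps\<close>)
  then show ?thesis by (simp add: interval_lebesgue_integral_def set_lebesgue_integral_def)
qed


section \<open>The functions \<open>\<lambda> / sinh \<lambda>\<close> and \<open>\<lambda> coth \<lambda>\<close>\<close>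

text \<open>\<open>exp_moment 0 \<lambda> = sinh \<lambda> / \<lambda>\<close>, and \<open>exp_moment k\<close> is its \<open>k\<close>-th derivative. This
  integral representation avoids the removable singularity at \<open>0\<close>.\<close>

definition exp_moment :: "nat \<Rightarrow> real \<Rightarrow> real"
  where "exp_moment k l = integral {-1..1} (\<lambda>\<theta>. \<theta> ^ k * exp (l * \<theta>)) / 2"

lemma exp_moment_integrable: "(\<lambda>\<theta>. \<theta> ^ k * exp (l * \<theta>)) integrable_on {-1..1::real}"
  by (intro integrable_continuous_interval continuous_intros)

lemma exp_moment_deriv: "(exp_moment k has_real_derivative exp_moment (Suc k) l) (at l)"
proof -
  have "((\<lambda>l. integral (cbox (-1) 1) (\<lambda>\<theta>. \<theta> ^ k * exp (l * \<theta>))) has_field_derivative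
      integral (cbox (-1) 1) (\<lambda>\<theta>. \<theta> ^ Suc k * exp (l * \<theta>))) (at l within UNIV)"
  proof (rule leibniz_rule_field_derivative)
    show "((\<lambda>x. t ^ k * exp (x * t)) has_real_derivative t ^ Suc k * exp (x * t)) (at x within UNIV)" for x t :: real
      by (auto intro!: derivative_eq_intros)
    show "continuous_on (UNIV \<times> cbox (-1) 1) (\<lambda>(x, t). t ^ Suc k * exp (x * t :: real))"
      unfolding split_beta by (intro continuous_intros)
  qed (use exp_moment_integrable in auto)
  from DERIV_cdivide[OF this, of 2] show ?thesis by (simp add: exp_moment_def[abs_def])
qed

text \<open>On the subinterval of length 1/2 adjacent to the endpoint with the sign of
  \<open>l\<close>, the exponent is at least half of \<open>\<bar>l\<bar>\<close>. This crude bound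
  is the source of all exponential decay in \<lambda>.\<close>

lemma exp_moment_lower: "exp_moment 0 l \<ge> exp (\<bar>l\<bar> / 2) / 4"
proof -
  have *: "integral {-1..1} (\<lambda>\<theta>. exp (l * \<theta>)) \<ge> exp (\<bar>l\<bar> / 2) / 2"
    if "{a..a + 1/2} \<subseteq> {-1..1}" "\<And>\<theta>. \<theta> \<in> {a..a + 1/2} \<Longrightarrow> \<bar>l\<bar> / 2 \<le> l * \<theta>" for a :: real
  proof -
    have "exp (\<bar>l\<bar> / 2) / 2 = integral {a..a + 1/2} (\<lambda>\<theta>. exp (\<bar>l\<bar> / 2))" by simp
    also have "\<dots> \<le> integral {a..a + 1/2} (\<lambda>\<theta>. exp (l * \<theta>))"
      using that(2) by (intro integral_le integrable_continuous_interval continuous_intros) auto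
    also have "\<dots> \<le> integral {-1..1} (\<lambda>\<theta>. exp (l * \<theta>))"
      using that(1) by (intro integral_subset_le integrable_continuous_interval continuous_intros) auto
    finally show ?thesis .
  qed
  have "integral {-1..1} (\<lambda>\<theta>. exp (l * \<theta>)) \<ge> exp (\<bar>l\<bar> / 2) / 2"
  proof (cases "l \<ge> 0")
    case True
    show ?thesis
    proof (rule *[of "1/2"])
      show "\<bar>l\<bar> / 2 \<le> l * \<theta>" if "\<theta> \<in> {1/2..1/2 + 1/2}" for \<theta>
        using mult_left_mono[of "1/2" \<theta> l] that True by simp
    qed auto
  next
    case False
    show ?thesis
    proof (rule *[of "-1"])
      show "\<bar>l\<bar> / 2 \<le> l * \<theta>" if "\<theta> \<in> {-1..-1 + 1/2}" for \<theta>
        using mult_left_mono_neg[of \<theta> "-1/2" l] that False by simp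
    qed auto
  qed
  then show ?thesis by (simp add: exp_moment_def)
qed

lemma exp_moment_0_pos: "exp_moment 0 l > 0"
  using exp_moment_lower[of l] by (smt (verit) exp_gt_zero divide_pos_pos)

lemma abs_exp_moment_le: "\<bar>exp_moment k l\<bar> \<le> exp_moment 0 l"
proof -
  have "norm (integral {-1..1} (\<lambda>\<theta>. \<theta> ^ k * exp (l * \<theta>))) \<le> integral {-1..1} (\<lambda>\<theta>. \<theta> ^ 0 * exp (l * \<theta>))"
    by (intro integral_norm_bound_integral exp_moment_integrable)
      (auto simp: abs_mult power_abs intro!: mult_left_le_one_le power_le_one)
  then show ?thesis by (simp add: exp_moment_def)
qed

text \<open>The integral of \<open>l * \<theta>\<close> over [-1, 1] is zero and may be subtracted.
  The new integrand is a product of \<open>l * \<theta>\<close> and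
  \<open>exp (l * \<theta>) - 1\<close>, which have the same sign.\<close>

lemma exp_moment_1_nonneg: "l * exp_moment 1 l \<ge> 0"
proof -
  have z: "integral {-1..1} (\<lambda>\<theta>. l * \<theta>) = 0"
    using ident_has_integral[of "-1" "1::real"]
    by (auto intro!: integral_unique has_integral_eq_rhs[OF has_integral_mult_right])
  have "0 \<le> integral {-1..1} (\<lambda>\<theta>. l * (\<theta> ^ 1 * exp (l * \<theta>)))"
    unfolding z[symmetric]
  proof (intro integral_le integrable_continuous_interval continuous_intros)
    fix \<theta> :: real
    have "0 \<le> (l * \<theta>) * (exp (l * \<theta>) - 1)"
      by (cases "l * \<theta> \<ge> 0") (auto intro: mult_nonneg_nonneg mult_nonpos_nonpos)
    then show "l * \<theta> \<le> l * (\<theta> ^ 1 * exp (l * \<theta>))" by (simp add: algebra_simps)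
  qed
  then show ?thesis by (simp add: exp_moment_def)
qed

text \<open>Integrate the derivative of \<open>(\<theta>\<^sup>2 - 1) e\<^bsup>\<lambda>\<theta>\<^esup>\<close> over \<open>[-1, 1]\<close>.\<close>

lemma exp_moment_ode: "l * exp_moment 2 l + 2 * exp_moment 1 l = l * exp_moment 0 l"
proof -
  have "((\<lambda>\<theta>. 2 * (\<theta> ^ 1 * exp (l * \<theta>)) + l * (\<theta> ^ 2 * exp (l * \<theta>)) - l * (\<theta> ^ 0 * exp (l * \<theta>)))
    has_integral (1\<^sup>2 - 1) * exp (l * 1) - ((-1)\<^sup>2 - 1) * exp (l * (-1))) {-1..1}"
    by (intro fundamental_theorem_of_calculus)
      (auto intro!: derivative_eq_intros simp: has_real_derivative_iff_has_vector_derivative[symmetric] algebra_simps power2_eq_square)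
  then have "integral {-1..1} (\<lambda>\<theta>. 2 * (\<theta> ^ 1 * exp (l * \<theta>)) + l * (\<theta> ^ 2 * exp (l * \<theta>)) - l * (\<theta> ^ 0 * exp (l * \<theta>))) = 0"
    by (auto dest: integral_unique)
  moreover have "integral {-1..1} (\<lambda>\<theta>. 2 * (\<theta> ^ 1 * exp (l * \<theta>)) + l * (\<theta> ^ 2 * exp (l * \<theta>)) - l * (\<theta> ^ 0 * exp (l * \<theta>)))
    = 2 * integral {-1..1} (\<lambda>\<theta>. \<theta> ^ 1 * exp (l * \<theta>)) + l * integral {-1..1} (\<lambda>\<theta>. \<theta> ^ 2 * exp (l * \<theta>))
      - l * integral {-1..1} (\<lambda>\<theta>. \<theta> ^ 0 * exp (l * \<theta>))"
    by (subst integral_diff integral_add integral_mult_right;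
        (intro integrable_add integrable_on_mult_right exp_moment_integrable)?)+ simp
  ultimately show ?thesis by (simp add: exp_moment_def)
qed

lemma exp_moment_minus: "exp_moment k (- l) = (- 1) ^ k * exp_moment k l"
proof -
  have "integral {-1..1} (\<lambda>\<theta>. \<theta> ^ k * exp (- l * \<theta>)) = integral {-1..1} (\<lambda>\<theta>. (- \<theta>) ^ k * exp (- l * (- \<theta>)))"
    using Henstock_Kurzweil_Integration.integral_reflect_real[of 1 "-1" "\<lambda>\<theta>. \<theta> ^ k * exp (- l * \<theta>)"] by simp
  also have "\<dots> = integral {-1..1} (\<lambda>\<theta>. (-1) ^ k * (\<theta> ^ k * exp (l * \<theta>)))"
    by (intro integral_cong) (subst power_minus, simp)
  finally show ?thesis by (simp add: exp_moment_def)
qed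

text \<open>\<open>mratio 1\<close> is the logarithmic derivative of sinh \<lambda> / \<lambda>,
  that is, coth \<lambda> - 1/\<lambda>, so that \<open>l_coth\<close> is \<lambda> coth \<lambda>
  without a division by \<lambda>. The ratios are bounded by 1, and their derivatives are
  polynomials in them.\<close>

definition mratio :: "nat \<Rightarrow> real \<Rightarrow> real"
  where "mratio k l = exp_moment k l / exp_moment 0 l"

definition l_sinh :: "real \<Rightarrow> real"
  where "l_sinh l = 1 / exp_moment 0 l"

definition l_coth :: "real \<Rightarrow> real"
  where "l_coth l = 1 + l * mratio 1 l"

text \<open>The derivative of \<open>l_coth\<close>, already simplified by the second order equation
  for sinh \<lambda> / \<lambda>. In this form the Riccati identity behind the heat equation becomes
  plain algebra.\<close>

definition l_coth' :: "real \<Rightarrow> real"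
  where "l_coth' l = l - mratio 1 l * l_coth l"

lemma abs_mratio_le: "\<bar>mratio k l\<bar> \<le> 1"
  using abs_exp_moment_le[of k l] exp_moment_0_pos[of l] by (simp add: mratio_def)

lemma mratio_deriv:
  "(mratio k has_real_derivative mratio (Suc k) l - mratio k l * mratio 1 l) (at l)"
proof -
  have "((\<lambda>l. exp_moment k l / exp_moment 0 l) has_real_derivative
    mratio (Suc k) l - mratio k l * mratio 1 l) (at l)"
    using exp_moment_0_pos[of l] unfolding mratio_def
    by (auto intro!: derivative_eq_intros exp_moment_deriv simp: field_simps)
  then show ?thesis by (simp add: mratio_def[abs_def])
qed

lemma l_sinh_deriv: "(l_sinh has_real_derivative - l_sinh l * mratio 1 l) (at l)"
proof -
  have "((\<lambda>l. 1 / exp_moment 0 l) has_real_derivative - l_sinh l * mratio 1 l) (at l)"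
    using exp_moment_0_pos[of l] unfolding mratio_def l_sinh_def
    by (auto intro!: derivative_eq_intros exp_moment_deriv simp: field_simps)
  then show ?thesis by (simp add: l_sinh_def[abs_def])
qed

lemma l_sinh_pos: "l_sinh l > 0"
  using exp_moment_0_pos[of l] by (simp add: l_sinh_def)

lemma l_sinh_le: "l_sinh l \<le> 4 * exp (- \<bar>l\<bar> / 2)"
proof -
  have "l_sinh l \<le> 1 / (exp (\<bar>l\<bar> / 2) / 4)"
    unfolding l_sinh_def by (intro divide_left_mono exp_moment_lower) (auto simp: exp_moment_0_pos)
  then show ?thesis by (simp add: exp_minus field_simps)
qed

lemma mratio_ode: "l * mratio 2 l = l - 2 * mratio 1 l"
  using exp_moment_ode[of l] exp_moment_0_pos[of l] by (simp add: mratio_def field_simps)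

lemma l_coth_ge_1: "l_coth l \<ge> 1"
  using exp_moment_1_nonneg[of l] exp_moment_0_pos[of l] by (simp add: l_coth_def mratio_def)

lemma l_coth_deriv: "(l_coth has_real_derivative l_coth' l) (at l)"
proof -
  have "((\<lambda>l. 1 + l * mratio 1 l) has_real_derivative mratio 1 l + l * (mratio 2 l - mratio 1 l * mratio 1 l)) (at l)"
    using mratio_deriv[of 1 l] by (auto intro!: derivative_eq_intros simp: numeral_2_eq_2)
  moreover have "mratio 1 l + l * (mratio 2 l - mratio 1 l * mratio 1 l) = l_coth' l"
    using mratio_ode[of l] by (simp add: l_coth'_def l_coth_def algebra_simps)
  ultimately show ?thesis by (simp add: l_coth_def[abs_def])
qed

lemma l_coth_identity: "l_coth l - l * l_coth' l = (l_coth l)\<^sup>2 - l\<^sup>2"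
  by (simp add: l_coth'_def l_coth_def algebra_simps power2_eq_square)

lemma l_sinh_minus: "l_sinh (- l) = l_sinh l"
  by (simp add: l_sinh_def exp_moment_minus)

lemma l_coth_minus: "l_coth (- l) = l_coth l"
  by (simp add: l_coth_def mratio_def exp_moment_minus)

text \<open>An algebra stable under differentiation that contains \<lambda> coth \<lambda> and its
  derivative. Its members grow at most polynomially, so a positive power of \<open>l_sinh\<close>
  makes them integrable.\<close>

inductive amplitude :: "(real \<Rightarrow> real) \<Rightarrow> bool" where
  const: "amplitude (\<lambda>l. c)"
| ident: "amplitude (\<lambda>l. l)"
| mratio: "amplitude (\<lambda>l. mratio k l)"
| add: "amplitude r \<Longrightarrow> amplitude r' \<Longrightarrow> amplitude (\<lambda>l. r l + r' l)"
| mult: "amplitude r \<Longrightarrow> amplitude r' \<Longrightarrow> amplitude (\<lambda>l. r l * r' l)"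

lemma amplitude_diff: "amplitude r \<Longrightarrow> amplitude r' \<Longrightarrow> amplitude (\<lambda>l. r l - r' l)"
  using amplitude.add[OF _ amplitude.mult[OF amplitude.const[of "-1"]], of r r'] by simp

lemma amplitude_l_coth: "amplitude l_coth"
  unfolding l_coth_def[abs_def] by (intro amplitude.intros)

lemma amplitude_l_coth': "amplitude l_coth'"
  unfolding l_coth'_def[abs_def] using amplitude_l_coth by (intro amplitude.intros amplitude_diff)

lemma amplitude_deriv:
  "amplitude r \<Longrightarrow> \<exists>r'. amplitude r' \<and> (\<forall>l. (r has_real_derivative r' l) (at l))"
proof (induction rule: amplitude.induct)
  case (const c)
  then show ?case by (intro exI[of _ "\<lambda>l. 0"]) (auto intro: amplitude.const)
next
  case ident
  then show ?case by (intro exI[of _ "\<lambda>l. 1"]) (auto intro: amplitude.const)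
next
  case (mratio k)
  have "amplitude (\<lambda>l. mratio (Suc k) l - mratio k l * mratio 1 l)"
    by (intro amplitude_diff amplitude.mratio amplitude.mult)
  then show ?case using mratio_deriv[of k] by blast
next
  case (add r s)
  then obtain r' s' where "amplitude r'" "\<forall>l. (r has_real_derivative r' l) (at l)"
    "amplitude s'" "\<forall>l. (s has_real_derivative s' l) (at l)" by blast
  then show ?case
    by (intro exI[of _ "\<lambda>l. r' l + s' l"]) (auto intro!: amplitude.add derivative_eq_intros)
next
  case (mult r s)
  then obtain r' s' where "amplitude r'" "\<forall>l. (r has_real_derivative r' l) (at l)"
    "amplitude s'" "\<forall>l. (s has_real_derivative s' l) (at l)" by blast
  then show ?case using mult.hyps
    by (intro exI[of _ "\<lambda>l. r' l * s l + s' l * r l"])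
      (auto intro!: amplitude.add amplitude.mult[of r'] amplitude.mult[of s'] derivative_eq_intros)
qed

lemma amplitude_continuous: "amplitude r \<Longrightarrow> continuous_on UNIV r"
  using amplitude_deriv[of r] by (auto intro!: DERIV_continuous_on simp: continuous_on_eq_continuous_within intro: DERIV_isCont)

lemma amplitude_bound: "amplitude r \<Longrightarrow> \<exists>C m. 0 \<le> C \<and> (\<forall>l. \<bar>r l\<bar> \<le> C * (1 + \<bar>l\<bar>) ^ m)"
proof (induction rule: amplitude.induct)
  case (const c)
  then show ?case by (intro exI[of _ "\<bar>c\<bar>"] exI[of _ 0]) auto
next
  case ident
  then show ?case by (intro exI[of _ 1] exI[of _ 1]) auto
next
  case (mratio k)
  then show ?case by (intro exI[of _ 1] exI[of _ 0]) (auto simp: abs_mratio_le)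
next
  case (add r s)
  then obtain C m D n where *: "0 \<le> C" "\<And>l. \<bar>r l\<bar> \<le> C * (1 + \<bar>l\<bar>) ^ m"
    "0 \<le> D" "\<And>l. \<bar>s l\<bar> \<le> D * (1 + \<bar>l\<bar>) ^ n" by blast
  have "\<bar>r l + s l\<bar> \<le> (C + D) * (1 + \<bar>l\<bar>) ^ (m + n)" for l
  proof -
    have "C * (1 + \<bar>l\<bar>) ^ m \<le> C * (1 + \<bar>l\<bar>) ^ (m + n)" "D * (1 + \<bar>l\<bar>) ^ n \<le> D * (1 + \<bar>l\<bar>) ^ (m + n)"
      using * by (auto intro!: mult_left_mono power_increasing)
    then show ?thesis using *(2)[of l] *(4)[of l] unfolding distrib_right by linarith
  qed
  then show ?case using * by (intro exI[of _ "C + D"] exI[of _ "m + n"]) auto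
next
  case (mult r s)
  then obtain C m D n where *: "0 \<le> C" "\<And>l. \<bar>r l\<bar> \<le> C * (1 + \<bar>l\<bar>) ^ m"
    "0 \<le> D" "\<And>l. \<bar>s l\<bar> \<le> D * (1 + \<bar>l\<bar>) ^ n" by blast
  have "\<bar>r l * s l\<bar> \<le> (C * D) * (1 + \<bar>l\<bar>) ^ (m + n)" for l
    using mult_mono[OF *(2)[of l] *(4)[of l]] *(1,3) by (simp add: abs_mult power_add mult_ac)
  then show ?case using * by (intro exI[of _ "C * D"] exI[of _ "m + n"]) auto
qed

text \<open>With n = k + 1, the inequality (1 + y/n)^n <= exp y is applied to y = x/2, after 1 + x
  <= 2n (1 + x/(2n)). This is the origin of the constant.\<close>

lemma poly_exp_bound:
  assumes "x \<ge> 0"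
  shows "(1 + x) ^ Suc k * exp (- x / 2) \<le> real (2 * Suc k) ^ Suc k"
proof -
  have "(1 + x) ^ Suc k \<le> (real (2 * Suc k) * (1 + (x/2) / Suc k)) ^ Suc k"
    using assms by (intro power_mono) (auto simp: field_simps)
  also have "\<dots> \<le> real (2 * Suc k) ^ Suc k * exp (x / 2)"
    unfolding power_mult_distrib[of "real (2 * Suc k)"]
    using exp_ge_one_plus_x_over_n_power_n[of "Suc k" "x/2"] assms
    by (intro mult_left_mono) auto
  finally have "(1 + x) ^ Suc k * exp (- x / 2) \<le> real (2 * Suc k) ^ Suc k * exp (x / 2) * exp (- x / 2)"
    by (intro mult_right_mono) auto
  then show ?thesis by (simp add: mult.assoc exp_add[symmetric])
qed

text \<open>The majorant serves twice: it is integrable, and it tends to 0 at both ends, which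
  removes the boundary terms of the integration by parts. Since \<open>n\<close> is positive, one
  exponential factor always remains.\<close>

lemma amplitude_decay:
  assumes "amplitude r" "n \<ge> 1"
  shows "\<exists>C. \<forall>l. \<bar>l_sinh l ^ n * r l\<bar> \<le> C * (1 / (1 + l\<^sup>2))"
proof -
  obtain C m where C: "0 \<le> C" "\<And>l. \<bar>r l\<bar> \<le> C * (1 + \<bar>l\<bar>) ^ m" using amplitude_bound[OF assms(1)] by blast
  \<comment> \<open>The exponent is m + 2: two powers beyond the growth of \<open>r\<close> absorb
    the factor 1 + l^2.\<close>
  define K where "K = real (2 * Suc (m + 1)) ^ Suc (m + 1)"
  have "\<bar>l_sinh l ^ n * r l\<bar> \<le> (4 ^ n * C * K) * (1 / (1 + l\<^sup>2))" for l
  proof -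
    have e: "exp (- \<bar>l\<bar> / 2) \<le> 1" by simp
    have "l_sinh l ^ n \<le> (4 * exp (- \<bar>l\<bar> / 2)) ^ n"
      using l_sinh_le[of l] l_sinh_pos[of l] by (intro power_mono) auto
    also have "\<dots> \<le> 4 ^ n * exp (- \<bar>l\<bar> / 2)"
      unfolding power_mult_distrib using power_decreasing[OF assms(2) _ e] by simp
    finally have s: "l_sinh l ^ n \<le> 4 ^ n * exp (- \<bar>l\<bar> / 2)" .
    have b: "\<bar>l_sinh l ^ n * r l\<bar> \<le> (4 ^ n * exp (- \<bar>l\<bar> / 2)) * (C * (1 + \<bar>l\<bar>) ^ m)"
      using s C l_sinh_pos[of l] by (auto simp: abs_mult intro!: mult_mono)
    have pos: "1 + l\<^sup>2 > 0" by (simp add: add_pos_nonneg)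
    have "(1 + l\<^sup>2) * ((4 ^ n * exp (- \<bar>l\<bar> / 2)) * (C * (1 + \<bar>l\<bar>) ^ m)) \<le> 4 ^ n * C * K"
    proof -
      have "(1 + l\<^sup>2) \<le> (1 + \<bar>l\<bar>)\<^sup>2" by (simp add: power2_eq_square algebra_simps)
      then have "(1 + l\<^sup>2) * ((4 ^ n * exp (- \<bar>l\<bar> / 2)) * (C * (1 + \<bar>l\<bar>) ^ m)) \<le>
          (1 + \<bar>l\<bar>)\<^sup>2 * ((4 ^ n * exp (- \<bar>l\<bar> / 2)) * (C * (1 + \<bar>l\<bar>) ^ m))"
        using C by (intro mult_right_mono) auto
      also have "\<dots> = 4 ^ n * C * ((1 + \<bar>l\<bar>) ^ Suc (m + 1) * exp (- \<bar>l\<bar> / 2))"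
        by (simp add: power2_eq_square mult_ac)
      also have "\<dots> \<le> 4 ^ n * C * K"
        using poly_exp_bound[of "\<bar>l\<bar>" "m + 1"] C unfolding K_def by (intro mult_left_mono) auto
      finally show ?thesis .
    qed
    with pos have "(4 ^ n * exp (- \<bar>l\<bar> / 2)) * (C * (1 + \<bar>l\<bar>) ^ m) \<le> (4 ^ n * C * K) * (1 / (1 + l\<^sup>2))"
      by (simp add: pos_le_divide_eq mult.commute)
    with b show ?thesis by linarith
  qed
  then show ?thesis by blast
qed

section \<open>The heat kernel\<close>

text \<open>\<open>heat_kernel_int (\<lambda>l. 1)\<close> is, up to normalisation, the heat kernel at time \<open>1\<close>: by Mehler's
  formula its partial Fourier transform in \<open>s\<close> at frequency \<open>\<lambda> / 4\<close> is proportional to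
  \<open>(\<lambda> / sinh \<lambda>)\<^sup>d e\<^bsup>- \<lambda> coth \<lambda> |z|\<^sup>2 / 4\<^esup>\<close>.\<close>

definition heat_integrand :: "(real \<Rightarrow> real) \<Rightarrow> real \<Rightarrow> 'd::finite heis \<Rightarrow> complex"
  where "heat_integrand r l w = complex_of_real (l_sinh l ^ CARD('d) * r l) *
    exp (complex_of_real (- (l_coth l * (fst w \<bullet> fst w) / 4)) + \<i> * complex_of_real (l * snd w / 4))"

definition heat_kernel_int :: "(real \<Rightarrow> real) \<Rightarrow> 'd::finite heis \<Rightarrow> complex"
  where "heat_kernel_int r w = (\<integral>l. heat_integrand r l w \<partial>lborel)"

lemma l_sinh_continuous: "continuous_on A l_sinh"
  by (rule DERIV_continuous_on[OF has_field_derivative_at_within[OF l_sinh_deriv]])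

lemma continuous_heat_integrand:
  assumes "amplitude r"
  shows "continuous_on A (\<lambda>l. heat_integrand r l w)"
proof -
  note [continuous_intros] = continuous_on_subset[OF amplitude_continuous[OF assms] subset_UNIV]
    l_sinh_continuous continuous_on_subset[OF amplitude_continuous[OF amplitude_l_coth] subset_UNIV]
  show ?thesis unfolding heat_integrand_def by (intro continuous_intros) auto
qed

lemma norm_heat_integrand:
  "norm (heat_integrand r l (w::'d::finite heis)) =
    \<bar>l_sinh l ^ CARD('d) * r l\<bar> * exp (- (l_coth l * (fst w \<bullet> fst w) / 4))"
  by (simp add: heat_integrand_def norm_mult del: of_real_mult of_real_power)

text \<open>Since \<lambda> coth \<lambda> >= 1, the Gaussian in z can be taken independent of
  \<lambda>. It gives the decay of the kernel in z; decay in s can only come from the oscillating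
  phase, which the norm ignores.\<close>

lemma norm_heat_integrand_le:
  "norm (heat_integrand r l (w::'d::finite heis)) \<le>
    \<bar>l_sinh l ^ CARD('d) * r l\<bar> * exp (- ((norm (fst w))\<^sup>2 / 4))"
  unfolding norm_heat_integrand
proof (intro mult_left_mono)
  have "1 * (fst w \<bullet> fst w) \<le> l_coth l * (fst w \<bullet> fst w)"
    by (intro mult_right_mono l_coth_ge_1) auto
  then show "exp (- (l_coth l * (fst w \<bullet> fst w) / 4)) \<le> exp (- ((norm (fst w))\<^sup>2 / 4))"
    by (simp add: power2_norm_eq_inner)
qed simp

lemma integrable_amplitude:
  assumes "amplitude r" "n \<ge> 1"
  shows "integrable lborel (\<lambda>l. \<bar>l_sinh l ^ n * r l\<bar>)"
proof -
  obtain C where C: "\<And>l. \<bar>l_sinh l ^ n * r l\<bar> \<le> C * (1 / (1 + l\<^sup>2))"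
    using amplitude_decay[OF assms] by blast
  show ?thesis
  proof (rule integrable_dominated[OF integrable_mult_right[OF integrable_inverse_1_plus_square_lborel]])
    show "(\<lambda>l. \<bar>l_sinh l ^ n * r l\<bar>) \<in> borel_measurable lborel"
      using borel_measurable_continuous_onI[OF amplitude_continuous[OF assms(1)]]
        borel_measurable_continuous_onI[OF l_sinh_continuous] by measurable
    show "norm \<bar>l_sinh l ^ n * r l\<bar> \<le> C * (1 / (1 + l\<^sup>2))" for l
      unfolding real_norm_def abs_idempotent by (rule C)
  qed
qed

lemma card_ge_1: "CARD('d::finite) \<ge> 1"
  by (simp add: Suc_leI)

lemma heat_integrand_measurable:
  "amplitude r \<Longrightarrow> (\<lambda>l. heat_integrand r l w) \<in> borel_measurable lborel"
  using borel_measurable_continuous_onI[OF continuous_heat_integrand] by simp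

lemma integrable_heat_integrand:
  fixes w :: "'d::finite heis"
  assumes "amplitude r"
  shows "integrable lborel (\<lambda>l. heat_integrand r l w)"
proof (rule integrable_dominated[OF integrable_amplitude[OF assms card_ge_1[where 'd='d]]])
  show "norm (heat_integrand r l w) \<le> \<bar>l_sinh l ^ CARD('d) * r l\<bar>" for l
    by (intro order_trans[OF norm_heat_integrand_le]) (simp add: mult_left_le)
qed (rule heat_integrand_measurable[OF assms])

lemma heat_kernel_int_add:
  assumes "amplitude r" "amplitude r'"
  shows "heat_kernel_int (\<lambda>l. r l + r' l) w = heat_kernel_int r w + heat_kernel_int r' w"
proof -
  have "heat_integrand (\<lambda>l. r l + r' l) l w = heat_integrand r l w + heat_integrand r' l w" for l
    by (simp add: heat_integrand_def algebra_simps)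
  then show ?thesis unfolding heat_kernel_int_def
    by (simp add: integrable_heat_integrand[OF assms(1)] integrable_heat_integrand[OF assms(2)])
qed

lemma heat_kernel_int_cmult:
  "heat_kernel_int (\<lambda>l. c * r l) w = complex_of_real c * heat_kernel_int r w"
proof -
  have "heat_integrand (\<lambda>l. c * r l) l w = complex_of_real c * heat_integrand r l w" for l
    by (simp add: heat_integrand_def algebra_simps)
  then show ?thesis unfolding heat_kernel_int_def by simp
qed

text \<open>The phase contributes a factor i \<lambda>/4 and the Gaussian a factor -\<lambda> coth
  \<lambda> / 2 times a linear form in z. Both factors in \<lambda> are amplitudes, so
  differentiation leads back to integrals of the same kind.\<close>

lemma heat_kernel_int_has_derivative:
  fixes w :: "'d::finite heis"
  assumes r: "amplitude r"
  shows "(heat_kernel_int r has_derivative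
    (\<lambda>v. \<i> / 4 * complex_of_real (snd v) * heat_kernel_int (\<lambda>l. l * r l) w
      - 1 / 2 * complex_of_real (fst w \<bullet> fst v) * heat_kernel_int (\<lambda>l. l_coth l * r l) w)) (at w)"
proof -
  let ?r1 = "\<lambda>l. l * r l" and ?r2 = "\<lambda>l. l_coth l * r l"
  have r1: "amplitude ?r1" and r2: "amplitude ?r2"
    by (intro amplitude.intros amplitude_l_coth r)+
  define D where "D w l v = \<i> / 4 * complex_of_real (snd v) * heat_integrand ?r1 l w
    - 1 / 2 * complex_of_real (fst w \<bullet> fst v) * heat_integrand ?r2 l w" for w v :: "'d heis" and l
  define G where "G l = \<bar>l_sinh l ^ CARD('d) * ?r1 l\<bar> + \<bar>l_sinh l ^ CARD('d) * ?r2 l\<bar>" for l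
  have der: "((\<lambda>w. heat_integrand r l w) has_derivative D w l) (at w)" for w :: "'d heis" and l
  proof -
    have "((\<lambda>w. complex_of_real (- (l_coth l * (fst w \<bullet> fst w) / 4)) + \<i> * complex_of_real (l * snd w / 4))
      has_derivative (\<lambda>v. complex_of_real (- (l_coth l * (fst w \<bullet> fst v) / 2)) + \<i> * complex_of_real (l * snd v / 4))) (at w)"
      by (auto intro!: derivative_eq_intros simp: inner_commute)
    from has_derivative_mult_right[OF has_derivative_compose[OF this DERIV_exp[unfolded has_field_derivative_def]],
        of "complex_of_real (l_sinh l ^ CARD('d) * r l)"]
    show ?thesis
      unfolding heat_integrand_def
      by (rule has_derivative_eq_rhs) (simp add: D_def heat_integrand_def fun_eq_iff algebra_simps)
  qed
  have bd: "norm (D w l v) \<le> G l * norm v" for w v l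
  proof -
    \<comment> \<open>The derivative in z carries a factor that is linear in z. The Gaussian absorbs
      it, which makes the majorant \<open>G\<close> independent of the point
      \<open>w\<close>.\<close>
    have x: "x / 2 * exp (- (x\<^sup>2 / 4)) \<le> 1" if "x \<ge> 0" for x :: real
    proof -
      have "x / 2 \<le> 1 + x\<^sup>2 / 4"
        using zero_le_power2[of "x / 2 - 1/2"] by (simp add: power2_eq_square algebra_simps)
      also have "\<dots> \<le> exp (x\<^sup>2 / 4)" by (rule exp_ge_add_one_self)
      finally show ?thesis by (simp add: exp_minus field_simps)
    qed
    have v: "norm (fst v) \<le> norm v" "\<bar>snd v\<bar> \<le> norm v"
      using norm_fst_le[of "fst v" "snd v"] norm_snd_le[of "snd v" "fst v"] by simp_all
    have e: "norm (heat_integrand ?r1 l w) \<le> \<bar>l_sinh l ^ CARD('d) * ?r1 l\<bar>"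
      by (rule order_trans[OF norm_heat_integrand_le]) (auto intro!: mult_left_le)
    have "norm (D w l v) \<le> norm (\<i> / 4 * complex_of_real (snd v) * heat_integrand ?r1 l w) +
        norm (1 / 2 * complex_of_real (fst w \<bullet> fst v) * heat_integrand ?r2 l w)"
      unfolding D_def by (rule norm_triangle_ineq4)
    also have "\<dots> = \<bar>snd v\<bar> / 4 * norm (heat_integrand ?r1 l w) +
        \<bar>fst w \<bullet> fst v\<bar> / 2 * norm (heat_integrand ?r2 l w)"
      by (simp add: norm_mult)
    also have "\<dots> \<le> norm v * \<bar>l_sinh l ^ CARD('d) * ?r1 l\<bar> + norm v * \<bar>l_sinh l ^ CARD('d) * ?r2 l\<bar>"
    proof (rule add_mono)
      show "\<bar>snd v\<bar> / 4 * norm (heat_integrand ?r1 l w) \<le> norm v * \<bar>l_sinh l ^ CARD('d) * ?r1 l\<bar>"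
        using v e by (intro mult_mono) auto
      have "\<bar>fst w \<bullet> fst v\<bar> / 2 * norm (heat_integrand ?r2 l w) \<le>
         (norm (fst w) * norm v) / 2 * (\<bar>l_sinh l ^ CARD('d) * ?r2 l\<bar> * exp (- ((norm (fst w))\<^sup>2 / 4)))"
        using v order_trans[OF Cauchy_Schwarz_ineq2[of "fst w" "fst v"] mult_left_mono[OF v(1), of "norm (fst w)"]]
        by (intro mult_mono norm_heat_integrand_le) auto
      also have "\<dots> = norm v * \<bar>l_sinh l ^ CARD('d) * ?r2 l\<bar> * (norm (fst w) / 2 * exp (- ((norm (fst w))\<^sup>2 / 4)))"
        by simp
      also have "\<dots> \<le> norm v * \<bar>l_sinh l ^ CARD('d) * ?r2 l\<bar> * 1"
        by (intro mult_left_mono x) auto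
      finally show "\<bar>fst w \<bullet> fst v\<bar> / 2 * norm (heat_integrand ?r2 l w) \<le> norm v * \<bar>l_sinh l ^ CARD('d) * ?r2 l\<bar>"
        by simp
    qed
    finally show ?thesis by (simp add: G_def algebra_simps)
  qed
  have "((\<lambda>w. \<integral>l. heat_integrand r l w \<partial>lborel) has_derivative (\<lambda>v. \<integral>l. D w l v \<partial>lborel)) (at w)"
  proof (rule has_derivative_integral_dominated[OF _ der _ bd])
    show "(\<lambda>l. D w l v) \<in> borel_measurable lborel" for w v
      unfolding D_def using heat_integrand_measurable[OF r1] heat_integrand_measurable[OF r2] by measurable
    show "integrable lborel G"
      unfolding G_def[abs_def] by (intro Bochner_Integration.integrable_add integrable_amplitude r1 r2 card_ge_1)
  qed (rule integrable_heat_integrand[OF r])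
  moreover have "(\<integral>l. D w l v \<partial>lborel) = \<i> / 4 * complex_of_real (snd v) * heat_kernel_int ?r1 w
      - 1 / 2 * complex_of_real (fst w \<bullet> fst v) * heat_kernel_int ?r2 w" for v
    unfolding D_def heat_kernel_int_def
    using integrable_heat_integrand[OF r1, of w] integrable_heat_integrand[OF r2, of w] by simp
  ultimately show ?thesis by (simp add: heat_kernel_int_def[abs_def])
qed

text \<open>Integration by parts in \<open>\<lambda>\<close>.\<close>

lemma heat_kernel_int_snd:
  fixes w :: "'d::finite heis"
  assumes r: "amplitude r" "amplitude r'" "\<And>l. (r has_real_derivative r' l) (at l)"
  shows "complex_of_real (snd w) * heat_kernel_int r w =
    4 * \<i> * heat_kernel_int (\<lambda>l. r' l - real CARD('d) * mratio 1 l * r l) w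
    - \<i> * complex_of_real (fst w \<bullet> fst w) * heat_kernel_int (\<lambda>l. l_coth' l * r l) w"
proof -
  define n where "n = CARD('d)"
  have n: "n \<ge> 1" "real n > 0" unfolding n_def by (auto simp: Suc_leI)
  let ?r1 = "\<lambda>l. r' l - real n * mratio 1 l * r l" and ?r2 = "\<lambda>l. l_coth' l * r l"
  have r1: "amplitude ?r1" and r2: "amplitude ?r2"
    by (intro amplitude.intros amplitude_diff amplitude_l_coth' r)+
  \<comment> \<open>The \<lambda>-derivative of the integrand: \<open>?r1\<close> comes from the
    amplitude together with the power of \<open>l_sinh\<close>, \<open>?r2\<close> from the Gaussian
    exponent, and the last term, the one to be solved for, from the phase.\<close>
  define F' where "F' l = heat_integrand ?r1 l w - complex_of_real (fst w \<bullet> fst w) / 4 * heat_integrand ?r2 l w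
    + \<i> * complex_of_real (snd w) / 4 * heat_integrand r l w" for l
  have a: "((\<lambda>l. l_sinh l ^ n * r l) has_real_derivative l_sinh l ^ n * ?r1 l) (at l)" for l
  proof -
    have "l_sinh l ^ n = l_sinh l ^ (n - 1) * l_sinh l" using n by (metis power_minus_mult zero_less_iff_neq_zero not_one_le_zero)
    then show ?thesis
      by (auto intro!: derivative_eq_intros l_sinh_deriv r(3) simp: algebra_simps)
  qed
  have b: "((\<lambda>l. - (l_coth l * (fst w \<bullet> fst w) / 4)) has_real_derivative - (l_coth' l * (fst w \<bullet> fst w) / 4)) (at l)" for l
    by (intro DERIV_minus DERIV_cdivide DERIV_cmult_right l_coth_deriv)
  have c: "((\<lambda>l. \<i> * complex_of_real (l * snd w / 4)) has_vector_derivative \<i> * complex_of_real (snd w / 4)) (at l)" for l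
    by (auto intro!: derivative_eq_intros)
  have der: "((\<lambda>l. heat_integrand r l w) has_vector_derivative F' l) (at l)" for l
  proof -
    let ?E = "\<lambda>l. complex_of_real (- (l_coth l * (fst w \<bullet> fst w) / 4)) + \<i> * complex_of_real (l * snd w / 4)"
    have "(?E has_vector_derivative
      (complex_of_real (- (l_coth' l * (fst w \<bullet> fst w) / 4)) + \<i> * complex_of_real (snd w / 4))) (at l)"
      by (intro has_vector_derivative_add c has_vector_derivative_of_real[OF b])
    then have "((\<lambda>l. exp (?E l)) has_vector_derivative
      (complex_of_real (- (l_coth' l * (fst w \<bullet> fst w) / 4)) + \<i> * complex_of_real (snd w / 4)) * exp (?E l)) (at l)"
      using field_vector_diff_chain_at[of ?E _ l exp "exp (?E l)"] by (simp add: comp_def DERIV_exp)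
    from has_vector_derivative_mult[OF has_vector_derivative_of_real[OF a[of l]] this]
    show ?thesis
      unfolding heat_integrand_def n_def[symmetric] F'_def
      by (rule has_vector_derivative_eq_rhs) (simp add: algebra_simps)
  qed
  have cont: "continuous_on UNIV F'"
    unfolding F'_def by (intro continuous_intros continuous_heat_integrand r r1 r2)
  have int: "integrable lborel F'"
    unfolding F'_def[abs_def] using integrable_heat_integrand[of _ w] r(1) r1 r2 by auto
  obtain C where C: "\<And>l. \<bar>l_sinh l ^ n * r l\<bar> \<le> C * (1 / (1 + l\<^sup>2))"
    using amplitude_decay[OF r(1) n(1)] by blast
  have nle: "norm (heat_integrand r l w) \<le> C * (1 / (1 + l\<^sup>2))" for l
  proof (rule order_trans[OF _ C])
    show "norm (heat_integrand r l w) \<le> \<bar>l_sinh l ^ n * r l\<bar>"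
      unfolding n_def by (rule order_trans[OF norm_heat_integrand_le]) (auto intro!: mult_left_le)
  qed
  have lim: "((\<lambda>l. heat_integrand r l w) \<longlongrightarrow> 0) F" if "((\<lambda>l::real. C * (1 / (1 + l\<^sup>2))) \<longlongrightarrow> 0) F" for F
    by (rule Lim_null_comparison[OF _ that]) (use nle in auto)
  have "((\<lambda>l::real. C * (1 / (1 + l\<^sup>2))) \<longlongrightarrow> 0) at_top" "((\<lambda>l::real. C * (1 / (1 + l\<^sup>2))) \<longlongrightarrow> 0) at_bot"
    by real_asymp+
  then have "(\<integral>l. F' l \<partial>lborel) = 0"
    by (intro integral_deriv_eq_0[OF der cont int] lim)
  also have "(\<integral>l. F' l \<partial>lborel) = heat_kernel_int ?r1 w - complex_of_real (fst w \<bullet> fst w) / 4 * heat_kernel_int ?r2 w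
    + \<i> * complex_of_real (snd w) / 4 * heat_kernel_int r w"
    unfolding F'_def heat_kernel_int_def
    using integrable_heat_integrand[OF r1, of w] integrable_heat_integrand[OF r2, of w]
      integrable_heat_integrand[OF r(1), of w] by simp
  finally have "\<i> * complex_of_real (snd w) / 4 * heat_kernel_int r w =
     complex_of_real (fst w \<bullet> fst w) / 4 * heat_kernel_int ?r2 w - heat_kernel_int ?r1 w"
    by (simp add: algebra_simps add_eq_0_iff)
  then have "(- 4 * \<i>) * (\<i> * complex_of_real (snd w) / 4 * heat_kernel_int r w) =
     (- 4 * \<i>) * (complex_of_real (fst w \<bullet> fst w) / 4 * heat_kernel_int ?r2 w - heat_kernel_int ?r1 w)"
    by simp
  then show ?thesis unfolding n_def by (simp add: algebra_simps)
qed

section \<open>The kernel is a Schwartz function\<close>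

lemma norm_heat_kernel_int_le:
  fixes w :: "'d::finite heis"
  assumes "amplitude r"
  shows "norm (heat_kernel_int r w) \<le>
    (\<integral>l. \<bar>l_sinh l ^ CARD('d) * r l\<bar> \<partial>lborel) * exp (- ((norm (fst w))\<^sup>2 / 4))"
proof -
  note i = integrable_amplitude[OF assms card_ge_1[where 'd='d]]
  have "norm (heat_kernel_int r w) \<le> (\<integral>l. norm (heat_integrand r l w) \<partial>lborel)"
    unfolding heat_kernel_int_def by simp
  also have "\<dots> \<le> (\<integral>l. \<bar>l_sinh l ^ CARD('d) * r l\<bar> * exp (- ((norm (fst w))\<^sup>2 / 4)) \<partial>lborel)"
    by (intro integral_mono integrable_norm integrable_heat_integrand assms norm_heat_integrand_le
        integrable_mult_left i)
  finally show ?thesis using i by simp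
qed

text \<open>Multiplication by s is not among the rules: integration by parts trades it for new
  amplitudes and a factor |z|^2, and thereby derives it from the others.\<close>

inductive heat_class :: "('d::finite heis \<Rightarrow> complex) \<Rightarrow> bool" where
  base: "amplitude r \<Longrightarrow> heat_class (heat_kernel_int r)"
| add: "heat_class f \<Longrightarrow> heat_class g \<Longrightarrow> heat_class (\<lambda>w. f w + g w)"
| cmult: "heat_class f \<Longrightarrow> heat_class (\<lambda>w. c * f w)"
| zmult: "heat_class f \<Longrightarrow> heat_class (\<lambda>w. complex_of_real (fst w \<bullet> e) * f w)"

lemma heat_class_diff: "heat_class f \<Longrightarrow> heat_class g \<Longrightarrow> heat_class (\<lambda>w. f w - g w)"
  using heat_class.add[OF _ heat_class.cmult[of g "-1"], of f] by simp

lemma heat_class_sum: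
  "finite A \<Longrightarrow> A \<noteq> {} \<Longrightarrow> (\<And>i. i \<in> A \<Longrightarrow> heat_class (f i)) \<Longrightarrow> heat_class (\<lambda>w. \<Sum>i\<in>A. f i w)"
proof (induction A rule: finite_ne_induct)
  case (insert i A)
  then have "heat_class (\<lambda>w. f i w + (\<Sum>i\<in>A. f i w))" by (intro heat_class.add) auto
  then show ?case using insert by simp
qed simp

lemma heat_class_sqnorm:
  fixes f :: "'d::finite heis \<Rightarrow> complex"
  assumes "heat_class f"
  shows "heat_class (\<lambda>w. complex_of_real (fst w \<bullet> fst w) * f w)"
proof -
  have "heat_class (\<lambda>w. \<Sum>e\<in>(Basis::(complex^'d) set). complex_of_real (fst w \<bullet> e) * (complex_of_real (fst w \<bullet> e) * f w))"
    using assms by (intro heat_class_sum heat_class.zmult) auto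
  moreover have "complex_of_real (fst w \<bullet> fst w) * f w =
    (\<Sum>e\<in>Basis. complex_of_real (fst w \<bullet> e) * (complex_of_real (fst w \<bullet> e) * f w))" for w :: "'d heis"
    by (subst euclidean_inner) (simp add: sum_distrib_right mult.assoc)
  ultimately show ?thesis by simp
qed

lemma heat_class_derivative:
  fixes f :: "'d::finite heis \<Rightarrow> complex"
  shows "heat_class f \<Longrightarrow> \<exists>D. (\<forall>w. (f has_derivative D w) (at w)) \<and> (\<forall>v. heat_class (\<lambda>w. D w v))"
proof (induction rule: heat_class.induct)
  case (base r)
  let ?r1 = "\<lambda>l. l * r l" and ?r2 = "\<lambda>l. l_coth l * r l"
  have r1: "amplitude ?r1" and r2: "amplitude ?r2"
    by (intro amplitude.intros amplitude_l_coth base)+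
  have "heat_class (\<lambda>w. \<i> / 4 * complex_of_real (snd v) * heat_kernel_int ?r1 w
      - 1 / 2 * complex_of_real (fst w \<bullet> fst v) * heat_kernel_int ?r2 w)" for v :: "'d heis"
    unfolding mult.assoc by (intro heat_class_diff heat_class.intros r1 r2)
  with heat_kernel_int_has_derivative[OF base] show ?case
    by (intro exI[of _ "\<lambda>w v. \<i> / 4 * complex_of_real (snd v) * heat_kernel_int ?r1 w
      - 1 / 2 * complex_of_real (fst w \<bullet> fst v) * heat_kernel_int ?r2 w"]) auto
next
  case (add f g)
  then obtain D E where "\<And>w. (f has_derivative D w) (at w)" "\<And>v. heat_class (\<lambda>w. D w v)"
    "\<And>w. (g has_derivative E w) (at w)" "\<And>v. heat_class (\<lambda>w. E w v)" by blast
  then show ?case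
    by (intro exI[of _ "\<lambda>w v. D w v + E w v"]) (auto intro!: has_derivative_add heat_class.add)
next
  case (cmult f c)
  then obtain D where "\<And>w. (f has_derivative D w) (at w)" "\<And>v. heat_class (\<lambda>w. D w v)" by blast
  then show ?case
    by (intro exI[of _ "\<lambda>w v. c * D w v"]) (auto intro!: has_derivative_mult_right heat_class.cmult)
next
  case (zmult f e)
  then obtain D where D: "\<And>w. (f has_derivative D w) (at w)" "\<And>v. heat_class (\<lambda>w. D w v)" by blast
  have "((\<lambda>w. complex_of_real (fst w \<bullet> e) * f w) has_derivative
    (\<lambda>v. complex_of_real (fst w \<bullet> e) * D w v + complex_of_real (fst v \<bullet> e) * f w)) (at w)" for w
    by (rule derivative_eq_intros refl D | simp)+
  moreover have "heat_class (\<lambda>w. complex_of_real (fst w \<bullet> e) * D w v + complex_of_real (fst v \<bullet> e) * f w)" for v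
    by (intro heat_class.add heat_class.zmult heat_class.cmult D zmult)
  ultimately show ?case
    by (intro exI[of _ "\<lambda>w v. complex_of_real (fst w \<bullet> e) * D w v + complex_of_real (fst v \<bullet> e) * f w"]) auto
qed

text \<open>The exponent must be arbitrary in the induction, because multiplication by a coordinate
  of z uses up one power. Powers of s are left out here; they are supplied by closure of the class
  under multiplication by s.\<close>

lemma heat_class_bound:
  "heat_class f \<Longrightarrow> \<exists>C. \<forall>w. norm (fst w) ^ k * norm (f w) \<le> C"
proof (induction arbitrary: k rule: heat_class.induct)
  case (base r)
  define I where "I = (\<integral>l. \<bar>l_sinh l ^ CARD('a) * r l\<bar> \<partial>lborel)"
  have I: "I \<ge> 0" unfolding I_def by simp
  have "norm (fst w) ^ k * norm (heat_kernel_int r w) \<le> I * exp 1 * real (2 * Suc k) ^ Suc k" for w :: "'a heis"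
  proof -
    let ?x = "norm (fst w)"
    \<comment> \<open>Completing a square replaces the Gaussian by a simple exponential, at the
      price of the factor \<open>exp 1\<close>, so that \<open>poly_exp_bound\<close>
      applies.\<close>
    have "- (?x\<^sup>2 / 4) \<le> 1 + (- ?x / 2)"
      using zero_le_power2[of "?x / 2 - 1/2"] by (simp add: power2_eq_square field_simps)
    then have "exp (- (?x\<^sup>2 / 4)) \<le> exp 1 * exp (- ?x / 2)" by (simp flip: exp_add)
    then have "norm (heat_kernel_int r w) \<le> I * (exp 1 * exp (- ?x / 2))"
      using order_trans[OF norm_heat_kernel_int_le[OF base, of w] mult_left_mono[OF _ I[unfolded I_def]]]
      by (simp add: I_def)
    moreover have "?x ^ k \<le> (1 + ?x) ^ Suc k"
      by (intro order_trans[OF power_mono power_increasing, of _ "1 + ?x"]) auto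
    ultimately have "?x ^ k * norm (heat_kernel_int r w) \<le> (1 + ?x) ^ Suc k * (I * (exp 1 * exp (- ?x / 2)))"
      by (intro mult_mono) auto
    also have "\<dots> = I * exp 1 * ((1 + ?x) ^ Suc k * exp (- ?x / 2))" by (simp add: mult_ac)
    also have "\<dots> \<le> I * exp 1 * real (2 * Suc k) ^ Suc k"
      using I by (intro mult_left_mono poly_exp_bound) auto
    finally show ?thesis .
  qed
  then show ?case by blast
next
  case (add f g)
  obtain C D where "\<And>w. norm (fst w) ^ k * norm (f w) \<le> C" "\<And>w. norm (fst w) ^ k * norm (g w) \<le> D"
    using add.IH by blast
  then have "norm (fst w) ^ k * norm (f w + g w) \<le> C + D" for w
    using mult_left_mono[OF norm_triangle_ineq[of "f w" "g w"], of "norm (fst w) ^ k"]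
    by (simp add: distrib_left) (smt (verit))
  then show ?case by blast
next
  case (cmult f c)
  obtain C where "\<And>w. norm (fst w) ^ k * norm (f w) \<le> C" using cmult.IH by blast
  then have "norm (fst w) ^ k * norm (c * f w) \<le> norm c * C" for w
    using mult_left_mono[of "norm (fst w) ^ k * norm (f w)" C "norm c"] by (simp add: norm_mult mult_ac)
  then show ?case by blast
next
  case (zmult f e)
  obtain C where C: "\<And>w. norm (fst w) ^ Suc k * norm (f w) \<le> C" using zmult.IH by blast
  have "norm (fst w) ^ k * norm (complex_of_real (fst w \<bullet> e) * f w) \<le> norm e * C" for w
  proof -
    have "norm (fst w) ^ k * norm (complex_of_real (fst w \<bullet> e) * f w) = norm (fst w) ^ k * norm (f w) * \<bar>fst w \<bullet> e\<bar>"
      by (simp add: norm_mult)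
    also have "\<dots> \<le> norm (fst w) ^ k * norm (f w) * (norm (fst w) * norm e)"
      by (intro mult_left_mono Cauchy_Schwarz_ineq2) auto
    also have "\<dots> = norm e * (norm (fst w) ^ Suc k * norm (f w))" by simp
    also have "\<dots> \<le> norm e * C" by (intro mult_left_mono C) auto
    finally show ?thesis .
  qed
  then show ?case by blast
qed

lemma heat_class_smult:
  "heat_class f \<Longrightarrow> heat_class (\<lambda>w. complex_of_real (snd w) * f w)"
proof (induction rule: heat_class.induct)
  case (base r)
  obtain r' where r': "amplitude r'" "\<And>l. (r has_real_derivative r' l) (at l)"
    using amplitude_deriv[OF base] by blast
  let ?r1 = "\<lambda>l. r' l - real CARD('a) * mratio 1 l * r l" and ?r2 = "\<lambda>l. l_coth' l * r l"
  have r1: "amplitude ?r1" and r2: "amplitude ?r2"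
    by (intro amplitude.intros amplitude_diff amplitude_l_coth' base r')+
  have "heat_class (\<lambda>w::'a heis. 4 * \<i> * heat_kernel_int ?r1 w
    - \<i> * (complex_of_real (fst w \<bullet> fst w) * heat_kernel_int ?r2 w))"
    by (intro heat_class_diff heat_class.cmult heat_class_sqnorm heat_class.base r1 r2)
  moreover have "complex_of_real (snd w) * heat_kernel_int r w = 4 * \<i> * heat_kernel_int ?r1 w
    - \<i> * (complex_of_real (fst w \<bullet> fst w) * heat_kernel_int ?r2 w)" for w :: "'a heis"
    using heat_kernel_int_snd[OF base r', of w] by (simp only: mult.assoc)
  ultimately show ?case by simp
next
  case (add f g)
  then show ?case using heat_class.add[OF add.IH] by (simp add: distrib_left)
next
  case (cmult f c)
  then show ?case using heat_class.cmult[OF cmult.IH] by (simp add: mult.left_commute)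
next
  case (zmult f e)
  then show ?case using heat_class.zmult[OF zmult.IH] by (simp add: mult.left_commute)
qed

lemma heat_class_schwartz:
  fixes f :: "'d::finite heis \<Rightarrow> complex"
  assumes "heat_class f"
  shows "schwartz f"
proof (rule schwartz_coinduct[where P=heat_class])
  fix f :: "'d heis \<Rightarrow> complex" and b :: "'d heis" assume f: "heat_class f"
  obtain D where D: "\<And>w. (f has_derivative D w) (at w)" "\<And>v. heat_class (\<lambda>w. D w v)"
    using heat_class_derivative[OF f] by blast
  show "\<exists>C. \<forall>w. norm (f w) \<le> C" using heat_class_bound[OF f, of 0] by simp
  show "f differentiable (at w)" for w using D(1) differentiableI by blast
  have "dir_deriv b f = (\<lambda>w. D w b)" using dir_deriv_eq[OF D(1)] by (intro ext)
  with D(2) show "heat_class (dir_deriv b f)" by simp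
  have "heat_class (\<lambda>w. complex_of_real (fst w \<bullet> fst b) * f w + complex_of_real (snd b) * (complex_of_real (snd w) * f w))"
    by (intro heat_class.add heat_class.zmult heat_class.cmult heat_class_smult f)
  then show "heat_class (\<lambda>w. complex_of_real (w \<bullet> b) * f w)"
    by (simp add: inner_prod_def algebra_simps)
qed (rule assms)

section \<open>The geometry of the Heisenberg group\<close>

text \<open>As a real linear map this is skew for the inner product, and it turns the symplectic
  term Im (z . conj z') of the group law into \<open>z \<bullet> mult_i z'\<close>. All later
  computations are real linear algebra with this map.\<close>

definition mult_i :: "complex ^ 'd \<Rightarrow> complex ^ 'd::finite"
  where "mult_i v = (\<chi> j. \<i> * v $ j)"

lemma inner_mult_i: "a \<bullet> mult_i b = (\<Sum>j\<in>UNIV. Im (a $ j * cnj (b $ j)))"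
  by (simp add: inner_vec_def mult_i_def inner_complex_def algebra_simps)

lemma mult_i_skew: "mult_i a \<bullet> b = - (a \<bullet> mult_i b)"
  by (simp add: inner_vec_def mult_i_def inner_complex_def algebra_simps sum_negf[symmetric])

lemma inner_mult_i_self [simp]: "a \<bullet> mult_i a = 0"
  using mult_i_skew[of a a] by (simp add: inner_commute)

lemma mult_i_add: "mult_i (a + b) = mult_i a + mult_i b"
  by (simp add: mult_i_def vec_eq_iff algebra_simps)

lemma mult_i_scaleR: "mult_i (r *\<^sub>R a) = r *\<^sub>R mult_i a"
  by (simp add: mult_i_def vec_eq_iff algebra_simps)

lemma mult_i_minus: "mult_i (- a) = - mult_i a"
  using mult_i_scaleR[of "-1" a] by simp

lemma mult_i_diff: "mult_i (a - b) = mult_i a - mult_i b"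
  using mult_i_add[of a "- b"] by (simp add: mult_i_minus)

lemma mult_i_0 [simp]: "mult_i 0 = 0"
  using mult_i_scaleR[of 0] by simp

lemma norm_mult_i [simp]: "norm (mult_i a) = norm a"
  by (simp add: norm_vec_def mult_i_def norm_mult)

lemma inner_mult_i_mult_i: "mult_i a \<bullet> mult_i a = a \<bullet> a"
  by (simp add: dot_square_norm)

lemma bounded_linear_mult_i: "bounded_linear mult_i"
  by (rule bounded_linear_intro[where K=1]) (simp_all add: mult_i_add mult_i_scaleR)

lemma heis_mult_eq:
  "heis_mult w v = (fst w + fst v, snd w + snd v + 2 * (fst w \<bullet> mult_i (fst v)))"
  by (simp add: heis_mult_def inner_mult_i)

lemma heis_mult_inv_cancel [simp]:
  "heis_mult a (heis_mult (heis_inv a) w) = w" "heis_mult (heis_inv a) (heis_mult a w) = w"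
  by (simp_all add: heis_mult_eq heis_inv_def mult_i_add mult_i_minus mult_i_diff inner_simps prod_eq_iff)

text \<open>Inversion in the group is negation, and it reverses products. For an even kernel this
  exchanges the roles of the two points, so the variable of integration can be placed on either
  side.\<close>

lemma heis_inv_mult_inv: "heis_mult (heis_inv v) w = - heis_mult (heis_inv w) v"
  by (simp add: heis_mult_eq heis_inv_def prod_eq_iff mult_i_skew[symmetric] inner_commute)

text \<open>For \<open>e = axis j 1\<close> and \<open>e = axis j \<i>\<close>, the left invariant field
  \<open>\<partial>\<^bsub>x\<^sub>j\<^esub> + 2 y\<^sub>j \<partial>\<^sub>s\<close> and \<open>\<partial>\<^bsub>y\<^sub>j\<^esub> - 2 x\<^sub>j \<partial>\<^sub>s\<close>, respectively.\<close>

definition hvec :: "complex ^ 'd::finite \<Rightarrow> 'd heis \<Rightarrow> 'd heis"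
  where "hvec e w = (e, 2 * (fst w \<bullet> mult_i e))"

definition hderiv :: "complex ^ 'd::finite \<Rightarrow> ('d heis \<Rightarrow> complex) \<Rightarrow> 'd heis \<Rightarrow> complex"
  where "hderiv e f w = dir_deriv (hvec e w) f w"

text \<open>The sublaplacian as a sum of squares of left invariant fields over the real basis of
  C^d. Invariance, scaling and the Leibniz rule are one line per field in this form.\<close>

definition sublap :: "('d::finite heis \<Rightarrow> complex) \<Rightarrow> 'd heis \<Rightarrow> complex"
  where "sublap f w = (\<Sum>e\<in>Basis. hderiv e (hderiv e f) w)"

lemma hderiv_eq: "(f has_derivative D) (at w) \<Longrightarrow> hderiv e f w = D (hvec e w)"
  by (simp add: hderiv_def dir_deriv_eq)

lemma smooth_has_derivative: "smooth f \<Longrightarrow> (f has_derivative (\<lambda>v. dir_deriv v f w)) (at w)"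
  by (simp add: smooth_iff smooth_on_has_derivative)

lemma dir_deriv_lincomb:
  fixes f :: "'d::finite heis \<Rightarrow> complex"
  assumes "f differentiable (at w)"
  shows "dir_deriv (a, c) f w = dir_deriv (a, 0) f w + complex_of_real c * dir_deriv (0, 1) f w"
proof -
  have l: "linear (\<lambda>v. dir_deriv v f w)"
    using assms linear_frechet_derivative unfolding dir_deriv_def by blast
  have "(a, c) = (a, 0) + c *\<^sub>R (0, 1)" by simp
  then have "dir_deriv (a, c) f w = dir_deriv ((a, 0) + c *\<^sub>R (0, 1)) f w" by simp
  also have "\<dots> = dir_deriv (a, 0) f w + complex_of_real c * dir_deriv (0, 1) f w"
    by (simp only: linear_add[OF l] linear_scale[OF l]) (simp add: scaleR_conv_of_real)
  finally show ?thesis .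
qed

lemma smooth_hderiv:
  fixes f :: "'d::finite heis \<Rightarrow> complex"
  assumes "smooth f" "e \<in> Basis"
  shows "smooth (hderiv e f)"
proof -
  have f: "smooth_on UNIV f" using assms smooth_iff by auto
  have "hderiv e f = (\<lambda>w. dir_deriv (e, 0) f w + 2 * complex_of_real (w \<bullet> (mult_i e, 0)) * dir_deriv (0, 1) f w)"
    unfolding hderiv_def[abs_def] hvec_def
    by (rule ext, subst dir_deriv_lincomb[OF smooth_on_differentiable[OF f UNIV_I]]) (simp add: inner_prod_def)
  moreover have "smooth_on UNIV (\<lambda>w. dir_deriv (e, 0) f w + 2 * complex_of_real (w \<bullet> (mult_i e, 0)) * dir_deriv (0, 1) f w)"
    by (intro smooth_on_add smooth_on_mult smooth_on_const smooth_on_inner smooth_on_dir_deriv f)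
      (use assms(2) in \<open>auto simp: Basis_prod_def\<close>)
  ultimately show ?thesis by (simp add: smooth_iff)
qed

lemma smooth_continuous: "smooth f \<Longrightarrow> continuous_on A f"
  using smooth_on_continuous_on[of UNIV f] continuous_on_subset by (auto simp: smooth_iff)

lemma
  assumes "smooth f" "smooth g"
  shows smooth_add: "smooth (\<lambda>x. f x + g x)" and smooth_mult: "smooth (\<lambda>x. f x * g x)"
  using assms by (auto simp: smooth_iff intro: smooth_on_add smooth_on_mult)

lemma smooth_cmult: "smooth f \<Longrightarrow> smooth (\<lambda>x. c * f x)"
  by (simp add: smooth_iff smooth_on_cmult)

lemma hderiv_add:
  assumes "smooth f" "smooth g"
  shows "hderiv e (\<lambda>w. f w + g w) w = hderiv e f w + hderiv e g w"
  using hderiv_eq[OF has_derivative_add[OF smooth_has_derivative[OF assms(1)] smooth_has_derivative[OF assms(2)]]]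
  by (simp add: hderiv_def)

lemma hderiv_mult:
  assumes "smooth f" "smooth g"
  shows "hderiv e (\<lambda>w. f w * g w) w = f w * hderiv e g w + hderiv e f w * g w"
  using hderiv_eq[OF has_derivative_mult[OF smooth_has_derivative[OF assms(1)] smooth_has_derivative[OF assms(2)]]]
  by (simp add: hderiv_def)

lemma hderiv_cmult:
  assumes "smooth f"
  shows "hderiv e (\<lambda>w. c * f w) w = c * hderiv e f w"
  using hderiv_eq[OF has_derivative_mult_right[OF smooth_has_derivative[OF assms(1)]]]
  by (simp add: hderiv_def)

lemma sum_Basis_cvec:
  "(\<Sum>e\<in>(Basis :: (complex ^ 'd::finite) set). g e) = (\<Sum>j\<in>UNIV. g (axis j 1) + g (axis j \<i>))"
proof -
  have "(\<Sum>e\<in>(Basis :: (complex ^ 'd) set). g e) = (\<Sum>j\<in>UNIV. \<Sum>u\<in>Basis. g (axis j (u::complex)))"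
    unfolding Basis_vec_def
    by (subst sum.UNION_disjoint) (auto simp: axis_eq_axis sum.UNION_disjoint)
  then show ?thesis by (simp add: Basis_complex_def)
qed

text \<open>Writing X and Y for the real fields, Z = (X - iY)/2 and its conjugate is (X + iY)/2. In
  the symmetrised product the mixed terms XY and YX cancel, leaving (X^2 + Y^2)/2, and the factor 2
  in the definition restores X^2 + Y^2.\<close>

lemma heis_laplacian_eq_sublap:
  fixes f :: "'d::finite heis \<Rightarrow> complex"
  assumes "smooth f"
  shows "heis_laplacian f w = sublap f w"
proof -
  have comp: "(z::complex^'d) \<bullet> mult_i (axis j 1) = Im (z $ j)" "z \<bullet> mult_i (axis j \<i>) = - Re (z $ j)" for z j
    unfolding inner_mult_i by (subst sum.remove[of _ j]; simp add: axis_def)+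
  have B: "axis j 1 \<in> (Basis :: (complex^'d) set)" "axis j \<i> \<in> (Basis :: (complex^'d) set)" for j
    by (auto simp: axis_in_Basis_iff Basis_complex_def)
  have Z: "heis_Z j g = (\<lambda>w. 1 / 2 * hderiv (axis j 1) g w + (- \<i> / 2) * hderiv (axis j \<i>) g w)"
    and Zbar: "heis_Zbar j g = (\<lambda>w. 1 / 2 * hderiv (axis j 1) g w + \<i> / 2 * hderiv (axis j \<i>) g w)"
    if "smooth g" for g :: "'d heis \<Rightarrow> complex" and j
  proof -
    have cz: "cnj z = complex_of_real (Re z) - \<i> * complex_of_real (Im z)" "z = complex_of_real (Re z) + \<i> * complex_of_real (Im z)" for z
      by (simp_all add: complex_eq_iff)
    have *: "hderiv (axis j 1) g w = d_x j g w + 2 * complex_of_real (Im (fst w $ j)) * d_s g w"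
      "hderiv (axis j \<i>) g w = d_y j g w - 2 * complex_of_real (Re (fst w $ j)) * d_s g w" for w
      unfolding hderiv_def hvec_def comp d_x_def d_y_def d_s_def
      using that[unfolded smooth_iff] smooth_on_differentiable[of UNIV g w]
      by (subst dir_deriv_lincomb; simp)+
    show "heis_Z j g = (\<lambda>w. 1 / 2 * hderiv (axis j 1) g w + (- \<i> / 2) * hderiv (axis j \<i>) g w)"
      by (rule ext, simp only: heis_Z_def d_z_def * cz(1)) (simp add: field_simps)
    show "heis_Zbar j g = (\<lambda>w. 1 / 2 * hderiv (axis j 1) g w + \<i> / 2 * hderiv (axis j \<i>) g w)"
      by (rule ext, simp only: heis_Zbar_def d_zbar_def *, subst (1) cz(2)) (simp add: field_simps)
  qed
  note sm = smooth_hderiv[OF assms B(1)] smooth_hderiv[OF assms B(2)]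
  have eq: "heis_Z j (heis_Zbar j f) w + heis_Zbar j (heis_Z j f) w =
    1 / 2 * (hderiv (axis j 1) (hderiv (axis j 1) f) w + hderiv (axis j \<i>) (hderiv (axis j \<i>) f) w)" for j
    unfolding Z[OF assms] Zbar[OF assms]
    by (simp only: Z Zbar smooth_add smooth_cmult sm hderiv_add hderiv_cmult) (simp add: field_simps)
  then show ?thesis
    unfolding heis_laplacian_def sublap_def sum_Basis_cvec eq by (simp flip: sum_divide_distrib)
qed

lemma sublap_mult:
  assumes "smooth f" "smooth g"
  shows "sublap (\<lambda>w. f w * g w) w =
    f w * sublap g w + 2 * (\<Sum>e\<in>Basis. hderiv e f w * hderiv e g w) + sublap f w * g w"
proof -
  have "hderiv e (hderiv e (\<lambda>w. f w * g w)) w =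
     f w * hderiv e (hderiv e g) w + 2 * (hderiv e f w * hderiv e g w) + hderiv e (hderiv e f) w * g w"
    if "e \<in> Basis" for e
  proof -
    note sm = smooth_hderiv[OF assms(1) that] smooth_hderiv[OF assms(2) that]
    have "hderiv e (\<lambda>w. f w * g w) = (\<lambda>w. f w * hderiv e g w + hderiv e f w * g w)"
      using hderiv_mult[OF assms] by auto
    then show ?thesis
      by (simp only: hderiv_add hderiv_mult smooth_mult sm assms) (simp add: algebra_simps)
  qed
  then show ?thesis
    by (simp add: sublap_def sum.distrib sum_distrib_left sum_distrib_right)
qed

lemma sublap_cmult:
  assumes "smooth f"
  shows "sublap (\<lambda>w. c * f w) w = c * sublap f w"
proof -
  have "hderiv e (hderiv e (\<lambda>w. c * f w)) w = c * hderiv e (hderiv e f) w" if "e \<in> Basis" for e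
  proof -
    have "hderiv e (\<lambda>w. c * f w) = (\<lambda>w. c * hderiv e f w)"
      using hderiv_cmult[OF assms] by auto
    then show ?thesis by (simp only: hderiv_cmult[OF smooth_hderiv[OF assms that]])
  qed
  then show ?thesis by (simp add: sublap_def sum_distrib_left)
qed

section \<open>Left invariance and homogeneity of the fields\<close>

lemma heis_mult_has_derivative:
  "(heis_mult a has_derivative (\<lambda>v. (fst v, snd v + 2 * (fst a \<bullet> mult_i (fst v))))) (at w)"
proof -
  have "((\<lambda>w. (fst a + fst w, snd a + snd w + 2 * (fst a \<bullet> mult_i (fst w)))) has_derivative
    (\<lambda>v. (fst v, snd v + 2 * (fst a \<bullet> mult_i (fst v))))) (at w)"
    by (auto intro!: derivative_eq_intros bounded_linear.has_derivative[OF bounded_linear_mult_i])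
  then show ?thesis by (simp add: heis_mult_eq[abs_def])
qed

lemma smooth_compose_affine:
  fixes f :: "'b::euclidean_space \<Rightarrow> complex" and g :: "'a::euclidean_space \<Rightarrow> 'b"
  assumes "smooth f" "bounded_linear L" "\<And>x. g x = c + L x"
  shows "smooth (\<lambda>x. f (g x))"
proof -
  have "smooth_on UNIV (\<lambda>x. complex_of_real (c \<bullet> e) + complex_of_real (L x \<bullet> e))" for e
    by (intro smooth_on_add smooth_on_const smooth_on_linear open_UNIV
        bounded_linear_compose[OF bounded_linear_of_real] bounded_linear_compose[OF bounded_linear_inner_left] assms)
  then have "smooth_on UNIV (\<lambda>x. f (g x))"
    using assms(1) by (intro smooth_on_compose[where V=UNIV and F=f and g=g] open_UNIV UNIV_I)
      (simp_all add: assms(3) inner_add_left smooth_iff)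
  then show ?thesis by (simp add: smooth_iff)
qed

lemma smooth_translate:
  fixes f :: "'d::finite heis \<Rightarrow> complex"
  assumes "smooth f"
  shows "smooth (\<lambda>w. f (heis_mult a w))"
proof (rule smooth_compose_affine[OF assms, where c=a])
  show "bounded_linear (\<lambda>v::'d heis. (fst v, snd v + 2 * (fst a \<bullet> mult_i (fst v))))"
    using heis_mult_has_derivative has_derivative_bounded_linear by blast
qed (simp add: heis_mult_eq prod_eq_iff)

text \<open>The differential of the left translation by \<open>a\<close> carries the vector
  \<open>hvec e w\<close> to \<open>hvec e (heis_mult a w)\<close>; this is left invariance of the
  field.\<close>

lemma hderiv_translate:
  assumes "smooth f"
  shows "hderiv e (\<lambda>w. f (heis_mult a w)) w = hderiv e f (heis_mult a w)"
proof -
  have "(fst (hvec e w), snd (hvec e w) + 2 * (fst a \<bullet> mult_i (fst (hvec e w)))) = hvec e (heis_mult a w)"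
    by (simp add: hvec_def heis_mult_eq inner_add_left)
  then show ?thesis
    using hderiv_eq[OF has_derivative_compose[OF heis_mult_has_derivative smooth_has_derivative[OF assms]], of e]
    unfolding hderiv_def by simp
qed

lemma sublap_translate:
  assumes "smooth f"
  shows "sublap (\<lambda>w. f (heis_mult a w)) w = sublap f (heis_mult a w)"
proof -
  have "hderiv e (\<lambda>w. f (heis_mult a w)) = (\<lambda>w. hderiv e f (heis_mult a w))" for e
    using hderiv_translate[OF assms] by (intro ext)
  then show ?thesis
    unfolding sublap_def by (intro sum.cong refl) (simp only: hderiv_translate smooth_hderiv assms)
qed

text \<open>The dilations that are automorphisms of the group. Since s scales with r^2, the fields
  are homogeneous of degree one. The rescaling \<open>heis_dilate t\<close> uses r = 1 / sqrt t, and
  its prefactor is the Jacobian r^(2d+2).\<close>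

definition dil :: "real \<Rightarrow> 'd::finite heis \<Rightarrow> 'd heis"
  where "dil r w = (r *\<^sub>R fst w, r\<^sup>2 * snd w)"

lemma bounded_linear_dil: "bounded_linear (dil r)"
  unfolding dil_def[abs_def]
  by (intro bounded_linear_Pair bounded_linear_const_mult bounded_linear_fst bounded_linear_snd
      bounded_linear_compose[OF bounded_linear_scaleR_right])

lemma smooth_dil: "smooth f \<Longrightarrow> smooth (\<lambda>w. f (dil r w))"
  by (rule smooth_compose_affine[OF _ bounded_linear_dil, where c=0]) auto

lemma hderiv_dil:
  assumes "smooth f"
  shows "hderiv e (\<lambda>w. f (dil r w)) w = complex_of_real r * hderiv e f (dil r w)"
proof -
  note D = smooth_has_derivative[OF assms, of "dil r w"]
  have "hderiv e (\<lambda>w. f (dil r w)) w = dir_deriv (dil r (hvec e w)) f (dil r w)"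
    using hderiv_eq[OF has_derivative_compose[OF bounded_linear_imp_has_derivative[OF bounded_linear_dil] D]] .
  also have "dil r (hvec e w) = r *\<^sub>R hvec e (dil r w)"
    by (simp add: dil_def hvec_def power2_eq_square)
  also have "dir_deriv \<dots> f (dil r w) = complex_of_real r * hderiv e f (dil r w)"
    using linear_scale[OF has_derivative_linear[OF D]] by (simp add: hderiv_def scaleR_conv_of_real)
  finally show ?thesis .
qed

lemma sublap_dil:
  assumes "smooth f"
  shows "sublap (\<lambda>w. f (dil r w)) w = complex_of_real (r\<^sup>2) * sublap f (dil r w)"
proof -
  have "hderiv e (hderiv e (\<lambda>w. f (dil r w))) w = complex_of_real (r\<^sup>2) * hderiv e (hderiv e f) (dil r w)"
    if "e \<in> Basis" for e
  proof -
    have "hderiv e (\<lambda>w. f (dil r w)) = (\<lambda>w. complex_of_real r * hderiv e f (dil r w))"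
      using hderiv_dil[OF assms] by (intro ext)
    then show ?thesis
      by (simp only: hderiv_cmult[OF smooth_dil] hderiv_dil smooth_hderiv[OF assms that])
        (simp add: power2_eq_square)
  qed
  then show ?thesis by (simp add: sublap_def sum_distrib_left)
qed

lemma heis_dilate_eq:
  assumes "t > 0"
  shows "heis_dilate t f w = complex_of_real (1 / t ^ (CARD('d) + 1)) * f (dil (1 / sqrt t) (w::'d::finite heis))"
  using assms by (simp add: heis_dilate_def dil_def power_divide)

lemma heis_dilate_fun:
  "t > 0 \<Longrightarrow> heis_dilate t f = (\<lambda>w::'d::finite heis. complex_of_real (1 / t ^ (CARD('d) + 1)) * f (dil (1 / sqrt t) w))"
  using heis_dilate_eq by blast

lemma smooth_heis_dilate: "t > 0 \<Longrightarrow> smooth f \<Longrightarrow> smooth (heis_dilate t f)"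
  by (simp only: heis_dilate_fun smooth_cmult smooth_dil)

lemma hderiv_heis_dilate:
  assumes "t > 0" "smooth f"
  shows "hderiv e (heis_dilate t f) w = complex_of_real (1 / sqrt t) * heis_dilate t (hderiv e f) w"
  by (simp only: heis_dilate_fun[OF assms(1)] hderiv_cmult[OF smooth_dil[OF assms(2)]] hderiv_dil[OF assms(2)])
    (simp only: mult_ac)

lemma sublap_heis_dilate:
  assumes "t > 0" "smooth f"
  shows "sublap (heis_dilate t f) w = complex_of_real (1 / t) * heis_dilate t (sublap f) w"
  using assms(1)
  by (simp only: heis_dilate_fun[OF assms(1)] sublap_cmult[OF smooth_dil[OF assms(2)]] sublap_dil[OF assms(2)])
    (simp add: power_divide)

text \<open>Differentiating \<open>t \<mapsto> heis_dilate t h\<close> produces the generator of the dilations, so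
  the heat equation for a self-similar function is an identity at time \<open>1\<close>.\<close>

definition self_similar_heat :: "('d::finite heis \<Rightarrow> complex) \<Rightarrow> bool"
  where "self_similar_heat h \<longleftrightarrow> (\<forall>w. sublap h w =
    - dir_deriv ((1 / 2) *\<^sub>R fst w, snd w) h w - of_nat (CARD('d) + 1) * h w)"

lemma heis_dilate_has_vector_derivative:
  fixes h :: "'d::finite heis \<Rightarrow> complex"
  assumes "smooth h" "self_similar_heat h" "t > 0"
  shows "((\<lambda>t. heis_dilate t h w) has_vector_derivative sublap (heis_dilate t h) w) (at t)"
proof -
  define n where "n = CARD('d) + 1"
  define y where "y = ((1 / sqrt t) *\<^sub>R fst w, snd w / t)"
  have y: "y = dil (1 / sqrt t) w" using assms(3) by (simp add: y_def dil_def power_divide)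
  note D = smooth_has_derivative[OF assms(1), of y]
  note lin = linear_scale[OF has_derivative_linear[OF D]]
  have "((\<lambda>t. (1 / sqrt t) *\<^sub>R fst w) has_vector_derivative (- (1 / (2 * t * sqrt t))) *\<^sub>R fst w) (at t)"
    using assms(3) by (auto intro!: derivative_eq_intros simp: field_simps power2_eq_square)
  moreover have "((\<lambda>t. snd w / t) has_vector_derivative - (snd w / t\<^sup>2)) (at t)"
    unfolding has_real_derivative_iff_has_vector_derivative[symmetric]
    using assms(3) by (auto intro!: derivative_eq_intros simp: field_simps power2_eq_square)
  ultimately have "((\<lambda>t. ((1 / sqrt t) *\<^sub>R fst w, snd w / t)) has_vector_derivative
    ((- (1 / (2 * t * sqrt t))) *\<^sub>R fst w, - (snd w / t\<^sup>2))) (at t)"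
    by (rule has_vector_derivative_Pair)
  \<comment> \<open>The velocity of the rescaled point is -1/t times the generator of the dilations
    at that point, the very direction in which \<open>self_similar_heat\<close>
    differentiates.\<close>
  also have "((- (1 / (2 * t * sqrt t))) *\<^sub>R fst w, - (snd w / t\<^sup>2)) = (- (1 / t)) *\<^sub>R ((1 / 2) *\<^sub>R fst y, snd y)"
    by (simp add: y_def power2_eq_square)
  finally have gd: "((\<lambda>t. ((1 / sqrt t) *\<^sub>R fst w, snd w / t)) has_vector_derivative
    (- (1 / t)) *\<^sub>R ((1 / 2) *\<^sub>R fst y, snd y)) (at t)" .
  have "((\<lambda>t. h ((1 / sqrt t) *\<^sub>R fst w, snd w / t)) has_vector_derivative
    dir_deriv ((- (1 / t)) *\<^sub>R ((1 / 2) *\<^sub>R fst y, snd y)) h y) (at t)"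
    using has_derivative_compose[where f="\<lambda>t. ((1 / sqrt t) *\<^sub>R fst w, snd w / t)" and g=h,
        OF gd[unfolded has_vector_derivative_def] D[unfolded y_def]]
    unfolding has_vector_derivative_def lin y_def[symmetric] by (simp add: mult.assoc)
  then have hd: "((\<lambda>t. h ((1 / sqrt t) *\<^sub>R fst w, snd w / t)) has_vector_derivative
    (- complex_of_real (1 / t)) * dir_deriv ((1 / 2) *\<^sub>R fst y, snd y) h y) (at t)"
    unfolding lin by (simp add: scaleR_conv_of_real)
  have p: "((\<lambda>t. complex_of_real (1 / t ^ n)) has_vector_derivative complex_of_real (- real n / t ^ Suc n)) (at t)"
  proof (rule has_vector_derivative_of_real)
    have "((\<lambda>t. inverse t ^ n) has_real_derivative real n * inverse t ^ (n - Suc 0) * (- (inverse t ^ Suc (Suc 0)))) (at t)"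
      using assms(3) DERIV_power[OF DERIV_inverse[of t UNIV], of n] by (simp add: mult_ac)
    also have "real n * inverse t ^ (n - Suc 0) * (- (inverse t ^ Suc (Suc 0))) = - real n / t ^ Suc n"
      by (simp add: n_def divide_inverse power_inverse algebra_simps)
    finally show "((\<lambda>t. 1 / t ^ n) has_real_derivative - real n / t ^ Suc n) (at t)"
      by (simp only: inverse_eq_divide power_one_over)
  qed
  have "sublap (heis_dilate t h) w = complex_of_real (1 / t) * (complex_of_real (1 / t ^ n) *
      (- dir_deriv ((1 / 2) *\<^sub>R fst y, snd y) h y - of_nat n * h y))"
    using assms(2)[unfolded self_similar_heat_def, rule_format, of y]
    by (simp only: sublap_heis_dilate[OF assms(3,1)] heis_dilate_eq[OF assms(3)] y[symmetric] n_def)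
  also have "\<dots> = complex_of_real (1 / t ^ n) * ((- complex_of_real (1 / t)) * dir_deriv ((1 / 2) *\<^sub>R fst y, snd y) h y)
     + complex_of_real (- real n / t ^ Suc n) * h y"
    using assms(3) by (simp add: field_simps)
  finally show ?thesis
    using has_vector_derivative_mult[OF p hd] unfolding heis_dilate_def n_def[symmetric] y_def[symmetric]
    by simp
qed

section \<open>The heat equation for the kernel\<close>

lemma heat_class_smooth: "heat_class f \<Longrightarrow> smooth f"
  using heat_class_schwartz schwartz_def by blast

lemma hderiv_heat_kernel_int:
  fixes w :: "'d::finite heis"
  assumes "amplitude r"
  shows "hderiv e (heat_kernel_int r) w =
    complex_of_real (fst w \<bullet> mult_i e) * (\<i> / 2 * heat_kernel_int (\<lambda>l. l * r l) w)
    + complex_of_real (fst w \<bullet> e) * (- 1 / 2 * heat_kernel_int (\<lambda>l. l_coth l * r l) w)"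
  unfolding hderiv_eq[OF heat_kernel_int_has_derivative[OF assms]] hvec_def by (simp add: field_simps)

text \<open>Both sides become combinations of kernel integrals. Summed over the basis, the mixed
  second derivatives cancel by skewness of \<open>mult_i\<close>, leaving |z|^2/4 times the
  amplitude (\<lambda> coth \<lambda>)^2 - \<lambda>^2 and the amplitude -d \<lambda> coth
  \<lambda>. The generator of dilations contains the factor s; integration by parts removes it, and
  the Riccati identity matches what results.\<close>

lemma self_similar_heat_kernel_int:
  "self_similar_heat (heat_kernel_int (\<lambda>l. 1) :: 'd::finite heis \<Rightarrow> complex)"
  unfolding self_similar_heat_def
proof
  fix w :: "'d heis"
  let ?K = "heat_kernel_int :: _ \<Rightarrow> 'd heis \<Rightarrow> complex"
  note am = amplitude.intros amplitude_diff amplitude_l_coth amplitude_l_coth'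
  \<comment> \<open>The factors 1 stay because differentiating the kernel with the constant
    amplitude 1 produces them literally, and the later rewriting is syntactic.\<close>
  let ?l = "\<lambda>l::real. l * 1" and ?c = "\<lambda>l. l_coth l * 1"
  let ?ll = "\<lambda>l. l * ?l l" and ?lc = "\<lambda>l. l_coth l * ?l l" and ?cl = "\<lambda>l. l * ?c l" and ?cc = "\<lambda>l. l_coth l * ?c l"
  define q where "q = fst w \<bullet> fst w"
  have lin: "((\<lambda>w. complex_of_real (fst w \<bullet> a)) has_derivative (\<lambda>v. complex_of_real (fst v \<bullet> a))) (at w)"
    for a :: "complex ^ 'd"
    by (auto intro!: derivative_eq_intros)
  have hlin: "hderiv e (\<lambda>w. complex_of_real (fst w \<bullet> a)) w = complex_of_real (e \<bullet> a)" for e a :: "complex ^ 'd"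
    by (simp add: hderiv_eq[OF lin] hvec_def)
  have slin: "smooth (\<lambda>w::'d heis. complex_of_real (fst w \<bullet> a))" for a
    using smooth_on_inner[of UNIV "(a, 0::real)"] by (simp add: smooth_iff inner_prod_def)
  have sK: "smooth (?K r)" if "amplitude r" for r
    using heat_class_smooth[OF heat_class.base[OF that]] .
  have one: "hderiv e (hderiv e (?K (\<lambda>l. 1))) w =
    complex_of_real ((fst w \<bullet> mult_i e)\<^sup>2) * (- 1 / 4 * ?K ?ll w)
    + complex_of_real ((fst w \<bullet> mult_i e) * (fst w \<bullet> e)) * (- \<i> / 4 * ?K ?lc w - \<i> / 4 * ?K ?cl w)
    + complex_of_real ((fst w \<bullet> e)\<^sup>2) * (1 / 4 * ?K ?cc w)
    - 1 / 2 * ?K ?c w" if e: "e \<in> Basis" for e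
  proof -
    have E: "hderiv e (?K (\<lambda>l. 1)) = (\<lambda>w. complex_of_real (fst w \<bullet> mult_i e) * (\<i> / 2 * ?K ?l w)
      + complex_of_real (fst w \<bullet> e) * (- 1 / 2 * ?K ?c w))"
      by (rule ext, rule hderiv_heat_kernel_int) (intro am)
    have a: "amplitude ?l" "amplitude ?c" by (intro am)+
    show ?thesis unfolding E
      using e inner_Basis[OF e e]
      by (simp only: hderiv_add hderiv_mult hderiv_cmult hlin slin sK a smooth_mult smooth_cmult
          hderiv_heat_kernel_int[OF a(1)] hderiv_heat_kernel_int[OF a(2)] inner_mult_i_self)
        (simp add: algebra_simps power2_eq_square)
  qed
  have s1: "(\<Sum>e\<in>Basis. (fst w \<bullet> mult_i e)\<^sup>2) = q"
  proof -
    have "(\<Sum>e\<in>Basis. (fst w \<bullet> mult_i e)\<^sup>2) = (\<Sum>e\<in>Basis. (mult_i (fst w) \<bullet> e) * (mult_i (fst w) \<bullet> e))"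
      by (simp add: mult_i_skew power2_eq_square)
    also have "\<dots> = mult_i (fst w) \<bullet> mult_i (fst w)" by (rule euclidean_inner[symmetric])
    finally show ?thesis by (simp add: inner_mult_i_mult_i q_def)
  qed
  have s2: "(\<Sum>e\<in>Basis. (fst w \<bullet> e)\<^sup>2) = q"
    unfolding q_def by (subst euclidean_inner) (simp add: power2_eq_square)
  have s3: "(\<Sum>e\<in>Basis. (fst w \<bullet> mult_i e) * (fst w \<bullet> e)) = 0"
  proof -
    have "(\<Sum>e\<in>Basis. (fst w \<bullet> mult_i e) * (fst w \<bullet> e)) = - (\<Sum>e\<in>Basis. (mult_i (fst w) \<bullet> e) * (fst w \<bullet> e))"
      by (simp add: mult_i_skew sum_negf[symmetric])
    also have "(\<Sum>e\<in>Basis. (mult_i (fst w) \<bullet> e) * (fst w \<bullet> e)) = mult_i (fst w) \<bullet> fst w"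
      by (rule euclidean_inner[symmetric])
    finally show ?thesis by (simp add: inner_commute[of "mult_i (fst w)"])
  qed
  have card: "card (Basis :: (complex ^ 'd) set) = 2 * CARD('d)" by simp
  have lap: "sublap (?K (\<lambda>l. 1)) w =
     complex_of_real q * (- 1 / 4 * ?K ?ll w) + complex_of_real q * (1 / 4 * ?K ?cc w) - of_nat CARD('d) * ?K ?c w"
    unfolding sublap_def
    by (subst sum.cong[OF refl one], assumption) (simp only: sum.distrib sum_subtractf sum_distrib_right[symmetric] of_real_sum[symmetric] s1 s2 s3 sum_constant card, simp)
  have rhs: "dir_deriv ((1 / 2) *\<^sub>R fst w, snd w) (?K (\<lambda>l. 1)) w =
    \<i> / 4 * (complex_of_real (snd w) * ?K ?l w) - complex_of_real q * (1 / 4 * ?K ?c w)"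
    unfolding dir_deriv_eq[OF heat_kernel_int_has_derivative[OF amplitude.const[of 1]]]
    by (simp add: q_def field_simps)
  have "((\<lambda>l. l * 1) has_real_derivative 1) (at l)" for l :: real
    by (auto intro!: derivative_eq_intros)
  then have "complex_of_real (snd w) * ?K ?l w =
    4 * \<i> * ?K (\<lambda>l. 1 - real CARD('d) * mratio 1 l * ?l l) w - \<i> * complex_of_real q * ?K (\<lambda>l. l_coth' l * ?l l) w"
    unfolding q_def by (intro heat_kernel_int_snd am)
  also have "(\<lambda>l. 1 - real CARD('d) * mratio 1 l * ?l l) = (\<lambda>l. real (CARD('d) + 1) * 1 + (- real CARD('d)) * ?c l)"
    by (auto simp: l_coth_def algebra_simps)
  also have "?K \<dots> w = complex_of_real (real (CARD('d) + 1)) * ?K (\<lambda>l. 1) w + complex_of_real (- real CARD('d)) * ?K ?c w"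
    by (subst heat_kernel_int_add) (intro am, intro am, simp only: heat_kernel_int_cmult)
  also have "(\<lambda>l. l_coth' l * ?l l) = (\<lambda>l. ?c l + ((-1) * ?cc l + 1 * ?ll l))"
    using l_coth_identity by (auto simp: fun_eq_iff power2_eq_square algebra_simps)
  also have "?K \<dots> w = ?K ?c w + (complex_of_real (-1) * ?K ?cc w + complex_of_real 1 * ?K ?ll w)"
    by (subst heat_kernel_int_add, (intro am)+, subst heat_kernel_int_add, (intro am)+)
      (simp only: heat_kernel_int_cmult)
  finally have S: "complex_of_real (snd w) * ?K ?l w =
    4 * \<i> * (complex_of_real (real (CARD('d) + 1)) * ?K (\<lambda>l. 1) w + complex_of_real (- real CARD('d)) * ?K ?c w)
    - \<i> * complex_of_real q * (?K ?c w + (complex_of_real (-1) * ?K ?cc w + complex_of_real 1 * ?K ?ll w))" .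
  show "sublap (?K (\<lambda>l. 1)) w =
    - dir_deriv ((1 / 2) *\<^sub>R fst w, snd w) (?K (\<lambda>l. 1)) w - of_nat (CARD('d) + 1) * ?K (\<lambda>l. 1) w"
    unfolding lap rhs S by (simp add: algebra_simps)
qed

section \<open>Integration on the Heisenberg group\<close>

lemma continuous_heis_mult: "continuous_on A (heis_mult a)"
  by (intro continuous_at_imp_continuous_on ballI has_derivative_continuous[OF heis_mult_has_derivative])

lemma continuous_dil: "continuous_on A (dil r)"
  using bounded_linear_dil by (rule linear_continuous_on)

lemma measurable_heis_mult [measurable]: "heis_mult a \<in> borel_measurable borel"
  by (intro borel_measurable_continuous_onI continuous_heis_mult)

lemma measurable_dil [measurable]: "dil r \<in> borel_measurable borel"
  by (intro borel_measurable_continuous_onI continuous_dil)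

text \<open>A left translation is a shear followed by a translation: for fixed z it only shifts s by
  an amount depending on z. So integrating in s first reduces the claim to translation invariance in
  each variable.\<close>

lemma lborel_distr_heis_mult: "distr lborel borel (heis_mult a) = (lborel :: 'd::finite heis measure)"
proof (rule measure_eqI)
  fix A assume "A \<in> sets (distr lborel borel (heis_mult a))"
  then have A[measurable]: "A \<in> sets borel" by simp
  define t where "t z = snd a + 2 * (fst a \<bullet> mult_i z)" for z :: "complex ^ 'd"
  have t[measurable]: "t \<in> borel_measurable borel"
    unfolding t_def by (intro borel_measurable_continuous_onI continuous_intros linear_continuous_on bounded_linear_mult_i)
  have bm: "f \<in> borel_measurable (lborel \<Otimes>\<^sub>M lborel)" if "f \<in> borel_measurable borel"
    for f :: "'d heis \<Rightarrow> ennreal" using that by (simp add: lborel_prod)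
  have shift: "(\<integral>\<^sup>+s. indicator A (z, c + s) \<partial>lborel) = (\<integral>\<^sup>+s. indicator A (z, s) \<partial>lborel)"
    for z :: "complex ^ 'd" and c :: real
    using nn_integral_real_affine[of "\<lambda>s. indicator A (z, s)" 1 c] by simp
  have "emeasure (distr lborel borel (heis_mult a)) A = (\<integral>\<^sup>+w. indicator A w \<partial>distr lborel borel (heis_mult a))"
    by simp
  also have "\<dots> = (\<integral>\<^sup>+w. indicator A (heis_mult a w) \<partial>lborel)"
    by (intro nn_integral_distr) measurable
  also have "\<dots> = (\<integral>\<^sup>+z. \<integral>\<^sup>+s. indicator A (heis_mult a (z, s)) \<partial>lborel \<partial>lborel)"
    unfolding lborel_prod[symmetric] by (intro lborel.nn_integral_fst[symmetric] bm) measurable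
  also have "\<dots> = (\<integral>\<^sup>+z. \<integral>\<^sup>+s. indicator A (fst a + z, t z + s) \<partial>lborel \<partial>lborel)"
    by (simp add: heis_mult_eq t_def algebra_simps)
  also have "\<dots> = (\<integral>\<^sup>+z. \<integral>\<^sup>+s. indicator A (fst a + z, s) \<partial>lborel \<partial>lborel)"
    by (simp add: shift)
  also have "\<dots> = (\<integral>\<^sup>+z. \<integral>\<^sup>+s. indicator A (z, s) \<partial>lborel \<partial>distr lborel borel ((+) (fst a)))"
    by (subst nn_integral_distr) simp_all
  also have "\<dots> = (\<integral>\<^sup>+z. \<integral>\<^sup>+s. indicator A (z, s) \<partial>lborel \<partial>lborel)"
    by (simp add: lborel_distr_plus)
  also have "\<dots> = (\<integral>\<^sup>+w. indicator A w \<partial>lborel)"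
    unfolding lborel_prod[symmetric] by (intro lborel.nn_integral_fst bm) measurable
  finally show "emeasure (distr lborel borel (heis_mult a)) A = emeasure lborel A" by simp
qed simp

lemma integral_heis_mult:
  fixes f :: "'d::finite heis \<Rightarrow> complex"
  assumes "f \<in> borel_measurable borel"
  shows "(\<integral>w. f (heis_mult a w) \<partial>lborel) = (\<integral>w. f w \<partial>lborel)"
  using integral_distr[of "heis_mult a" lborel borel f] assms by (simp add: lborel_distr_heis_mult)

text \<open>The dilation is diagonal, with 2d entries r and one entry r^2, hence the Jacobian
  r^(2d+2).\<close>

lemma lborel_dil:
  assumes "r > 0"
  shows "(lborel :: 'd::finite heis measure) =
    density (distr lborel borel (dil r)) (\<lambda>_. ennreal (r ^ (2 * CARD('d) + 2)))"
proof -
  \<comment> \<open>A basis vector has zero last component exactly when it is one of the 2d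
    directions in z.\<close>
  define c :: "'d heis \<Rightarrow> real" where "c e = (if snd e = 0 then r else r\<^sup>2)" for e
  have c: "c e \<noteq> 0" "\<bar>c e\<bar> = c e" for e using assms by (auto simp: c_def)
  have sB: "(\<Sum>e\<in>Basis. g e) = (\<Sum>b\<in>Basis. g (b, 0)) + g (0, 1)"
    for g :: "'d heis \<Rightarrow> 'd heis"
    unfolding Basis_prod_def by (subst sum.union_disjoint) (auto simp: sum.reindex inj_on_def)
  have pB: "(\<Prod>e\<in>Basis. g e) = (\<Prod>b\<in>Basis. g (b, 0)) * g (0, 1)"
    for g :: "'d heis \<Rightarrow> real"
    unfolding Basis_prod_def by (subst prod.union_disjoint) (auto simp: prod.reindex inj_on_def)
  have T: "(\<lambda>x. 0 + (\<Sum>j\<in>Basis. (c j * (x \<bullet> j)) *\<^sub>R j)) = (dil r :: 'd heis \<Rightarrow> _)"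
  proof
    fix x :: "'d heis"
    have "(\<Sum>b\<in>Basis. (r * (fst x \<bullet> b)) *\<^sub>R b) = r *\<^sub>R fst x"
      by (simp flip: scaleR_scaleR scaleR_right.sum add: euclidean_representation)
    then show "0 + (\<Sum>j\<in>Basis. (c j * (x \<bullet> j)) *\<^sub>R j) = dil r x"
      unfolding sB by (simp add: c_def dil_def inner_prod_def prod_eq_iff fst_sum snd_sum)
  qed
  have P: "(\<Prod>j\<in>Basis. \<bar>c j\<bar>) = r ^ (2 * CARD('d) + 2)"
    unfolding c(2) pB by (simp add: c_def power_add[symmetric] mult.commute)
  show ?thesis
    using lborel_affine_euclidean[of c 0, OF c(1)] unfolding T P .
qed

lemma integral_dil:
  fixes f :: "'d::finite heis \<Rightarrow> complex"
  assumes r: "r > 0" and f: "f \<in> borel_measurable borel"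
  shows "(\<integral>w. f w \<partial>lborel) = complex_of_real (r ^ (2 * CARD('d) + 2)) * (\<integral>w. f (dil r w) \<partial>lborel)"
proof -
  have p: "r ^ (2 * CARD('d) + 2) > 0" using r by simp
  have "(\<integral>w. f w \<partial>lborel) = (\<integral>w. f w \<partial>density (distr lborel borel (dil r)) (\<lambda>_. ennreal (r ^ (2 * CARD('d) + 2))))"
    by (subst lborel_dil[OF r, where 'd='d]) (rule refl)
  also have "\<dots> = (\<integral>w. (r ^ (2 * CARD('d) + 2)) *\<^sub>R f w \<partial>distr lborel borel (dil r))"
    using p f by (intro integral_density) auto
  also have "\<dots> = (r ^ (2 * CARD('d) + 2)) *\<^sub>R (\<integral>w. f (dil r w) \<partial>lborel)"
    using f by (subst integral_distr) auto
  finally show "(\<integral>w. f w \<partial>lborel) = complex_of_real (r ^ (2 * CARD('d) + 2)) * (\<integral>w. f (dil r w) \<partial>lborel)"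
    by (simp add: scaleR_conv_of_real)
qed

lemma dil_dil: "dil r (dil s w) = dil (r * s) w"
  by (simp add: dil_def power_mult_distrib)

lemma dil_1 [simp]: "dil 1 w = w"
  by (simp add: dil_def)

lemma integral_heis_dilate:
  fixes h :: "'d::finite heis \<Rightarrow> complex"
  assumes t: "t > 0" and [measurable]: "h \<in> borel_measurable borel" "\<phi> \<in> borel_measurable borel"
  shows "(\<integral>w. heis_dilate t h w * \<phi> w \<partial>lborel) = (\<integral>w. h w * \<phi> (dil (sqrt t) w) \<partial>lborel)"
proof -
  let ?c = "complex_of_real (1 / t ^ (CARD('d) + 1))"
  have s: "sqrt t > 0" using t by simp
  have m: "(\<lambda>w. heis_dilate t h w * \<phi> w) \<in> borel_measurable borel"
    unfolding heis_dilate_fun[OF t] by measurable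
  have "heis_dilate t h (dil (sqrt t) w) = ?c * h w" for w
    using t s by (simp add: heis_dilate_eq dil_dil)
  then have "(\<integral>w. heis_dilate t h (dil (sqrt t) w) * \<phi> (dil (sqrt t) w) \<partial>lborel) =
     ?c * (\<integral>w. h w * \<phi> (dil (sqrt t) w) \<partial>lborel)"
    by (simp only: mult.assoc integral_mult_right_zero)
  moreover have "sqrt t ^ (2 * CARD('d) + 2) = t ^ (CARD('d) + 1)"
  proof -
    have "sqrt t ^ (2 * CARD('d) + 2) = (sqrt t ^ 2) ^ (CARD('d) + 1)"
      by (simp only: power_mult[symmetric]) simp
    then show ?thesis using t by simp
  qed
  ultimately show ?thesis
    using integral_dil[OF s m] t by simp
qed

text \<open>The bilinear term prevents subadditivity of the Euclidean norm along the group law.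
  Submultiplicativity of 1 + norm, up to the factor 2, takes its place and is what lets polynomial
  weights be moved across translations.\<close>

lemma weight_mult_le: "1 + norm (heis_mult a b) \<le> 2 * (1 + norm a) * (1 + norm b)"
  for a :: "'d::finite heis"
proof -
  have n: "norm (fst x) \<le> norm x" "\<bar>snd x\<bar> \<le> norm x" for x :: "'d heis"
    using norm_fst_le[of "fst x" "snd x"] norm_snd_le[of "snd x" "fst x"] by simp_all
  have "heis_mult a b = a + b + (0, 2 * (fst a \<bullet> mult_i (fst b)))"
    by (simp add: heis_mult_eq prod_eq_iff)
  then have "norm (heis_mult a b) \<le> norm (a + b) + norm (0 :: complex ^ 'd, 2 * (fst a \<bullet> mult_i (fst b)))"
    by (simp only: norm_triangle_ineq)
  also have "norm (0 :: complex ^ 'd, 2 * (fst a \<bullet> mult_i (fst b))) = \<bar>2 * (fst a \<bullet> mult_i (fst b))\<bar>"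
    by (simp only: norm_Pair norm_zero real_norm_def power2_abs zero_power2 add_0 real_sqrt_abs)
  finally have "norm (heis_mult a b) \<le> norm a + norm b + \<bar>2 * (fst a \<bullet> mult_i (fst b))\<bar>"
    using norm_triangle_ineq[of a b] by linarith
  also have "\<bar>2 * (fst a \<bullet> mult_i (fst b))\<bar> \<le> 2 * (norm a * norm b)"
    using order_trans[OF Cauchy_Schwarz_ineq2[of "fst a" "mult_i (fst b)", unfolded norm_mult_i] mult_mono[OF n(1)[of a] n(1)[of b]]]
    by (simp add: abs_mult)
  finally have "1 + norm (heis_mult a b) \<le> 1 + norm a + norm b + 2 * (norm a * norm b)" by simp
  also have "\<dots> \<le> 2 * (1 + norm a) * (1 + norm b)" by (simp add: algebra_simps)
  finally show ?thesis .
qed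

lemma norm_dil_le: "norm (dil r w) \<le> (1 + r\<^sup>2) * norm w"
proof -
  have "norm (dil r w) \<le> (1 + r\<^sup>2) * sqrt ((norm (fst w))\<^sup>2 + (snd w)\<^sup>2)"
  proof -
    have "(norm (dil r w))\<^sup>2 = r\<^sup>2 * (norm (fst w))\<^sup>2 + (r\<^sup>2)\<^sup>2 * (snd w)\<^sup>2"
      by (simp add: dil_def norm_Pair power_mult_distrib)
    also have "\<dots> \<le> (1 + r\<^sup>2)\<^sup>2 * (norm (fst w))\<^sup>2 + (1 + r\<^sup>2)\<^sup>2 * (snd w)\<^sup>2"
    proof (intro add_mono mult_right_mono)
      show "r\<^sup>2 \<le> (1 + r\<^sup>2)\<^sup>2" using zero_le_power2[of "r\<^sup>2"] by (simp add: power2_sum)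
      show "(r\<^sup>2)\<^sup>2 \<le> (1 + r\<^sup>2)\<^sup>2" by (intro power_mono) auto
    qed auto
    finally have "(norm (dil r w))\<^sup>2 \<le> ((1 + r\<^sup>2) * sqrt ((norm (fst w))\<^sup>2 + (snd w)\<^sup>2))\<^sup>2"
      by (simp add: power_mult_distrib distrib_left)
    then show ?thesis by (rule power2_le_imp_le) (auto intro!: mult_nonneg_nonneg)
  qed
  then show ?thesis by (simp add: norm_prod_def)
qed

section \<open>Curves in a polynomially weighted \<open>L\<^sup>1\<close> space\<close>

text \<open>The exponent allots two powers to each coordinate. Since each coordinate is bounded by
  the norm, the function lies below the product of the one-dimensional functions 1/(1 + x^2), whose
  integral factorises.\<close>

lemma integrable_weight:
  "integrable lborel (\<lambda>x::'a::euclidean_space. 1 / (1 + norm x) ^ (2 * DIM('a)))"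
proof (rule integrableI_bounded)
  show "(\<lambda>x::'a. 1 / (1 + norm x) ^ (2 * DIM('a))) \<in> borel_measurable lborel" by measurable
  let ?f = "\<lambda>x::real. ennreal (1 / (1 + x\<^sup>2))"
  have p: "1 + x\<^sup>2 > 0" for x :: real by (simp add: add_pos_nonneg)
  have "(\<integral>\<^sup>+x. ennreal (norm (1 / (1 + norm (x::'a)) ^ (2 * DIM('a)))) \<partial>lborel) \<le>
    (\<integral>\<^sup>+x. ennreal (\<Prod>b\<in>Basis. 1 / (1 + (x \<bullet> b)\<^sup>2)) \<partial>(lborel :: 'a measure))"
  proof (intro nn_integral_mono ennreal_leI)
    fix x :: 'a
    have "(\<Prod>b\<in>(Basis::'a set). 1 / (1 + norm x)\<^sup>2) \<le> (\<Prod>b\<in>Basis. 1 / (1 + (x \<bullet> b)\<^sup>2))"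
    proof (intro prod_mono conjI divide_left_mono)
      fix b :: 'a assume "b \<in> Basis"
      then have "(x \<bullet> b)\<^sup>2 \<le> (norm x)\<^sup>2"
        by (metis Basis_le_norm abs_le_square_iff abs_norm_cancel)
      then show "1 + (x \<bullet> b)\<^sup>2 \<le> (1 + norm x)\<^sup>2"
        by (simp add: power2_sum add_increasing2)
    qed (auto intro!: mult_pos_pos p add_pos_nonneg zero_less_power)
    then show "norm (1 / (1 + norm x) ^ (2 * DIM('a))) \<le> (\<Prod>b\<in>Basis. 1 / (1 + (x \<bullet> b)\<^sup>2))"
      by (simp add: power_mult power_one_over)
  qed
  also have "\<dots> = (\<integral>\<^sup>+x. (\<Prod>b\<in>Basis. ?f (x \<bullet> b)) \<partial>(lborel :: 'a measure))"
    by (intro nn_integral_cong prod_ennreal[symmetric]) (simp add: less_imp_le[OF p])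
  also have "\<dots> = (\<Prod>b\<in>(Basis::'a set). \<integral>\<^sup>+x. ?f x \<partial>lborel)"
    by (rule nn_integral_lborel_prod) auto
  also have "\<dots> < \<infinity>"
  proof -
    have "(\<integral>\<^sup>+x. ?f x \<partial>lborel) < \<infinity>"
      using integrable_inverse_1_plus_square_lborel unfolding integrable_iff_bounded
      by (simp add: less_imp_le[OF p])
    then show ?thesis by (simp add: power_less_top_ennreal)
  qed
  finally show "(\<integral>\<^sup>+x. ennreal (norm (1 / (1 + norm (x::'a)) ^ (2 * DIM('a)))) \<partial>lborel) < \<infinity>" .
qed

definition weight :: "'a::euclidean_space \<Rightarrow> real"
  where "weight w = 1 / (1 + norm w) ^ (2 * DIM('a))"

lemma weight_pos: "weight w > 0" and weight_le_1: "weight w \<le> 1"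
  for w :: "'a::euclidean_space"
proof -
  have "(1 + norm w) ^ (2 * DIM('a)) \<ge> 1" by (intro one_le_power) simp
  moreover have "1 / X > 0 \<and> 1 / X \<le> 1" if "X \<ge> 1" for X :: real using that by simp
  ultimately have *: "weight w > 0 \<and> weight w \<le> 1" unfolding weight_def by blast
  show "weight w > 0" using * by (rule conjunct1)
  show "weight w \<le> 1" using * by (rule conjunct2)
qed

lemma weight_nonneg: "weight w \<ge> 0"
  by (rule less_imp_le[OF weight_pos])

lemma weight_measurable [measurable]: "weight \<in> borel_measurable borel"
  unfolding weight_def[abs_def] by measurable

lemma integrable_weight': "integrable lborel weight"
  using integrable_weight by (simp add: weight_def[abs_def])

text \<open>The form in which continuity of the solution enters the uniqueness argument; the
  exponent p has disappeared from it.\<close>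

definition weighted_curve :: "(real \<Rightarrow> 'a::euclidean_space \<Rightarrow> complex) \<Rightarrow> bool"
  where "weighted_curve u \<longleftrightarrow>
    (\<forall>t\<ge>0. u t \<in> borel_measurable lborel \<and> integrable lborel (\<lambda>w. norm (u t w) * weight w)) \<and>
    (\<forall>t0\<ge>0. ((\<lambda>t. \<integral>w. norm (u t w - u t0 w) * weight w \<partial>lborel) \<longlongrightarrow> 0) (at t0 within {0..}))"

lemma mem_Lp_diff:
  assumes "p \<ge> 1" "mem_Lp p f" "mem_Lp p g"
  shows "integrable lborel (\<lambda>x. norm (f x - g x) powr p)"
proof (rule integrable_dominated)
  show "integrable lborel (\<lambda>x. 2 powr p * (norm (f x) powr p + norm (g x) powr p))"
    using assms by (simp add: mem_Lp_def)
  show "(\<lambda>x. norm (f x - g x) powr p) \<in> borel_measurable lborel"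
    using assms by (auto simp: mem_Lp_def)
  have "norm (f x - g x) powr p \<le> 2 powr p * (norm (f x) powr p + norm (g x) powr p)" for x
  proof -
    have "norm (f x - g x) \<le> 2 * max (norm (f x)) (norm (g x))"
      using norm_triangle_ineq4[of "f x" "g x"] by linarith
    then have "norm (f x - g x) powr p \<le> (2 * max (norm (f x)) (norm (g x))) powr p"
      using assms(1) by (intro powr_mono2) auto
    also have "\<dots> = 2 powr p * (max (norm (f x)) (norm (g x))) powr p"
      by (rule powr_mult)
    also have "\<dots> \<le> 2 powr p * (norm (f x) powr p + norm (g x) powr p)"
      by (intro mult_left_mono) (auto simp: max_def)
    finally show ?thesis .
  qed
  then show "norm (norm (f x - g x) powr p) \<le> 2 powr p * (norm (f x) powr p + norm (g x) powr p)" for x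
    by simp
qed

text \<open>This linear bound replaces Hoelder's inequality.\<close>

lemma le_eps_powr:
  fixes x e p :: real
  assumes "x \<ge> 0" "e > 0" "p \<ge> 1"
  shows "x \<le> e + e powr (1 - p) * x powr p"
proof (cases "x \<le> e")
  case True
  moreover have "0 \<le> e powr (1 - p) * x powr p" by simp
  ultimately show ?thesis by linarith
next
  case False
  define y where "y = x / e"
  have y: "y \<ge> 1" "x = e * y" using False assms(2) by (auto simp: y_def)
  have "x \<le> e * y powr p"
    using powr_mono[OF assms(3) y(1)] y assms(2) by simp
  also have "e = e powr (1 - p) * e powr p"
    using assms(2) by (simp add: powr_add[symmetric])
  also have "e powr (1 - p) * e powr p * y powr p = e powr (1 - p) * x powr p"
    using assms(2) y by (simp add: powr_mult)
  finally show ?thesis using assms(2) by linarith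
qed

text \<open>The linear bound contains a free parameter, fixed in the order that a limit allows: a
  small parameter makes the multiple of the total weight small, and then closeness in time makes the
  p-th power term small despite its large constant.\<close>

lemma heat_solution_weighted_curve:
  assumes p: "p \<ge> 1" and u: "heat_solution p u0 u"
  shows "weighted_curve u"
proof -
  have Lp: "mem_Lp p (u t)" if "t \<ge> 0" for t using u that by (simp add: heat_solution_def)
  then have meas: "u t \<in> borel_measurable lborel" if "t \<ge> 0" for t using that by (simp add: mem_Lp_def)
  define D where "D t0 t = (\<integral>w. norm (u t w - u t0 w) powr p \<partial>lborel)" for t0 t
  define W where "W = (\<integral>w. weight (w::'a heis) \<partial>lborel)"
  have Dlim: "(D t0 \<longlongrightarrow> 0) (at t0 within {0..})" if "t0 \<ge> 0" for t0
    using u that by (simp add: heat_solution_def D_def[abs_def])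
  have int: "integrable lborel (\<lambda>w. norm (f w) * weight w)"
    and bound: "e > 0 \<Longrightarrow> (\<integral>w. norm (f w) * weight w \<partial>lborel) \<le> e * W + e powr (1 - p) * (\<integral>w. norm (f w) powr p \<partial>lborel)"
    if f: "f \<in> borel_measurable lborel" "integrable lborel (\<lambda>x. norm (f x) powr p)"
    for f :: "'a heis \<Rightarrow> complex" and e
  proof -
    have le: "norm (f w) * weight w \<le> e * weight w + e powr (1 - p) * norm (f w) powr p" if "e > 0" for w e
    proof -
      have "norm (f w) * weight w \<le> (e + e powr (1 - p) * norm (f w) powr p) * weight w"
        using weight_nonneg that p by (intro mult_right_mono le_eps_powr) auto
      also have "\<dots> = e * weight w + e powr (1 - p) * norm (f w) powr p * weight w"
        by (simp add: distrib_right)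
      also have "\<dots> \<le> e * weight w + e powr (1 - p) * norm (f w) powr p"
        using weight_le_1[of w] by (intro add_left_mono mult_left_le) auto
      finally show ?thesis .
    qed
    have i: "integrable lborel (\<lambda>w. e * weight w + e powr (1 - p) * norm (f w) powr p)" for e
      using f integrable_weight' by auto
    show *: "integrable lborel (\<lambda>w. norm (f w) * weight w)"
    proof (rule integrable_dominated[OF i[of 1]])
      show "norm (norm (f w) * weight w) \<le> 1 * weight w + 1 powr (1 - p) * norm (f w) powr p" for w
        using le[of 1 w] weight_nonneg[of w] by (simp add: abs_mult)
    qed (use f in measurable)
    show "(\<integral>w. norm (f w) * weight w \<partial>lborel) \<le> e * W + e powr (1 - p) * (\<integral>w. norm (f w) powr p \<partial>lborel)" if "e > 0"
    proof -
      have "(\<integral>w. norm (f w) * weight w \<partial>lborel) \<le> (\<integral>w. e * weight w + e powr (1 - p) * norm (f w) powr p \<partial>lborel)"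
        by (intro integral_mono * i le that)
      also have "\<dots> = e * W + e powr (1 - p) * (\<integral>w. norm (f w) powr p \<partial>lborel)"
        unfolding W_def using f integrable_weight'[where 'a="'a heis"] by (subst Bochner_Integration.integral_add) auto
      finally show ?thesis .
    qed
  qed
  have W: "W \<ge> 0" unfolding W_def by (intro integral_nonneg_AE AE_I2 mult_nonneg_nonneg norm_ge_zero weight_nonneg)
  have "((\<lambda>t. \<integral>w. norm (u t w - u t0 w) * weight w \<partial>lborel) \<longlongrightarrow> 0) (at t0 within {0..})" if t0: "t0 \<ge> 0" for t0
  proof (rule tendstoI)
    fix e :: real assume e: "e > 0"
    \<comment> \<open>\<open>d\<close> spends less than half of the tolerance on the total weight;
      the 1 in the denominator is a safeguard, as only \<open>W \<ge> 0\<close> has been shown. The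
      threshold \<open>c\<close> below is what the other half then allows.\<close>
    define d where "d = e / (2 * (W + 1))"
    have d: "d > 0" "d * W < e / 2" using e W by (auto simp: d_def field_simps)
    define c where "c = e / 2 / d powr (1 - p)"
    have c: "c > 0" using e d by (simp add: c_def)
    have "\<forall>\<^sub>F t in at t0 within {0..}. D t0 t < c"
      using order_tendstoD(2)[OF Dlim[OF t0] c] .
    moreover have "\<forall>\<^sub>F t in at t0 within {0..}. t \<in> {0..}"
      by (simp add: eventually_at_filter)
    ultimately show "\<forall>\<^sub>F t in at t0 within {0..}. dist (\<integral>w. norm (u t w - u t0 w) * weight w \<partial>lborel) 0 < e"
    proof eventually_elim
      fix t assume t: "D t0 t < c" "t \<in> {0..}"
      have "(\<integral>w. norm (u t w - u t0 w) * weight w \<partial>lborel) \<le> d * W + d powr (1 - p) * D t0 t"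
        unfolding D_def using t t0 d p by (intro bound mem_Lp_diff Lp borel_measurable_diff meas) auto
      also have "d powr (1 - p) * D t0 t < d powr (1 - p) * c"
        using t d by (intro mult_strict_left_mono) auto
      also have "d powr (1 - p) * c = e / 2" using d by (simp add: c_def)
      finally have "(\<integral>w. norm (u t w - u t0 w) * weight w \<partial>lborel) < e" using d by linarith
      moreover have "(\<integral>w. norm (u t w - u t0 w) * weight w \<partial>lborel) \<ge> 0"
        by (intro integral_nonneg_AE AE_I2 mult_nonneg_nonneg norm_ge_zero weight_nonneg)
      ultimately show "dist (\<integral>w. norm (u t w - u t0 w) * weight w \<partial>lborel) 0 < e" by simp
    qed
  qed
  moreover have "integrable lborel (\<lambda>w. norm (u t w) * weight w)" if "t \<ge> 0" for t
    using int[OF meas[OF that]] Lp[OF that] by (simp add: mem_Lp_def)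
  ultimately show ?thesis using meas unfolding weighted_curve_def by blast
qed

lemma integrable_weighted_mult:
  fixes f a :: "'a::euclidean_space \<Rightarrow> complex"
  assumes "f \<in> borel_measurable lborel" "integrable lborel (\<lambda>w. norm (f w) * weight w)"
    and "a \<in> borel_measurable lborel" "\<And>w. norm (a w) \<le> M * weight w"
  shows "integrable lborel (\<lambda>w. f w * a w)"
    and "norm (\<integral>w. f w * a w \<partial>lborel) \<le> M * (\<integral>w. norm (f w) * weight w \<partial>lborel)"
proof -
  have le: "norm (f w * a w) \<le> M * (norm (f w) * weight w)" for w
    using mult_left_mono[OF assms(4)[of w], of "norm (f w)"] by (simp add: norm_mult mult_ac)
  have i: "integrable lborel (\<lambda>w. M * (norm (f w) * weight w))" using assms(2) by simp
  show *: "integrable lborel (\<lambda>w. f w * a w)"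
    by (rule integrable_dominated[OF i _ le]) (use assms(1,3) in simp)
  have "norm (\<integral>w. f w * a w \<partial>lborel) \<le> (\<integral>w. norm (f w * a w) \<partial>lborel)" by simp
  also have "\<dots> \<le> (\<integral>w. M * (norm (f w) * weight w) \<partial>lborel)"
    by (intro integral_mono integrable_norm * i le)
  finally show "norm (\<integral>w. f w * a w \<partial>lborel) \<le> M * (\<integral>w. norm (f w) * weight w \<partial>lborel)" by simp
qed

lemma weighted_diff_integrable:
  fixes f g :: "'a::euclidean_space \<Rightarrow> complex"
  assumes [measurable]: "f \<in> borel_measurable lborel" "g \<in> borel_measurable lborel"
    and "integrable lborel (\<lambda>w. norm (f w) * weight w)" "integrable lborel (\<lambda>w. norm (g w) * weight w)"
  shows "integrable lborel (\<lambda>w. norm (f w - g w) * weight w)"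
proof (rule integrable_dominated[OF Bochner_Integration.integrable_add[OF assms(3,4)]])
  show "norm (norm (f w - g w) * weight w) \<le> norm (f w) * weight w + norm (g w) * weight w" for w
    using mult_right_mono[OF norm_triangle_ineq4[of "f w" "g w"] weight_nonneg[of w]] weight_nonneg[of w]
    by (simp add: distrib_right abs_mult)
qed measurable

text \<open>The change of the curve is small in the weighted norm and meets the uniform bound
  \<open>M\<close>; the change of the test function, with the curve frozen at \<open>t0\<close>, is
  handled by dominated convergence. Pointwise convergence of the test functions is therefore enough.
  The limit time may lie outside \<open>S\<close>, as it does at the final time later.\<close>

lemma weighted_curve_tendsto:
  fixes u :: "real \<Rightarrow> 'a::euclidean_space \<Rightarrow> complex"
  assumes u: "weighted_curve u" and S: "S \<subseteq> {0..}" "t0 \<ge> 0"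
    and a: "\<And>t. t \<in> insert t0 S \<Longrightarrow> a t \<in> borel_measurable lborel"
      "\<And>t w. t \<in> insert t0 S \<Longrightarrow> norm (a t w) \<le> M * weight w"
      "\<And>w. ((\<lambda>t. a t w) \<longlongrightarrow> a t0 w) (at t0 within S)"
  shows "((\<lambda>t. \<integral>w. u t w * a t w \<partial>lborel) \<longlongrightarrow> (\<integral>w. u t0 w * a t0 w \<partial>lborel)) (at t0 within S)"
proof -
  have meas: "u t \<in> borel_measurable lborel" and int: "integrable lborel (\<lambda>w. norm (u t w) * weight w)"
    if "t \<ge> 0" for t using u that by (auto simp: weighted_curve_def)
  define J where "J t = (\<integral>w. norm (u t w - u t0 w) * weight w \<partial>lborel)" for t
  have J: "(J \<longlongrightarrow> 0) (at t0 within S)"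
    using u S unfolding J_def weighted_curve_def by (blast intro: tendsto_within_subset)
  have dint: "integrable lborel (\<lambda>w. norm (u t w - u t0 w) * weight w)" if "t \<in> S" for t
    using that S by (intro weighted_diff_integrable meas int) auto
  have "((\<lambda>t. \<integral>w. (u t w - u t0 w) * a t w \<partial>lborel) \<longlongrightarrow> 0) (at t0 within S)"
  proof (rule Lim_null_comparison)
    show "((\<lambda>t. M * J t) \<longlongrightarrow> 0) (at t0 within S)" using tendsto_mult_left[OF J, of M] by simp
    have "norm (\<integral>w. (u t w - u t0 w) * a t w \<partial>lborel) \<le> M * J t" if "t \<in> S" for t
      unfolding J_def using that S a meas
      by (intro integrable_weighted_mult dint borel_measurable_diff) auto
    then show "\<forall>\<^sub>F t in at t0 within S. norm (\<integral>w. (u t w - u t0 w) * a t w \<partial>lborel) \<le> M * J t"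
      by (simp add: eventually_at_filter)
  qed
  moreover have "((\<lambda>t. \<integral>w. u t0 w * a t w \<partial>lborel) \<longlongrightarrow> (\<integral>w. u t0 w * a t0 w \<partial>lborel)) (at t0 within S)"
    unfolding tendsto_at_iff_sequentially comp_def
  proof (intro allI impI)
    fix X assume X: "\<forall>i::nat. X i \<in> S - {t0}" "X \<longlonglongrightarrow> t0"
    show "(\<lambda>i. \<integral>w. u t0 w * a (X i) w \<partial>lborel) \<longlonglongrightarrow> (\<integral>w. u t0 w * a t0 w \<partial>lborel)"
    proof (rule integral_dominated_convergence[where w="\<lambda>w. M * (norm (u t0 w) * weight w)"])
      show "(\<lambda>w. u t0 w * a t0 w) \<in> borel_measurable lborel" using meas S a by auto
      show "(\<lambda>w. u t0 w * a (X i) w) \<in> borel_measurable lborel" for i using meas S a X by auto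
      show "integrable lborel (\<lambda>w. M * (norm (u t0 w) * weight w))" using int S by auto
      show "AE w in lborel. (\<lambda>i. u t0 w * a (X i) w) \<longlonglongrightarrow> u t0 w * a t0 w"
      proof (rule AE_I2, rule tendsto_mult_left)
        fix w show "(\<lambda>i. a (X i) w) \<longlonglongrightarrow> a t0 w"
          using a(3)[of w] X unfolding tendsto_at_iff_sequentially comp_def by blast
      qed
      show "AE w in lborel. norm (u t0 w * a (X i) w) \<le> M * (norm (u t0 w) * weight w)" for i
      proof (rule AE_I2)
        fix w show "norm (u t0 w * a (X i) w) \<le> M * (norm (u t0 w) * weight w)"
          using mult_left_mono[OF a(2)[of "X i" w], of "norm (u t0 w)"] X by (simp add: norm_mult mult_ac)
      qed
    qed
  qed
  ultimately have *: "((\<lambda>t. (\<integral>w. (u t w - u t0 w) * a t w \<partial>lborel) + (\<integral>w. u t0 w * a t w \<partial>lborel))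
    \<longlongrightarrow> 0 + (\<integral>w. u t0 w * a t0 w \<partial>lborel)) (at t0 within S)"
    by (rule tendsto_add)
  have "(\<integral>w. (u t w - u t0 w) * a t w \<partial>lborel) + (\<integral>w. u t0 w * a t w \<partial>lborel) = (\<integral>w. u t w * a t w \<partial>lborel)"
    if "t \<in> S" for t
  proof -
    have "integrable lborel (\<lambda>w. (u t w - u t0 w) * a t w)"
      using that S a meas by (intro integrable_weighted_mult(1)[where M=M] dint borel_measurable_diff) auto
    moreover have "integrable lborel (\<lambda>w. u t0 w * a t w)"
      using that S a meas int by (intro integrable_weighted_mult(1)[where M=M]) auto
    ultimately show ?thesis
      by (simp flip: Bochner_Integration.integral_add add: algebra_simps)
  qed
  then have "\<forall>\<^sub>F t in at t0 within S. (\<integral>w. (u t w - u t0 w) * a t w \<partial>lborel) + (\<integral>w. u t0 w * a t w \<partial>lborel) = (\<integral>w. u t w * a t w \<partial>lborel)"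
    by (simp add: eventually_at_filter)
  from Lim_transform_eventually[OF * this] show ?thesis by simp
qed

text \<open>Indicators of closed sets are limits of continuous cutoffs of the distance. Closed sets
  are stable under intersection and generate the Borel sets, so the integral of \<open>f\<close>
  vanishes over every Borel set, and all averages of \<open>f\<close> lie in the closed set
  {0}.\<close>

lemma AE_zero_if_integral_continuous_zero:
  fixes f :: "'a::euclidean_space \<Rightarrow> complex"
  assumes f: "integrable lborel f"
    and zero: "\<And>\<phi> :: 'a \<Rightarrow> real. continuous_on UNIV \<phi> \<Longrightarrow> (\<And>x. 0 \<le> \<phi> x \<and> \<phi> x \<le> 1) \<Longrightarrow>
      (\<integral>x. \<phi> x *\<^sub>R f x \<partial>lborel) = 0"
  shows "AE x in lborel. f x = 0"
proof -
  have si: "set_integrable lborel A f" if "A \<in> sets borel" for A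
    using that f integrable_mult_indicator[of A lborel f] by (simp add: set_integrable_def)
  have closed0: "(LINT x:A|lborel. f x) = 0" if "closed A" for A
  \<comment> \<open>\<open>infdist\<close> to the empty set is 0 by convention, so the cutoffs would
    be identically 1 in that case.\<close>
  proof (cases "A = {}")
    case False
    define \<phi> where "\<phi> n x = max 0 (1 - real n * infdist x A)" for n x
    have "(\<lambda>n. \<integral>x. \<phi> n x *\<^sub>R f x \<partial>lborel) \<longlonglongrightarrow> (\<integral>x. indicator A x *\<^sub>R f x \<partial>lborel)"
    proof (rule integral_dominated_convergence[where w="\<lambda>x. norm (f x)"])
      show "(\<lambda>x. indicat_real A x *\<^sub>R f x) \<in> borel_measurable lborel"
        using si[OF borel_closed[OF that]] by (auto simp: set_integrable_def)
      show "(\<lambda>x. \<phi> n x *\<^sub>R f x) \<in> borel_measurable lborel" for n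
      proof -
        have "\<phi> n \<in> borel_measurable borel" unfolding \<phi>_def
          by (intro borel_measurable_continuous_onI continuous_intros)
        then show ?thesis using f by auto
      qed
      show "integrable lborel (\<lambda>x. norm (f x))" using f by simp
      show "AE x in lborel. (\<lambda>n. \<phi> n x *\<^sub>R f x) \<longlonglongrightarrow> indicat_real A x *\<^sub>R f x"
      proof (rule AE_I2, rule tendsto_scaleR[OF _ tendsto_const])
        fix x show "(\<lambda>n. \<phi> n x) \<longlonglongrightarrow> indicat_real A x"
        proof (cases "x \<in> A")
          case True
          then show ?thesis by (simp add: \<phi>_def)
        next
          case x: False
          then have pos: "infdist x A > 0"
            using that False in_closed_iff_infdist_zero infdist_nonneg by (metis order_le_less)
          obtain N :: nat where N: "1 / infdist x A < real N" using reals_Archimedean2 by blast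
          have "\<phi> n x = 0" if "n \<ge> N" for n
          proof -
            have "1 / infdist x A \<le> real n" using N that by linarith
            then show ?thesis using pos by (simp add: \<phi>_def field_simps)
          qed
          then have "\<forall>\<^sub>F n in sequentially. \<phi> n x = 0" by (auto simp: eventually_sequentially)
          then show ?thesis using x by (simp add: tendsto_eventually)
        qed
      qed
      have \<phi>01: "0 \<le> \<phi> n x \<and> \<phi> n x \<le> 1" for n x by (simp add: \<phi>_def infdist_nonneg)
      then show "AE x in lborel. norm (\<phi> n x *\<^sub>R f x) \<le> norm (f x)" for n
        by (auto intro!: AE_I2 mult_left_le_one_le)
    qed
    moreover have "(\<integral>x. \<phi> n x *\<^sub>R f x \<partial>lborel) = 0" for n
      unfolding \<phi>_def by (intro zero continuous_intros) (auto simp: infdist_nonneg)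
    ultimately show ?thesis
      unfolding set_lebesgue_integral_def by (simp add: LIMSEQ_const_iff)
  qed (simp add: set_lebesgue_integral_def)
  have "(LINT x:A|lborel. f x) = 0" if "A \<in> sets lborel" for A
  proof -
    have A: "A \<in> sigma_sets UNIV (Collect closed)" using that by (simp add: borel_eq_closed)
    have sb: "sigma_sets UNIV (Collect closed) = sets (borel :: 'a measure)" by (simp add: borel_eq_closed)
    have Int: "Int_stable (Collect closed :: 'a set set)" by (auto simp: Int_stable_def)
    have Pow: "Collect closed \<subseteq> Pow (UNIV :: 'a set)" by simp
    show ?thesis using Int Pow A
    proof (induction A rule: sigma_sets_induct_disjoint)
      case (compl A)
      have "(LINT x:UNIV|lborel. f x) = (LINT x:A|lborel. f x) + (LINT x:UNIV - A|lborel. f x)"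
        using compl(1) unfolding sb by (subst set_integral_Un[symmetric]) (auto intro!: si)
      then show ?case using compl(2) closed0[of UNIV] by simp
    next
      case (union A)
      then have "(LINT x:(\<Union>i. A i)|lborel. f x) = (\<Sum>i. (LINT x:(A i)|lborel. f x))"
        unfolding sb by (intro lebesgue_integral_countable_add si) (auto simp: disjoint_family_on_def)
      then show ?case using union by simp
    next
      case (basic A)
      then show ?case by (simp add: closed0)
    next
      case empty
      show ?case by (simp add: set_lebesgue_integral_def)
    qed
  qed
  then have "AE x in lborel. f x \<in> {0}"
    by (intro sigma_finite_measure.averaging_theorem[OF sigma_finite_lborel f]) auto
  then show ?thesis by simp
qed

section \<open>Smooth functions with compact support\<close>

text \<open>A polynomial in 1/x as a prefactor makes this family closed under differentiation, so
  all derivatives of exp (-1/x) are treated at once.\<close>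

definition bump_poly :: "real poly \<Rightarrow> real \<Rightarrow> real"
  where "bump_poly p x = (if x \<le> 0 then 0 else poly p (1 / x) * exp (- (1 / x)))"

lemma poly_exp_tendsto_0: "((\<lambda>y. poly p y * exp (- y)) \<longlongrightarrow> 0) at_top" for p :: "real poly"
proof -
  have "((\<lambda>y. \<Sum>i\<le>degree p. coeff p i * (y ^ i / exp y)) \<longlongrightarrow> (\<Sum>i\<le>degree p. coeff p i * 0)) at_top"
    by (intro tendsto_intros tendsto_power_div_exp_0)
  then show ?thesis
    by (simp add: poly_altdef exp_minus sum_distrib_right divide_inverse mult.assoc)
qed

text \<open>In y = 1/x the derivative of p(y) exp (-y) is y^2 (p(y) - p'(y)) exp (-y). At 0 the
  difference quotient from the right is again of the form polynomial in y times exp (-y), which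
  tends to 0, and from the left it vanishes.\<close>

lemma bump_poly_deriv:
  "(bump_poly p has_real_derivative bump_poly ([:0, 0, 1:] * (p - pderiv p)) x) (at x)"
proof -
  consider "x < 0" | "x > 0" | "x = 0" by linarith
  then show ?thesis
  proof cases
    case 1
    have "((\<lambda>x. 0) has_real_derivative bump_poly ([:0, 0, 1:] * (p - pderiv p)) x) (at x)"
      using 1 by (simp add: bump_poly_def)
    then show ?thesis
      by (rule has_field_derivative_transform_within_open[where S="{..<0}"]) (use 1 in \<open>auto simp: bump_poly_def\<close>)
  next
    case 2
    have "((\<lambda>x. poly p (1 / x) * exp (- (1 / x))) has_real_derivative bump_poly ([:0, 0, 1:] * (p - pderiv p)) x) (at x)"
      using 2 by (auto intro!: derivative_eq_intros simp: bump_poly_def field_simps power2_eq_square)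
    then show ?thesis
      by (rule has_field_derivative_transform_within_open[where S="{0<..}"]) (use 2 in \<open>auto simp: bump_poly_def\<close>)
  next
    case 3
    have r: "((\<lambda>h. bump_poly p h / h) \<longlongrightarrow> 0) (at_right 0)"
    proof -
      have "((\<lambda>h. poly ([:0, 1:] * p) (inverse h) * exp (- inverse h)) \<longlongrightarrow> 0) (at_right 0)"
        by (rule filterlim_compose[OF poly_exp_tendsto_0 filterlim_inverse_at_top_right])
      moreover have "\<forall>\<^sub>F h in at_right 0. poly ([:0, 1:] * p) (inverse h) * exp (- inverse h) = bump_poly p h / h"
        using eventually_at_right_less[of 0] by eventually_elim (simp add: bump_poly_def divide_inverse)
      ultimately show ?thesis by (rule Lim_transform_eventually)
    qed
    have l: "((\<lambda>h. bump_poly p h / h) \<longlongrightarrow> 0) (at_left 0)"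
    proof (rule tendsto_eventually)
      show "\<forall>\<^sub>F h in at_left 0. bump_poly p h / h = 0"
        by (auto simp: eventually_at_filter bump_poly_def)
    qed
    have "((\<lambda>h. bump_poly p h / h) \<longlongrightarrow> 0) (at 0)" using l r by (simp add: filterlim_split_at)
    then show ?thesis using 3 by (simp add: DERIV_def bump_poly_def)
  qed
qed

lemma smooth_bump_poly: "smooth (\<lambda>x. complex_of_real (bump_poly p x))"
  unfolding smooth_iff
proof (rule smooth_on_real_deriv[where P="\<lambda>f. \<exists>p. f = (\<lambda>x. complex_of_real (bump_poly p x))"])
  fix f assume "\<exists>p. f = (\<lambda>x. complex_of_real (bump_poly p x))"
  then obtain p where f: "f = (\<lambda>x. complex_of_real (bump_poly p x))" by blast
  show "\<exists>g. (\<exists>p. g = (\<lambda>x. complex_of_real (bump_poly p x))) \<and> (\<forall>x\<in>UNIV. (f has_vector_derivative g x) (at x))"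
    unfolding f using has_vector_derivative_of_real[OF bump_poly_deriv] by blast
qed auto

lemma smooth_sqnorm: "smooth (\<lambda>v::'a::euclidean_space. complex_of_real (v \<bullet> v))"
proof -
  have "smooth_on UNIV (\<lambda>v::'a. \<Sum>b\<in>Basis. complex_of_real (v \<bullet> b) * complex_of_real (v \<bullet> b))"
    by (intro smooth_on_sum smooth_on_mult smooth_on_inner open_UNIV finite_Basis)
  moreover have "complex_of_real (v \<bullet> v) = (\<Sum>b\<in>Basis. complex_of_real (v \<bullet> b) * complex_of_real (v \<bullet> b))" for v :: 'a
    by (subst euclidean_inner) simp
  ultimately show ?thesis by (simp add: smooth_iff)
qed

text \<open>The factor \<open>exp 1\<close> normalises the value at the origin to 1, so the cutoffs
  \<open>bump (dil r y)\<close> tend to 1 as r tends to 0.\<close>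

definition bump :: "'a::euclidean_space \<Rightarrow> complex"
  where "bump v = complex_of_real (exp 1 * bump_poly 1 (1 - v \<bullet> v))"

lemma smooth_bump: "smooth (bump :: 'a::euclidean_space \<Rightarrow> complex)"
proof -
  have "smooth_on UNIV (\<lambda>v::'a. complex_of_real (bump_poly 1 (1 - v \<bullet> v)))"
  proof (rule smooth_on_compose[where V=UNIV and F="\<lambda>x. complex_of_real (bump_poly 1 x)" and g="\<lambda>v. 1 - v \<bullet> v"])
    have "smooth_on UNIV (\<lambda>v::'a. 1 - complex_of_real (v \<bullet> v))"
      by (intro smooth_on_diff smooth_on_const open_UNIV smooth_sqnorm[unfolded smooth_iff])
    then show "smooth_on UNIV (\<lambda>v::'a. complex_of_real ((1 - v \<bullet> v) \<bullet> e))" if "e \<in> Basis" for e :: real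
      using that by simp
  qed (use smooth_bump_poly in \<open>auto simp: smooth_iff\<close>)
  then show ?thesis
    unfolding bump_def[abs_def] of_real_mult smooth_iff by (intro smooth_on_cmult open_UNIV)
qed

lemma bump_0 [simp]: "bump 0 = 1"
  by (simp add: bump_def bump_poly_def exp_add[symmetric] flip: of_real_mult)

lemma bump_eq_0: "norm v \<ge> 1 \<Longrightarrow> bump v = 0"
  using power_mono[of 1 "norm v" 2] by (simp add: bump_def bump_poly_def power2_norm_eq_inner)

lemma dir_deriv_eq_0_open:
  assumes "open U" "x \<in> U" "\<And>y. y \<in> U \<Longrightarrow> f y = 0"
  shows "dir_deriv v f x = 0"
  using dir_deriv_cong_open[of U x f "\<lambda>_. 0" v] assms by (simp add: dir_deriv_eq[OF has_derivative_const])

lemma bounded_if_compact_support: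
  fixes f :: "'a::euclidean_space \<Rightarrow> complex"
  assumes "continuous_on UNIV f" "\<And>x. norm x > 1 \<Longrightarrow> f x = 0"
  shows "\<exists>C. \<forall>x. norm (f x) \<le> C"
proof -
  have "bounded (f ` cball 0 1)"
    by (intro compact_imp_bounded compact_continuous_image continuous_on_subset[OF assms(1)]) auto
  then obtain C where "\<forall>x\<in>cball 0 1. norm (f x) \<le> C" by (auto simp: bounded_iff)
  then have C: "norm (f x) \<le> C" if "norm x \<le> 1" for x using that by simp
  have "norm (f x) \<le> C" for x
    using C[of x] C[of 0] assms(2)[of x] by (cases "norm x \<le> 1") (auto intro: order_trans[OF norm_ge_zero])
  then show ?thesis by blast
qed

lemma hderiv_eq_0:
  assumes "\<And>w. norm w > 1 \<Longrightarrow> f w = 0" "norm w > 1"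
  shows "hderiv e f w = 0"
  unfolding hderiv_def
proof (rule dir_deriv_eq_0_open[where U="- cball 0 1"])
  show "w \<in> - cball 0 1" using assms(2) by simp
qed (use assms(1) in auto)

lemma bump_hderiv_bounded:
  assumes "e \<in> Basis"
  shows "\<exists>C. \<forall>w. norm (hderiv e bump w) \<le> C"
  by (intro bounded_if_compact_support smooth_continuous smooth_hderiv smooth_bump assms hderiv_eq_0 bump_eq_0) auto

lemma bump_sublap_bounded: "\<exists>C. \<forall>w::'d::finite heis. norm (sublap bump w) \<le> C"
proof (rule bounded_if_compact_support)
  show "continuous_on UNIV (sublap bump :: 'd heis \<Rightarrow> complex)"
    unfolding sublap_def[abs_def]
    by (intro continuous_on_sum smooth_continuous smooth_hderiv smooth_bump)
  show "sublap bump w = 0" if "norm w > 1" for w :: "'d heis"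
    unfolding sublap_def using that
    by (intro sum.neutral ballI hderiv_eq_0 bump_eq_0) auto
qed

section \<open>The lemma of du Bois-Reymond on an interval\<close>

lemma smooth_antiderivative:
  fixes G g :: "real \<Rightarrow> complex"
  assumes "\<And>x. (G has_vector_derivative g x) (at x)" "smooth g"
  shows "smooth G"
  unfolding smooth_iff
proof (rule smooth_on_real_deriv[where P="\<lambda>f. f = G \<or> smooth f"])
  fix f :: "real \<Rightarrow> complex" assume "f = G \<or> smooth f"
  then show "\<exists>g. (g = G \<or> smooth g) \<and> (\<forall>x\<in>UNIV. (f has_vector_derivative g x) (at x))"
  proof
    assume "f = G" then show ?thesis using assms by blast
  next
    assume f: "smooth f"
    have "(f has_vector_derivative dir_deriv 1 f x) (at x)" for x
    proof -
      note D = smooth_on_has_derivative[OF f[unfolded smooth_iff] UNIV_I, of x]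
      have "(\<lambda>v. dir_deriv v f x) = (\<lambda>v. v *\<^sub>R dir_deriv 1 f x)"
        using linear_scale[OF has_derivative_linear[OF D], of _ 1]
        unfolding real_scaleR_def mult_1_right by (intro ext)
      then show ?thesis using D unfolding has_vector_derivative_def by (simp only:)
    qed
    moreover have "smooth (dir_deriv 1 f)"
      using smooth_on_dir_deriv[of UNIV f 1] f by (simp add: smooth_iff)
    ultimately show ?thesis by blast
  qed
qed auto

text \<open>\<open>G\<close> is a smooth step. The test function \<open>G ((t - a) / \<epsilon>) - G ((t - b) / \<epsilon>)\<close> forces
  \<open>F\<close> to have the same mean values near \<open>a\<close> and near \<open>b\<close>.\<close>

lemma du_Bois_Reymond:
  fixes F :: "real \<Rightarrow> complex"
  assumes F: "continuous_on {l<..<r} F"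
    and weak: "\<And>\<theta> \<theta>' c d. smooth \<theta> \<Longrightarrow> (\<And>t. (\<theta> has_vector_derivative \<theta>' t) (at t)) \<Longrightarrow>
      continuous_on UNIV \<theta>' \<Longrightarrow> l < c \<Longrightarrow> c < d \<Longrightarrow> d < r \<Longrightarrow>
      (\<And>t. t \<notin> {c..d} \<Longrightarrow> \<theta> t = 0) \<Longrightarrow> (\<integral>t\<in>{c..d}. \<theta>' t * F t \<partial>lborel) = 0"
    and ab: "l < a" "a < b" "b < r"
  shows "F a = F b"
proof -
  define \<eta> :: "real \<Rightarrow> real" where "\<eta> x = Re (bump x)" for x
  have \<eta>c: "complex_of_real (\<eta> x) = bump x" for x by (simp add: \<eta>_def bump_def)
  have \<eta>_cont: "continuous_on UNIV \<eta>"
    unfolding \<eta>_def by (intro continuous_intros smooth_continuous smooth_bump)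
  have \<eta>0: "\<eta> x = 0" if "\<bar>x\<bar> \<ge> 1" for x using bump_eq_0[of x] that by (simp add: \<eta>_def)
  have "\<exists>G. \<forall>x::real. -\<infinity> < ereal x \<longrightarrow> ereal x < \<infinity> \<longrightarrow> (G has_vector_derivative \<eta> x) (at x)"
    using \<eta>_cont by (intro einterval_antiderivative) (auto simp: continuous_on_eq_continuous_at)
  then obtain G where G: "\<And>x. (G has_real_derivative \<eta> x) (at x)"
    by (auto simp: has_real_derivative_iff_has_vector_derivative)
  have const: "\<exists>k. \<forall>x\<in>S. G x = k" if "convex S" "\<And>x. x \<in> S \<Longrightarrow> \<bar>x\<bar> \<ge> 1" for S
    using that G \<eta>0 by (intro has_field_derivative_zero_constant) (metis has_field_derivative_at_within)+
  \<comment> \<open>\<open>G\<close> is constant on each side of [-1, 1]. Two shifted copies share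
    these constants, so their difference vanishes outside the interval between the two
    steps.\<close>
  obtain k1 k2 where k1: "\<And>x. x \<le> -1 \<Longrightarrow> G x = k1" and k2: "\<And>x. x \<ge> 1 \<Longrightarrow> G x = k2"
    using const[of "{..-1}"] const[of "{1..}"] by auto
  \<comment> \<open>An unnormalised mean of \<open>F\<close> around \<open>x\<close> at scale
    \<open>e\<close>. The indicator changes nothing where the bump lives, but it keeps the argument
    of \<open>F\<close> inside the interval on which \<open>F\<close> is known to be
    continuous.\<close>
  define M where "M x e = (\<integral>y. \<eta> y *\<^sub>R (indicator {-1..1} y *\<^sub>R F (x + e * y)) \<partial>lborel)" for x e
  have eq: "M a e = M b e" if e: "e > 0" "l < a - e" "b + e < r" for e
  proof -
    define \<theta> where "\<theta> t = complex_of_real (G ((t - a) / e) - G ((t - b) / e))" for t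
    define \<theta>' where "\<theta>' t = complex_of_real ((\<eta> ((t - a) / e) - \<eta> ((t - b) / e)) / e)" for t
    have der: "(\<theta> has_vector_derivative \<theta>' t) (at t)" for t
    proof -
      have "((\<lambda>t. G ((t - a) / e) - G ((t - b) / e)) has_real_derivative
        \<eta> ((t - a) / e) * (1 / e) - \<eta> ((t - b) / e) * (1 / e)) (at t)"
        by (intro DERIV_diff DERIV_chain2[OF G]) (use e in \<open>auto intro!: derivative_eq_intros\<close>)
      then show ?thesis unfolding \<theta>_def[abs_def] \<theta>'_def
        by (intro has_vector_derivative_of_real) (simp add: diff_divide_distrib)
    qed
    have cont: "continuous_on UNIV \<theta>'"
      unfolding \<theta>'_def by (intro continuous_intros continuous_on_compose2[OF \<eta>_cont]) (use e in auto)
    have sm': "smooth (\<lambda>t. bump ((t - x) / e))" for x :: real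
      by (rule smooth_compose_affine[OF smooth_bump, where L="\<lambda>t. t / e" and c="- x / e"])
        (auto simp: bounded_linear_divide diff_divide_distrib)
    have "smooth \<theta>'"
    proof -
      have "\<theta>' = (\<lambda>t. (1 / complex_of_real e) * (bump ((t - a) / e) - bump ((t - b) / e)))"
        by (auto simp: \<theta>'_def \<eta>c[symmetric])
      moreover have "smooth (\<lambda>t. (1 / complex_of_real e) * (bump ((t - a) / e) - bump ((t - b) / e)))"
        unfolding smooth_iff by (intro smooth_on_cmult smooth_on_diff open_UNIV sm'[unfolded smooth_iff])
      ultimately show ?thesis by simp
    qed
    then have sm: "smooth \<theta>" using der by (rule smooth_antiderivative[rotated])
    have supp: "\<theta> t = 0" if "t \<notin> {a - e..b + e}" for t
    proof (cases "t < a - e")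
      case True
      then have "(t - a) / e \<le> -1" "(t - b) / e \<le> -1" using e ab by (auto simp: field_simps)
      then show ?thesis by (simp add: \<theta>_def k1)
    next
      case False
      then have "(t - a) / e \<ge> 1" "(t - b) / e \<ge> 1" using e ab that by (auto simp: field_simps)
      then show ?thesis by (simp add: \<theta>_def k2)
    qed
    have "(\<integral>t\<in>{a - e..b + e}. \<theta>' t * F t \<partial>lborel) = 0"
      by (rule weak[OF sm der cont _ _ _ supp]) (use ab e in auto)
    define H where "H x t = \<eta> ((t - x) / e) *\<^sub>R (indicator {x - e..x + e} t *\<^sub>R F t)" for x t
    have Hint: "integrable lborel (H x)" if "x \<in> {a, b}" for x
    proof -
      have "continuous_on {x - e..x + e} (\<lambda>t. \<eta> ((t - x) / e) *\<^sub>R F t)"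
        using that ab e by (intro continuous_intros continuous_on_compose2[OF \<eta>_cont] continuous_on_subset[OF F]) auto
      from borel_integrable_atLeastAtMost'[OF this] show ?thesis
        by (simp add: set_integrable_def H_def[abs_def] mult.commute)
    qed
    have HM: "(\<integral>t. H x t \<partial>lborel) = e *\<^sub>R M x e" for x
    proof -
      have Hs: "H x (x + e * y) = \<eta> y *\<^sub>R (indicator {-1..1} y *\<^sub>R F (x + e * y))" for y
      proof -
        have "x + e * y \<in> {x - e..x + e} \<longleftrightarrow> y \<in> {-1..1}"
          using e mult_le_cancel_left_pos[of e "-1" y] mult_le_cancel_left_pos[of e y 1] by auto
        then show ?thesis using e by (simp add: H_def indicator_def)
      qed
      have "(\<integral>t. H x t \<partial>lborel) = \<bar>e\<bar> *\<^sub>R (\<integral>y. H x (x + e * y) \<partial>lborel)"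
        using e by (intro lborel_integral_real_affine) auto
      then show ?thesis using e by (simp add: M_def Hs)
    qed
    have "indicator {a - e..b + e} t *\<^sub>R (\<theta>' t * F t) = (1 / e) *\<^sub>R (H a t - H b t)" for t
    proof -
      have Hx: "H x t = indicator {a - e..b + e} t *\<^sub>R (\<eta> ((t - x) / e) *\<^sub>R F t)" if "x \<in> {a, b}" for x
      proof (cases "t \<in> {x - e..x + e}")
        case True
        then have "t \<in> {a - e..b + e}" using that ab by auto
        with True show ?thesis by (simp add: H_def)
      next
        case False
        then have "\<bar>(t - x) / e\<bar> \<ge> 1" using e by (auto simp: abs_if field_simps)
        then show ?thesis by (simp add: H_def \<eta>0)
      qed
      show ?thesis unfolding Hx[of a, simplified] Hx[of b, simplified] \<theta>'_def
        by (simp add: scaleR_conv_of_real algebra_simps diff_divide_distrib)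
    qed
    then have "(\<integral>t\<in>{a - e..b + e}. \<theta>' t * F t \<partial>lborel) = (1 / e) *\<^sub>R (e *\<^sub>R M a e - e *\<^sub>R M b e)"
      unfolding set_lebesgue_integral_def using Hint by (simp add: HM[symmetric])
    with \<open>(\<integral>t\<in>{a - e..b + e}. \<theta>' t * F t \<partial>lborel) = 0\<close> show ?thesis using e by simp
  qed
  define m where "m = (\<integral>y. \<eta> y *\<^sub>R indicat_real {-1..1} y \<partial>lborel)"
  \<comment> \<open>A null sequence of scales. The denominator is at least 2, so every scale stays
    strictly below both margins, as the equality of means requires.\<close>
  define X where "X n = min (a - l) (r - b) / (2 + real n)" for n
  have X: "X n > 0" "X n < min (a - l) (r - b)" for n
  proof -
    have *: "\<mu> / (2 + real n) > 0 \<and> \<mu> / (2 + real n) < \<mu>" if "\<mu> > 0" for \<mu>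
    proof -
      have "\<mu> * real n \<ge> 0" using that by simp
      then show ?thesis using that by (simp add: field_simps add_pos_nonneg)
    qed
    have "min (a - l) (r - b) > 0" using ab by auto
    from *[OF this] show "X n > 0" "X n < min (a - l) (r - b)" unfolding X_def by blast+
  qed
  have X0: "X \<longlonglongrightarrow> 0" unfolding X_def by real_asymp
  have lim: "(\<lambda>n. M x (X n)) \<longlonglongrightarrow> m *\<^sub>R F x" if x: "x \<in> {a, b}" for x
  proof -
    define \<rho> where "\<rho> = X 0"
    have Xle: "X n \<le> \<rho>" for n
    proof -
      have "min (a - l) (r - b) \<ge> 0" using ab by auto
      then show ?thesis unfolding \<rho>_def X_def by (intro divide_left_mono) auto
    qed
    have sub: "{x - \<rho>..x + \<rho>} \<subseteq> {l<..<r}" using X[of 0] ab x by (auto simp: \<rho>_def)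
    have "bounded (F ` {x - \<rho>..x + \<rho>})"
      by (intro compact_imp_bounded compact_continuous_image continuous_on_subset[OF F sub]) auto
    then obtain B where "\<forall>t\<in>{x - \<rho>..x + \<rho>}. norm (F t) \<le> B" by (auto simp: bounded_iff)
    then have B: "norm (F t) \<le> B" if "t \<in> {x - \<rho>..x + \<rho>}" for t using that by blast
    have inside: "x + X n * y \<in> {x - \<rho>..x + \<rho>}" if "y \<in> {-1..1}" for n y
    proof -
      have "\<bar>X n * y\<bar> \<le> \<rho> * 1" unfolding abs_mult using Xle[of n] X(1)[of n] that by (intro mult_mono) auto
      then show ?thesis by auto
    qed
    have "(\<lambda>n. M x (X n)) \<longlonglongrightarrow> (\<integral>y. \<eta> y *\<^sub>R (indicator {-1..1} y *\<^sub>R F x) \<partial>lborel)"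
      unfolding M_def
    proof (rule integral_dominated_convergence[where w="\<lambda>y. indicator {-1..1} y *\<^sub>R (\<bar>\<eta> y\<bar> * B)"])
      have \<eta>m[measurable]: "\<eta> \<in> borel_measurable borel" using \<eta>_cont by (rule borel_measurable_continuous_onI)
      show "(\<lambda>y. \<eta> y *\<^sub>R (indicat_real {-1..1} y *\<^sub>R F x)) \<in> borel_measurable lborel" by measurable
      show "(\<lambda>y. \<eta> y *\<^sub>R (indicat_real {-1..1} y *\<^sub>R F (x + X n * y))) \<in> borel_measurable lborel" for n
      proof -
        have "continuous_on {-1..1} (\<lambda>y. F (x + X n * y))"
          using inside sub by (intro continuous_on_compose2[OF F]) (auto intro!: continuous_intros)
        from borel_measurable_continuous_on_indicator[OF _ this]
        have [measurable]: "(\<lambda>y. indicat_real {-1..1} y *\<^sub>R F (x + X n * y)) \<in> borel_measurable borel" by simp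
        show ?thesis by measurable
      qed
      have "continuous_on {-1..1} (\<lambda>y. \<bar>\<eta> y\<bar> * B)"
        by (intro continuous_intros continuous_on_subset[OF \<eta>_cont]) auto
      from borel_integrable_atLeastAtMost'[OF this]
      show "integrable lborel (\<lambda>y. indicat_real {-1..1} y *\<^sub>R (\<bar>\<eta> y\<bar> * B))"
        by (simp add: set_integrable_def)
      show "AE y in lborel. (\<lambda>n. \<eta> y *\<^sub>R (indicat_real {-1..1} y *\<^sub>R F (x + X n * y))) \<longlonglongrightarrow> \<eta> y *\<^sub>R (indicat_real {-1..1} y *\<^sub>R F x)"
      proof (rule AE_I2, intro tendsto_scaleR tendsto_const)
        fix y
        have "isCont F x" using F sub X(1)[of 0] ab x by (auto simp: continuous_on_eq_continuous_at)
        moreover have "(\<lambda>n. x + X n * y) \<longlonglongrightarrow> x"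
          using tendsto_add[OF tendsto_const tendsto_mult_right[OF X0, of y], of x] by simp
        ultimately show "(\<lambda>n. F (x + X n * y)) \<longlonglongrightarrow> F x" by (rule isCont_tendsto_compose)
      qed
      show "AE y in lborel. norm (\<eta> y *\<^sub>R (indicat_real {-1..1} y *\<^sub>R F (x + X n * y))) \<le> indicat_real {-1..1} y *\<^sub>R (\<bar>\<eta> y\<bar> * B)" for n
        using B[OF inside] by (intro AE_I2) (auto simp: indicator_def intro!: mult_left_mono)
    qed
    also have "(\<integral>y. \<eta> y *\<^sub>R (indicator {-1..1} y *\<^sub>R F x) \<partial>lborel) = m *\<^sub>R F x"
    proof -
      have "integrable lborel (\<lambda>y. indicat_real {-1..1} y *\<^sub>R \<eta> y)"
        using borel_integrable_atLeastAtMost'[OF continuous_on_subset[OF \<eta>_cont]] by (simp add: set_integrable_def)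
      then show ?thesis unfolding m_def
        by (subst integral_scaleR_left[symmetric]) (auto simp: mult.commute)
    qed
    finally show ?thesis .
  qed
  have "M a (X n) = M b (X n)" for n using X[of n] by (intro eq) auto
  then have "(\<lambda>n. M a (X n)) \<longlonglongrightarrow> m *\<^sub>R F b" using lim[of b] by simp
  with lim[of a] have "m *\<^sub>R F a = m *\<^sub>R F b" by (intro LIMSEQ_unique[of "\<lambda>n. M a (X n)"]) simp_all
  moreover have "m \<noteq> 0"
  proof
    assume "m = 0"
    have nn: "\<eta> y \<ge> 0" for y by (simp add: \<eta>_def bump_def bump_poly_def)
    have i: "integrable lborel (\<lambda>y. \<eta> y *\<^sub>R indicat_real {-1..1} y)"
      using borel_integrable_atLeastAtMost'[OF continuous_on_subset[OF \<eta>_cont], of "-1" 1]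
      by (simp add: set_integrable_def mult.commute)
    then have "AE y in lborel. \<eta> y *\<^sub>R indicat_real {-1..1} y = 0"
      using \<open>m = 0\<close> nn unfolding m_def by (subst (asm) integral_nonneg_eq_0_iff_AE) auto
    then have "AE y in lborel. y \<notin> {-1/2<..<1/2::real}"
    proof eventually_elim
      fix y :: real assume *: "\<eta> y *\<^sub>R indicat_real {-1..1} y = 0"
      show "y \<notin> {-1/2<..<1/2}"
      proof
        assume y: "y \<in> {-1/2<..<1/2}"
        then have "\<bar>y\<bar> < 1" by auto
        then have "y * y < 1" by (simp flip: power2_eq_square add: abs_square_less_1)
        then have "\<eta> y > 0" by (simp add: \<eta>_def bump_def bump_poly_def)
        with * y show False by auto
      qed
    qed
    then have "emeasure lborel {-1/2<..<1/2::real} = 0"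
      by (subst (asm) AE_iff_measurable[of "{-1/2<..<1/2}"]) auto
    then show False by simp
  qed
  ultimately show ?thesis by simp
qed

section \<open>The total mass of the heat kernel\<close>

definition weight_bounded :: "('a::euclidean_space \<Rightarrow> complex) \<Rightarrow> bool"
  where "weight_bounded f \<longleftrightarrow> (\<exists>C. \<forall>w. norm (f w) \<le> C * weight w)"

lemma schwartz_smooth: "schwartz f \<Longrightarrow> smooth f"
  by (simp add: schwartz_def)

lemma weight_boundedI:
  fixes f :: "'a::euclidean_space \<Rightarrow> complex"
  assumes "\<And>w. (1 + norm w) ^ (2 * DIM('a)) * norm (f w) \<le> C"
  shows "weight_bounded f"
  unfolding weight_bounded_def
proof (intro exI allI)
  fix w :: 'a
  have "(1 + norm w) ^ (2 * DIM('a)) > 0" by (simp add: add_pos_nonneg)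
  then show "norm (f w) \<le> C * weight w"
    using assms[of w] by (simp add: weight_def pos_le_divide_eq mult.commute)
qed

lemma schwartz_weight_bounded:
  assumes "schwartz f"
  shows "weight_bounded f"
proof -
  obtain C where "\<forall>w. (1 + norm w) ^ (2 * DIM('a)) * norm (iter_deriv [] f w) \<le> C"
    using assms unfolding schwartz_def by (metis empty_set empty_subsetI)
  then show ?thesis by (intro weight_boundedI[of f C]) simp
qed

lemma schwartz_hderiv_weight_bounded:
  fixes f :: "'d::finite heis \<Rightarrow> complex"
  assumes f: "schwartz f" and e: "e \<in> Basis"
  shows "weight_bounded (hderiv e f)"
proof -
  let ?N = "2 * DIM('d heis)"
  have B: "(e, 0) \<in> (Basis :: 'd heis set)" "(0, 1) \<in> (Basis :: 'd heis set)"
    using e by (auto simp: Basis_prod_def)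
  obtain C1 where C1: "\<And>w. (1 + norm w) ^ ?N * norm (dir_deriv (e, 0) f w) \<le> C1"
    using f[unfolded schwartz_def, THEN conjunct2, rule_format, of "[(e, 0)]" ?N] B by auto
  \<comment> \<open>The coefficient of the s-derivative in a left invariant field grows linearly;
    the additional power pays for it.\<close>
  obtain C2 where C2: "\<And>w. (1 + norm w) ^ Suc ?N * norm (dir_deriv (0, 1) f w) \<le> C2"
    using f[unfolded schwartz_def, THEN conjunct2, rule_format, of "[(0, 1)]" "Suc ?N"] B by auto
  show ?thesis
  proof (rule weight_boundedI)
    fix w :: "'d heis"
    let ?m = "(1 + norm w) ^ ?N"
    have "f differentiable (at w)"
      using schwartz_smooth[OF f] smooth_on_differentiable unfolding smooth_iff by blast
    note * = dir_deriv_lincomb[OF this, of e "2 * (fst w \<bullet> mult_i e)"]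
    have "\<bar>fst w \<bullet> mult_i e\<bar> \<le> norm (fst w) * norm (mult_i e)" by (rule Cauchy_Schwarz_ineq2)
    also have "\<dots> \<le> norm w" using e norm_fst_le[of "fst w" "snd w"] by simp
    finally have i: "\<bar>fst w \<bullet> mult_i e\<bar> \<le> 1 + norm w" by simp
    have "?m * norm (hderiv e f w) \<le> ?m * (norm (dir_deriv (e, 0) f w) + 2 * (1 + norm w) * norm (dir_deriv (0, 1) f w))"
      unfolding hderiv_def hvec_def *
    proof (intro mult_left_mono order_trans[OF norm_triangle_ineq] add_left_mono)
      show "norm (complex_of_real (2 * (fst w \<bullet> mult_i e)) * dir_deriv (0, 1) f w) \<le> 2 * (1 + norm w) * norm (dir_deriv (0, 1) f w)"
        unfolding norm_mult norm_of_real using i by (intro mult_right_mono) auto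
    qed simp
    also have "\<dots> = ?m * norm (dir_deriv (e, 0) f w) + 2 * ((1 + norm w) ^ Suc ?N * norm (dir_deriv (0, 1) f w))"
      by (simp add: algebra_simps)
    also have "\<dots> \<le> C1 + 2 * C2" using C1[of w] C2[of w] by linarith
    finally show "?m * norm (hderiv e f w) \<le> C1 + 2 * C2" .
  qed
qed

lemma weight_bounded_integrable:
  assumes "weight_bounded f" "f \<in> borel_measurable borel"
  shows "integrable lborel f"
proof -
  obtain C where C: "\<And>w. norm (f w) \<le> C * weight w" using assms(1) by (auto simp: weight_bounded_def)
  show ?thesis
    by (rule integrable_dominated[OF integrable_mult_right[OF integrable_weight'] _ C]) (use assms in simp)
qed

lemma smooth_measurable: "smooth f \<Longrightarrow> f \<in> borel_measurable borel"
  by (intro borel_measurable_continuous_onI smooth_continuous)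

lemma std_normal_char:
  "(\<integral>x. complex_of_real (std_normal_density x) * exp (\<i> * complex_of_real (t * x)) \<partial>lborel) =
    complex_of_real (exp (- (t\<^sup>2) / 2))"
proof -
  have "(\<integral>x. complex_of_real (std_normal_density x) * exp (\<i> * complex_of_real (t * x)) \<partial>lborel) =
    (\<integral>x. std_normal_density x *\<^sub>R iexp (t * x) \<partial>lborel)"
    by (simp add: scaleR_conv_of_real)
  also have "\<dots> = char std_normal_distribution t"
    unfolding char_def by (subst integral_density) auto
  finally show ?thesis by (simp add: char_std_normal_distribution)
qed

text \<open>Fourier inversion at \<open>0\<close>, regularised by a Gaussian in \<open>s\<close>.\<close>

lemma fourier_inversion_0:
  fixes A :: "real \<Rightarrow> real" and g :: "real \<Rightarrow> complex"
  assumes A: "continuous_on UNIV A" "integrable lborel A" "\<And>l. \<bar>A l\<bar> \<le> B"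
    and g: "\<And>s. g s = (\<integral>l. complex_of_real (A l) * exp (\<i> * complex_of_real (l * s)) \<partial>lborel)"
    and gint: "integrable lborel g"
  shows "(\<integral>s. g s \<partial>lborel) = complex_of_real (2 * pi * A 0)"
proof -
  let ?\<nu> = "std_normal_density"
  have Am[measurable]: "A \<in> borel_measurable borel" using A(1) by (rule borel_measurable_continuous_onI)
  define I where "I n = (\<integral>s. g s * complex_of_real (?\<nu> (s / real (Suc n))) \<partial>lborel)" for n
  have \<nu>0: "?\<nu> 0 = 1 / sqrt (2 * pi)" by (simp add: std_normal_density_def)
  have \<nu>cont: "continuous_on UNIV ?\<nu>" unfolding std_normal_density_def[abs_def] by (intro continuous_intros) auto
  have \<nu>le: "?\<nu> x \<le> ?\<nu> 0" "?\<nu> x \<ge> 0" for x by (auto simp: std_normal_density_def intro!: divide_right_mono)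
  have gm[measurable]: "g \<in> borel_measurable borel" using gint by auto
  have lim1: "I \<longlonglongrightarrow> (\<integral>s. g s * complex_of_real (?\<nu> 0) \<partial>lborel)"
    unfolding I_def
  proof (rule integral_dominated_convergence[where w="\<lambda>s. norm (g s) * ?\<nu> 0"])
    show "integrable lborel (\<lambda>s. norm (g s) * ?\<nu> 0)" using gint by simp
    show "AE s in lborel. (\<lambda>n. g s * complex_of_real (?\<nu> (s / real (Suc n)))) \<longlonglongrightarrow> g s * complex_of_real (?\<nu> 0)"
    proof (rule AE_I2, intro tendsto_intros)
      fix s :: real
      have "(\<lambda>n. s / real (Suc n)) \<longlonglongrightarrow> 0" by real_asymp
      moreover have "isCont ?\<nu> 0" using \<nu>cont by (simp add: continuous_on_eq_continuous_at)
      ultimately show "(\<lambda>n. ?\<nu> (s / real (Suc n))) \<longlonglongrightarrow> ?\<nu> 0"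
        using isCont_tendsto_compose by blast
    qed
    show "AE s in lborel. norm (g s * complex_of_real (?\<nu> (s / real (Suc n)))) \<le> norm (g s) * ?\<nu> 0" for n
    proof (rule AE_I2)
      fix s show "norm (g s * complex_of_real (?\<nu> (s / real (Suc n)))) \<le> norm (g s) * ?\<nu> 0"
        unfolding norm_mult norm_of_real using \<nu>le by (intro mult_left_mono) auto
    qed
  qed measurable
  \<comment> \<open>The Gaussian makes the double integral absolutely convergent, so that the order
    may be exchanged. Its transform is a Gaussian that concentrates at frequency 0, which the
    substitution y = l m turns into the slowly varying factor \<open>A (y / m)\<close>.\<close>
  have In: "I n = (\<integral>y. complex_of_real (A (y / real (Suc n)) * exp (- (y\<^sup>2) / 2)) \<partial>lborel)" for n
  proof -
    define m where "m = real (Suc n)"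
    have m: "m > 0" by (simp add: m_def)
    have \<nu>int: "integrable lborel (\<lambda>s. ?\<nu> (s / m))"
    proof -
      have "integrable lborel (\<lambda>s. ?\<nu> (0 + 1 / m * s))"
        using m by (intro lborel_integrable_real_affine integrable_normal_density) auto
      then show ?thesis by (simp only: add_0 times_divide_eq_left mult_1)
    qed
    have "I n = (\<integral>s. (\<integral>l. complex_of_real (A l) * exp (\<i> * complex_of_real (l * s)) * complex_of_real (?\<nu> (s / m)) \<partial>lborel) \<partial>lborel)"
      unfolding I_def g m_def[symmetric] by simp
    also have "\<dots> = (\<integral>l. (\<integral>s. complex_of_real (A l) * exp (\<i> * complex_of_real (l * s)) * complex_of_real (?\<nu> (s / m)) \<partial>lborel) \<partial>lborel)"
    proof (rule lborel_pair.Fubini_integral, rule lborel_pair.Fubini_integrable)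
      have n: "norm (complex_of_real (A l) * exp (\<i> * complex_of_real (l * s)) * complex_of_real (?\<nu> (s / m))) = \<bar>A l\<bar> * ?\<nu> (s / m)" for l s
        using \<nu>le(2) by (simp add: norm_mult)
      show "(\<lambda>(l, s). complex_of_real (A l) * exp (\<i> * complex_of_real (l * s)) * complex_of_real (?\<nu> (s / m))) \<in> borel_measurable (lborel \<Otimes>\<^sub>M lborel)"
        by measurable
      show "integrable lborel (\<lambda>l. \<integral>s. norm (case (l, s) of (l, s) \<Rightarrow> complex_of_real (A l) * exp (\<i> * complex_of_real (l * s)) * complex_of_real (?\<nu> (s / m))) \<partial>lborel)"
        unfolding prod.case n using A(2) by simp
      show "AE l in lborel. integrable lborel (\<lambda>s. case (l, s) of (l, s) \<Rightarrow> complex_of_real (A l) * exp (\<i> * complex_of_real (l * s)) * complex_of_real (?\<nu> (s / m)))"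
        unfolding prod.case
      proof (rule AE_I2)
        fix l
        show "integrable lborel (\<lambda>s. complex_of_real (A l) * exp (\<i> * complex_of_real (l * s)) * complex_of_real (?\<nu> (s / m)))"
          by (rule integrable_dominated[OF integrable_mult_right[OF \<nu>int, of "\<bar>A l\<bar>"] _ eq_refl[OF n]]) measurable
      qed
    qed
    also have "\<dots> = (\<integral>l. complex_of_real (A l) * (\<integral>s. complex_of_real (?\<nu> (s / m)) * exp (\<i> * complex_of_real (l * s)) \<partial>lborel) \<partial>lborel)"
      by (simp add: mult.assoc mult.commute[of "exp _"])
    also have "\<dots> = (\<integral>l. complex_of_real (A l) * (complex_of_real m * complex_of_real (exp (- ((l * m)\<^sup>2) / 2))) \<partial>lborel)"
    proof -
      have "(\<integral>s. complex_of_real (?\<nu> (s / m)) * exp (\<i> * complex_of_real (l * s)) \<partial>lborel) =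
        \<bar>m\<bar> *\<^sub>R (\<integral>x. complex_of_real (?\<nu> ((0 + m * x) / m)) * exp (\<i> * complex_of_real (l * (0 + m * x))) \<partial>lborel)" for l
        using m by (intro lborel_integral_real_affine) auto
      also have "\<bar>m\<bar> *\<^sub>R (\<integral>x. complex_of_real (?\<nu> ((0 + m * x) / m)) * exp (\<i> * complex_of_real (l * (0 + m * x))) \<partial>lborel) =
         complex_of_real m * complex_of_real (exp (- ((l * m)\<^sup>2) / 2))" for l
        using m std_normal_char[of "l * m"] by (simp add: scaleR_conv_of_real mult.assoc)
      finally show ?thesis by (simp only:)
    qed
    also have "\<dots> = \<bar>1 / m\<bar> *\<^sub>R (\<integral>y. complex_of_real (A (0 + 1 / m * y)) * (complex_of_real m * complex_of_real (exp (- (((0 + 1 / m * y) * m)\<^sup>2) / 2))) \<partial>lborel)"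
      using m by (intro lborel_integral_real_affine) auto
    also have "\<dots> = (\<integral>y. complex_of_real (A (y / m) * exp (- (y\<^sup>2) / 2)) \<partial>lborel)"
    proof -
      have *: "complex_of_real (A (0 + 1 / m * y)) * (complex_of_real m * complex_of_real (exp (- (((0 + 1 / m * y) * m)\<^sup>2) / 2)))
        = complex_of_real m * complex_of_real (A (y / m) * exp (- (y\<^sup>2) / 2))" for y
        using m by simp
      show ?thesis unfolding * integral_mult_right_zero using m by (simp add: scaleR_conv_of_real)
    qed
    finally show ?thesis by (simp add: m_def)
  qed
  have eq: "exp (- (y\<^sup>2) / 2) = sqrt (2 * pi) * ?\<nu> y" for y by (simp add: std_normal_density_def)
  have "(\<lambda>n. \<integral>y. complex_of_real (A (y / real (Suc n)) * exp (- (y\<^sup>2) / 2)) \<partial>lborel) \<longlonglongrightarrow>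
    (\<integral>y. complex_of_real (A 0 * exp (- (y\<^sup>2) / 2)) \<partial>lborel)"
  proof (rule integral_dominated_convergence[where w="\<lambda>y. B * exp (- (y\<^sup>2) / 2)"])
    show "integrable lborel (\<lambda>y. B * exp (- (y\<^sup>2) / 2))" unfolding eq by simp
    show "AE y in lborel. (\<lambda>n. complex_of_real (A (y / real (Suc n)) * exp (- (y\<^sup>2) / 2))) \<longlonglongrightarrow> complex_of_real (A 0 * exp (- (y\<^sup>2) / 2))"
    proof (rule AE_I2, intro tendsto_intros)
      fix y :: real
      have "(\<lambda>n. y / real (Suc n)) \<longlonglongrightarrow> 0" by real_asymp
      moreover have "isCont A 0" using A(1) by (simp add: continuous_on_eq_continuous_at)
      ultimately show "(\<lambda>n. A (y / real (Suc n))) \<longlonglongrightarrow> A 0"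
        using isCont_tendsto_compose by blast
    qed
    show "AE y in lborel. norm (complex_of_real (A (y / real (Suc n)) * exp (- (y\<^sup>2) / 2))) \<le> B * exp (- (y\<^sup>2) / 2)" for n
      unfolding norm_of_real abs_mult abs_exp_cancel by (intro AE_I2 mult_right_mono A) simp
  qed measurable
  also have "(\<integral>y. complex_of_real (A 0 * exp (- (y\<^sup>2) / 2)) \<partial>lborel) = complex_of_real (A 0 * sqrt (2 * pi))"
    unfolding eq integral_complex_of_real by simp
  finally have "I \<longlonglongrightarrow> complex_of_real (A 0 * sqrt (2 * pi))" unfolding In[symmetric] .
  from LIMSEQ_unique[OF lim1 this]
  have "(\<integral>s. g s \<partial>lborel) * complex_of_real (?\<nu> 0) = complex_of_real (A 0 * sqrt (2 * pi))"
    using gint by simp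
  then have "(\<integral>s. g s \<partial>lborel) * complex_of_real (?\<nu> 0) * complex_of_real (sqrt (2 * pi)) = complex_of_real (A 0 * sqrt (2 * pi)) * complex_of_real (sqrt (2 * pi))"
    by simp
  also have "(\<integral>s. g s \<partial>lborel) * complex_of_real (?\<nu> 0) * complex_of_real (sqrt (2 * pi)) = (\<integral>s. g s \<partial>lborel) * complex_of_real (?\<nu> 0 * sqrt (2 * pi))"
    by simp
  also have "?\<nu> 0 * sqrt (2 * pi) = 1" by (simp add: \<nu>0)
  also have "complex_of_real (A 0 * sqrt (2 * pi)) * complex_of_real (sqrt (2 * pi)) = complex_of_real (A 0 * (sqrt (2 * pi) * sqrt (2 * pi)))"
    by (simp only: of_real_mult mult.assoc)
  also have "sqrt (2 * pi) * sqrt (2 * pi) = 2 * pi" by simp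
  finally show ?thesis by (simp add: mult_ac)
qed

text \<open>Integrating over s first evaluates the amplitude at \<lambda> = 0 by Fourier inversion
  and leaves a positive Gaussian in z. Nonvanishing suffices, because the kernel is divided by its
  mass in the end.\<close>

lemma heat_kernel_mass:
  "(\<integral>w. heat_kernel_int (\<lambda>l. 1) w \<partial>(lborel :: 'd::finite heis measure)) \<noteq> 0"
proof -
  let ?h = "heat_kernel_int (\<lambda>l. 1) :: 'd heis \<Rightarrow> complex"
  have am: "amplitude (\<lambda>l. 1)" by (rule amplitude.const)
  have sch: "schwartz (?h :: 'd heis \<Rightarrow> complex)"
    by (intro heat_class_schwartz heat_class.base am)
  have hm[measurable]: "(?h :: 'd heis \<Rightarrow> complex) \<in> borel_measurable borel"
    by (intro smooth_measurable schwartz_smooth sch)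
  have hint: "integrable lborel (?h :: 'd heis \<Rightarrow> complex)"
    by (intro weight_bounded_integrable schwartz_weight_bounded sch hm)
  \<comment> \<open>Here 8 pi is 4 times 2 pi: the 4 comes from substituting 4s for s, which clears
    the 1/4 in the phase, and 2 pi from Fourier inversion.\<close>
  define K where "K = 8 * pi * l_sinh 0 ^ CARD('d)"
  have K: "K > 0" using l_sinh_pos[of 0] by (simp add: K_def)
  have fiber: "(\<integral>s. ?h (z, s) \<partial>lborel) = complex_of_real (K * exp (- (z \<bullet> z / 4)))" for z :: "complex ^ 'd"
  proof -
    define A where "A l = l_sinh l ^ CARD('d) * exp (- (l_coth l * (z \<bullet> z) / 4))" for l
    have Acont: "continuous_on UNIV A"
      unfolding A_def by (intro continuous_intros l_sinh_continuous amplitude_continuous amplitude_l_coth) auto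
    have Ale: "\<bar>A l\<bar> \<le> \<bar>l_sinh l ^ CARD('d) * 1\<bar>" for l
    proof -
      have "l_coth l * (z \<bullet> z) \<ge> 0" using l_coth_ge_1[of l] by (intro mult_nonneg_nonneg) auto
      then show ?thesis by (simp add: A_def abs_mult mult_left_le)
    qed
    have Aint: "integrable lborel A"
      by (rule Bochner_Integration.integrable_bound[OF integrable_amplitude[OF am card_ge_1[where 'd='d]]])
        (use Ale borel_measurable_continuous_onI[OF Acont] in auto)
    obtain C where C: "\<And>l. \<bar>l_sinh l ^ CARD('d) * 1\<bar> \<le> C * (1 / (1 + l\<^sup>2))"
      using amplitude_decay[OF am card_ge_1[where 'd='d]] by blast
    have AC: "\<bar>A l\<bar> \<le> \<bar>C\<bar>" for l
    proof -
      have "C * (1 / (1 + l\<^sup>2)) \<le> \<bar>C\<bar> * (1 / (1 + l\<^sup>2))" by (intro mult_right_mono) auto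
      also have "\<dots> \<le> \<bar>C\<bar>" by (intro mult_left_le) (auto simp: add_pos_nonneg)
      finally show ?thesis using Ale[of l] C[of l] by linarith
    qed
    have hz: "integrable lborel (\<lambda>s. ?h (z, s))"
    proof -
      obtain D where D: "\<And>w::'d heis. norm (?h w) \<le> D * weight w"
        using schwartz_weight_bounded[OF sch] by (auto simp: weight_bounded_def)
      have D0: "D \<ge> 0"
        using order_trans[OF norm_ge_zero D[of 0]] weight_pos[of "0 :: 'd heis"] by (simp add: zero_le_mult_iff)
      have w: "weight (z, s) \<le> 1 / (1 + s\<^sup>2)" for s
      proof -
        have "1 + s\<^sup>2 \<le> (1 + \<bar>s\<bar>)\<^sup>2" by (simp add: power2_sum)
        also have "\<dots> \<le> (1 + norm (z, s))\<^sup>2"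
          using norm_snd_le[of s z] by (intro power_mono) auto
        also have "\<dots> \<le> (1 + norm (z, s)) ^ (2 * DIM('d heis))"
          by (intro power_increasing) auto
        finally show ?thesis unfolding weight_def by (intro divide_left_mono) (auto simp: add_pos_nonneg)
      qed
      have le: "norm (?h (z, s)) \<le> D * (1 / (1 + s\<^sup>2))" for s
        using D[of "(z, s)"] mult_left_mono[OF w D0] by (rule order_trans)
      show ?thesis
        by (rule integrable_dominated[OF integrable_mult_right[OF integrable_inverse_1_plus_square_lborel] _ le]) measurable
    qed
    have "(\<integral>s. ?h (z, s) \<partial>lborel) = \<bar>4\<bar> *\<^sub>R (\<integral>s. ?h (z, 0 + 4 * s) \<partial>lborel)"
      by (rule lborel_integral_real_affine) simp
    also have "(\<integral>s. ?h (z, 0 + 4 * s) \<partial>lborel) = complex_of_real (2 * pi * A 0)"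
    proof (rule fourier_inversion_0[OF Acont Aint AC])
      show "?h (z, 0 + 4 * s) = (\<integral>l. complex_of_real (A l) * exp (\<i> * complex_of_real (l * s)) \<partial>lborel)" for s
        unfolding heat_kernel_int_def heat_integrand_def A_def
        by (simp only: exp_add of_real_exp of_real_mult fst_conv snd_conv mult.assoc mult_1_right) simp
      show "integrable lborel (\<lambda>s. ?h (z, 0 + 4 * s))"
        by (rule lborel_integrable_real_affine[OF hz]) simp
    qed
    also have "A 0 = l_sinh 0 ^ CARD('d) * exp (- (z \<bullet> z / 4))"
      by (simp add: A_def l_coth_def)
    finally show ?thesis by (simp add: K_def scaleR_conv_of_real)
  qed
  have pint: "integrable (lborel \<Otimes>\<^sub>M lborel) (\<lambda>(z, s). ?h (z, s) :: complex)"
    using hint by (simp add: lborel_prod)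
  have "(\<integral>w. ?h w \<partial>(lborel :: 'd heis measure)) = (\<integral>z. (\<integral>s. ?h (z, s) \<partial>lborel) \<partial>(lborel :: (complex ^ 'd) measure))"
    using lborel_pair.integral_fst[OF pint] by (simp add: lborel_prod)
  also have "\<dots> = complex_of_real (\<integral>z. K * exp (- (z \<bullet> z / 4)) \<partial>(lborel :: (complex ^ 'd) measure))"
    unfolding fiber by simp
  finally have eq: "(\<integral>w. ?h w \<partial>(lborel :: 'd heis measure)) = complex_of_real (\<integral>z. K * exp (- (z \<bullet> z / 4)) \<partial>(lborel :: (complex ^ 'd) measure))" .
  have "integrable lborel (\<lambda>z :: complex ^ 'd. complex_of_real (K * exp (- (z \<bullet> z / 4))))"
    using lborel_pair.integrable_fst[OF pint] unfolding fiber .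
  then have i: "integrable lborel (\<lambda>z :: complex ^ 'd. K * exp (- (z \<bullet> z / 4)))"
    by (simp only: complex_of_real_integrable_eq)
  have "(\<integral>z. K * exp (- (z \<bullet> z / 4)) \<partial>(lborel :: (complex ^ 'd) measure)) \<noteq> 0"
  proof
    assume "(\<integral>z. K * exp (- (z \<bullet> z / 4)) \<partial>(lborel :: (complex ^ 'd) measure)) = 0"
    then have "AE z in (lborel :: (complex ^ 'd) measure). K * exp (- (z \<bullet> z / 4)) = 0"
      using i K by (subst (asm) integral_nonneg_eq_0_iff_AE) auto
    then have "AE z in (lborel :: (complex ^ 'd) measure). False" using K by auto
    then have "emeasure lborel (UNIV :: (complex ^ 'd) set) = 0"
      by (subst (asm) AE_iff_measurable[of UNIV]) auto
    then show False by simp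
  qed
  then show ?thesis unfolding eq by simp
qed

text \<open>Negating the point keeps the Gaussian and reverses the phase. Substituting -\<lambda>
  for \<lambda> undoes the reversal, since \<lambda> / sinh \<lambda> and \<lambda> coth \<lambda>
  are even.\<close>

lemma heat_kernel_int_even:
  "heat_kernel_int (\<lambda>l. 1) (- w) = heat_kernel_int (\<lambda>l. 1) w"
proof -
  have "heat_kernel_int (\<lambda>l. 1) w = \<bar>-1\<bar> *\<^sub>R (\<integral>l. heat_integrand (\<lambda>l. 1) (0 + (-1) * l) w \<partial>lborel)"
    unfolding heat_kernel_int_def by (rule lborel_integral_real_affine) simp
  also have "\<dots> = heat_kernel_int (\<lambda>l. 1) (- w)"
    by (simp add: heat_kernel_int_def heat_integrand_def l_sinh_minus l_coth_minus)
  finally show ?thesis by simp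
qed

section \<open>Uniqueness for the heat equation\<close>

lemma norm_heis_inv [simp]: "norm (heis_inv a) = norm a"
  by (simp add: heis_inv_def norm_Pair norm_prod_def)

lemma weight_le_if:
  fixes a b :: "'a::euclidean_space"
  assumes "1 + norm b \<le> k * (1 + norm a)"
  shows "weight a \<le> k ^ (2 * DIM('a)) * weight b"
proof -
  let ?N = "2 * DIM('a)"
  have p: "(1 + norm x) ^ ?N > 0" for x :: 'a by (simp add: add_pos_nonneg)
  have "(1 + norm b) ^ ?N \<le> (k * (1 + norm a)) ^ ?N"
    using assms by (intro power_mono) auto
  then have "(1 + norm b) ^ ?N \<le> k ^ ?N * (1 + norm a) ^ ?N"
    by (simp only: power_mult_distrib)
  then show ?thesis using p[of a] p[of b] unfolding weight_def by (simp add: divide_le_eq pos_le_divide_eq mult.commute)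
qed

lemma weight_translate:
  fixes a v :: "'d::finite heis"
  shows "weight (heis_mult a v) \<le> (2 * (1 + norm a)) ^ (2 * DIM('d heis)) * weight v"
  using weight_mult_le[of "heis_inv a" "heis_mult a v"] by (intro weight_le_if) simp

lemma weight_right_translate:
  fixes v y :: "'d::finite heis"
  shows "weight (heis_mult v y) \<le> (2 * (1 + norm y)) ^ (2 * DIM('d heis)) * weight v"
proof (rule weight_le_if)
  have "heis_mult (heis_mult v y) (heis_inv y) = v"
    by (simp add: heis_mult_eq heis_inv_def mult_i_minus inner_add_left prod_eq_iff)
  then show "1 + norm v \<le> 2 * (1 + norm y) * (1 + norm (heis_mult v y))"
    using weight_mult_le[of "heis_mult v y" "heis_inv y"] by (simp add: algebra_simps)
qed

lemma weight_dil:
  fixes v :: "'d::finite heis"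
  assumes "r > 0"
  shows "weight (dil r v) \<le> (1 + (1 / r)\<^sup>2) ^ (2 * DIM('d heis)) * weight v"
proof (rule weight_le_if)
  have "norm v \<le> (1 + (1 / r)\<^sup>2) * norm (dil r v)"
    using norm_dil_le[of "1 / r" "dil r v"] assms by (simp add: dil_dil)
  then show "1 + norm v \<le> (1 + (1 / r)\<^sup>2) * (1 + norm (dil r v))"
    by (simp add: distrib_left add_increasing)
qed

section \<open>Bounds uniform in the time and in the radius of the cutoff\<close>

definition unif_bounded :: "'i set \<Rightarrow> ('i \<Rightarrow> 'a \<Rightarrow> complex) \<Rightarrow> bool"
  where "unif_bounded S k \<longleftrightarrow> (\<exists>C. \<forall>i\<in>S. \<forall>w. norm (k i w) \<le> C)"

definition unif_weight_bounded :: "'i set \<Rightarrow> ('i \<Rightarrow> 'a::euclidean_space \<Rightarrow> complex) \<Rightarrow> bool"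
  where "unif_weight_bounded S b \<longleftrightarrow> (\<exists>M. \<forall>i\<in>S. \<forall>w. norm (b i w) \<le> M * weight w)"

lemma unif_weight_bounded_mult:
  fixes b :: "'i \<Rightarrow> 'a::euclidean_space \<Rightarrow> complex"
  assumes "unif_bounded S k" "unif_weight_bounded S b"
  shows "unif_weight_bounded S (\<lambda>i w. k i w * b i w)"
proof -
  obtain C M where "\<forall>i\<in>S. \<forall>w. norm (k i w) \<le> C" "\<forall>i\<in>S. \<forall>w. norm (b i w) \<le> M * weight w"
    using assms by (auto simp: unif_bounded_def unif_weight_bounded_def)
  then have "norm (k i w * b i w) \<le> C * (M * weight w)" if "i \<in> S" for i w
    unfolding norm_mult using that by (intro mult_mono) (auto intro: order_trans[OF norm_ge_zero])
  then show ?thesis unfolding unif_weight_bounded_def by (metis mult.assoc)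
qed

lemma unif_weight_bounded_add:
  fixes b c :: "'i \<Rightarrow> 'a::euclidean_space \<Rightarrow> complex"
  assumes "unif_weight_bounded S b" "unif_weight_bounded S c"
  shows "unif_weight_bounded S (\<lambda>i w. b i w + c i w)"
proof -
  obtain M N where *: "\<forall>i\<in>S. \<forall>w. norm (b i w) \<le> M * weight w" "\<forall>i\<in>S. \<forall>w. norm (c i w) \<le> N * weight w"
    using assms by (auto simp: unif_weight_bounded_def)
  have "norm (b i w + c i w) \<le> (M + N) * weight w" if "i \<in> S" for i w
    using norm_triangle_ineq[of "b i w" "c i w"] *[THEN bspec[OF _ that], THEN spec, of w]
    by (simp add: distrib_right)
  then show ?thesis unfolding unif_weight_bounded_def by blast
qed

lemma unif_weight_bounded_sum:
  fixes b :: "'j \<Rightarrow> 'i \<Rightarrow> 'a::euclidean_space \<Rightarrow> complex"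
  assumes "finite A" "\<And>j. j \<in> A \<Longrightarrow> unif_weight_bounded S (b j)"
  shows "unif_weight_bounded S (\<lambda>i w. \<Sum>j\<in>A. b j i w)"
  using assms
proof (induction A rule: finite_induct)
  case empty
  then show ?case by (auto simp: unif_weight_bounded_def intro!: exI[of _ 0])
next
  case (insert j A)
  then show ?case by (simp add: unif_weight_bounded_add)
qed

text \<open>On an interval of times away from 0 the prefactor is largest at the left end, while the
  distortion of the weight by the dilation is bounded by its value at the right end. As t tends to 0
  the prefactor blows up, hence the positive lower bound.\<close>

lemma unif_weight_bounded_heis_dilate:
  fixes f :: "'d::finite heis \<Rightarrow> complex"
  assumes f: "weight_bounded f" and t: "0 < t0"
  shows "unif_weight_bounded {t0..t1} (\<lambda>t v. heis_dilate t f (heis_mult a v))"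
proof -
  let ?N = "2 * DIM('d heis)"
  obtain C where C: "\<And>w. norm (f w) \<le> C * weight w" using f by (auto simp: weight_bounded_def)
  have C0: "C \<ge> 0"
    using order_trans[OF norm_ge_zero C[of 0]] weight_pos[of "0 :: 'd heis"] by (simp add: zero_le_mult_iff)
  have "norm (heis_dilate t f (heis_mult a v)) \<le>
      (1 / t0 ^ (CARD('d) + 1) * C * (1 + t1) ^ ?N * (2 * (1 + norm a)) ^ ?N) * weight v"
    if tt: "t \<in> {t0..t1}" for t v
  proof -
    have tp: "t > 0" using t tt by auto
    let ?y = "heis_mult a v"
    have "norm (heis_dilate t f ?y) = 1 / t ^ (CARD('d) + 1) * norm (f (dil (1 / sqrt t) ?y))"
      using tp by (simp only: heis_dilate_eq norm_mult norm_of_real) simp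
    also have "\<dots> \<le> 1 / t0 ^ (CARD('d) + 1) * (C * ((1 + t1) ^ ?N * ((2 * (1 + norm a)) ^ ?N * weight v)))"
    proof (intro mult_mono order_trans[OF C] mult_left_mono[OF _ C0])
      show "1 / t ^ (CARD('d) + 1) \<le> 1 / t0 ^ (CARD('d) + 1)"
        using t tt by (intro divide_left_mono power_mono) auto
      have "weight (dil (1 / sqrt t) ?y) \<le> (1 + t) ^ ?N * weight ?y"
        using weight_dil[of "1 / sqrt t" ?y] tp by simp
      also have "\<dots> \<le> (1 + t1) ^ ?N * ((2 * (1 + norm a)) ^ ?N * weight v)"
        using tt tp weight_nonneg by (intro mult_mono power_mono weight_translate) auto
      finally show "weight (dil (1 / sqrt t) ?y) \<le> (1 + t1) ^ ?N * ((2 * (1 + norm a)) ^ ?N * weight v)" .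
    qed (use t C0 weight_nonneg in auto)
    finally show ?thesis by (simp only: mult.assoc)
  qed
  then show ?thesis unfolding unif_weight_bounded_def by blast
qed

lemma continuous_heis_dilate:
  assumes "continuous_on UNIV f" "continuous_on S k" "\<And>x. x \<in> S \<Longrightarrow> k x > 0"
  shows "continuous_on S (\<lambda>x. heis_dilate (k x) f y)"
proof -
  have "k x \<noteq> 0" if "x \<in> S" for x using assms(3)[OF that] by simp
  then show ?thesis unfolding heis_dilate_def
    by (intro continuous_intros continuous_on_compose2[OF assms(1)] assms(2)) auto
qed

lemma measurable_heis_dilate_translate:
  "f \<in> borel_measurable borel \<Longrightarrow> t > 0 \<Longrightarrow> (\<lambda>v. heis_dilate t f (heis_mult a v)) \<in> borel_measurable borel"
proof -
  assume [measurable]: "f \<in> borel_measurable borel" and t: "t > 0"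
  show ?thesis unfolding heis_dilate_eq[OF t] by measurable
qed

text \<open>The bounds on the test functions degenerate at \<open>T\<close>, where the kernel
  concentrates. Continuity is local, so bounds on each interval [0, t'] with t' < T are
  enough.\<close>

lemma weighted_curve_continuous:
  fixes u :: "real \<Rightarrow> 'a::euclidean_space \<Rightarrow> complex"
  assumes u: "weighted_curve u"
    and meas: "\<And>t. t \<in> {0..<T} \<Longrightarrow> a t \<in> borel_measurable lborel"
    and bd: "\<And>t'. t' < T \<Longrightarrow> unif_weight_bounded {0..t'} a"
    and cont: "\<And>w. continuous_on {0..<T} (\<lambda>t. a t w)"
  shows "continuous_on {0..<T} (\<lambda>t. \<integral>w. u t w * a t w \<partial>lborel)"
  unfolding continuous_on_def
proof
  fix t0 assume t0: "t0 \<in> {0..<T}"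
  define t' where "t' = (t0 + T) / 2"
  have t': "t0 < t'" "t' < T" using t0 by (auto simp: t'_def)
  obtain M where M: "\<forall>t\<in>{0..t'}. \<forall>w. norm (a t w) \<le> M * weight w"
    using bd[OF t'(2)] by (auto simp: unif_weight_bounded_def)
  have at: "at t0 within {0..<T} = at t0 within {0..t'}"
    by (rule at_within_nhd[where S="{..<t'}"]) (use t' in auto)
  show "((\<lambda>t. \<integral>w. u t w * a t w \<partial>lborel) \<longlongrightarrow> (\<integral>w. u t0 w * a t0 w \<partial>lborel)) (at t0 within {0..<T})"
    unfolding at
  proof (rule weighted_curve_tendsto[OF u])
    show "((\<lambda>t. a t w) \<longlongrightarrow> a t0 w) (at t0 within {0..t'})" for w
      using cont[of w] t0 unfolding continuous_on_def at[symmetric] by blast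
  qed (use M t' t0 meas in auto)
qed

text \<open>Supplies the integrable majorant in time for the removal of the cutoff.\<close>

lemma weighted_curve_norm_continuous:
  assumes u: "weighted_curve u"
  shows "continuous_on {0..} (\<lambda>t. \<integral>w. norm (u t w) * weight w \<partial>lborel)"
  unfolding continuous_on_def
proof
  fix t0 :: real assume t0: "t0 \<in> {0..}"
  let ?N = "\<lambda>t. \<integral>w. norm (u t w) * weight w \<partial>lborel"
  have meas: "u t \<in> borel_measurable lborel" and int: "integrable lborel (\<lambda>w. norm (u t w) * weight w)"
    if "t \<ge> 0" for t using u that by (auto simp: weighted_curve_def)
  have J: "((\<lambda>t. \<integral>w. norm (u t w - u t0 w) * weight w \<partial>lborel) \<longlongrightarrow> 0) (at t0 within {0..})"
    using u t0 by (simp add: weighted_curve_def)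
  have "norm (?N t - ?N t0) \<le> (\<integral>w. norm (u t w - u t0 w) * weight w \<partial>lborel)" if t: "t \<in> {0..}" for t
  proof -
    have di: "integrable lborel (\<lambda>w. norm (u t w - u t0 w) * weight w)"
      using t t0 by (intro weighted_diff_integrable meas int) auto
    have "?N t - ?N t0 = (\<integral>w. norm (u t w) * weight w - norm (u t0 w) * weight w \<partial>lborel)"
      using int t t0 by simp
    also have "norm \<dots> \<le> (\<integral>w. norm (norm (u t w) * weight w - norm (u t0 w) * weight w) \<partial>lborel)" by simp
    also have "\<dots> \<le> (\<integral>w. norm (u t w - u t0 w) * weight w \<partial>lborel)"
    proof (intro integral_mono di integrable_norm Bochner_Integration.integrable_diff int)
      show "norm (norm (u t w) * weight w - norm (u t0 w) * weight w) \<le> norm (u t w - u t0 w) * weight w" for w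
        using mult_right_mono[OF norm_triangle_ineq3[of "u t w" "u t0 w"] weight_nonneg[of w]] weight_nonneg[of w]
        by (simp add: left_diff_distrib[symmetric] abs_mult)
    qed (use t t0 in auto)
    finally show ?thesis .
  qed
  then have "\<forall>\<^sub>F t in at t0 within {0..}. norm (?N t - ?N t0) \<le> (\<integral>w. norm (u t w - u t0 w) * weight w \<partial>lborel)"
    by (simp add: eventually_at_filter)
  from Lim_null_comparison[OF this J] show "(?N \<longlongrightarrow> ?N t0) (at t0 within {0..})"
    by (simp add: LIM_zero_iff)
qed

section \<open>The cut-off backward kernels as test functions\<close>

lemma smooth_on_powr: "smooth_on {0<..} (\<lambda>x::real. complex_of_real (x powr p))"
proof (rule smooth_on_real_deriv[where P="\<lambda>f. \<exists>c p. f = (\<lambda>x. complex_of_real (c * x powr p))"])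
  fix f assume "\<exists>c p. f = (\<lambda>x. complex_of_real (c * x powr p))"
  then obtain c p where f: "f = (\<lambda>x. complex_of_real (c * x powr p))" by blast
  have "(f has_vector_derivative complex_of_real ((c * p) * x powr (p - 1))) (at x)" if "x \<in> {0<..}" for x
    unfolding f using that
    by (intro has_vector_derivative_of_real) (auto intro!: derivative_eq_intros)
  then show "\<exists>g. (\<exists>c p. g = (\<lambda>x. complex_of_real (c * x powr p))) \<and> (\<forall>x\<in>{0<..}. (f has_vector_derivative g x) (at x))"
    by (intro exI[of _ "\<lambda>x. complex_of_real ((c * p) * x powr (p - 1))"]) blast
next
  show "\<exists>c p'. (\<lambda>x::real. complex_of_real (x powr p)) = (\<lambda>x. complex_of_real (c * x powr p'))"
    by (intro exI[of _ 1] exI[of _ p]) simp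
qed simp

text \<open>The half spaces t < T and t > d cover everything. On the first the function is built
  from real powers of T - t, all of them smooth there, and on the second it vanishes, so that the
  singularity of the kernel at T is never met.\<close>

lemma smooth_heat_test_function:
  fixes h :: "'d::finite heis \<Rightarrow> complex"
  assumes h: "smooth h" and \<theta>: "smooth \<theta>" and T: "d < T" and supp: "\<And>t. t > d \<Longrightarrow> \<theta> t = 0"
  shows "smooth (\<lambda>(t, v). if t < T then \<theta> t * (bump (dil r (heis_mult a v)) * heis_dilate (T - t) h (heis_mult a v)) else 0)"
    (is "smooth ?\<phi>")
proof -
  let ?U = "{p :: real \<times> 'd heis. fst p < T}"
  let ?V = "{p :: real \<times> 'd heis. d < fst p}"
  have U: "open ?U" and V: "open ?V"
    by (auto intro!: open_Collect_less continuous_intros)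
  have UV: "?U \<union> ?V = UNIV" using T by auto
  have fst': "smooth_on ?U (\<lambda>p. complex_of_real ((c + k * fst p) \<bullet> e))" for c k e :: real
  proof -
    have "smooth_on ?U (\<lambda>p. complex_of_real (c * e) + complex_of_real (p \<bullet> (k * e, 0)))"
      by (intro smooth_on_add smooth_on_const smooth_on_inner U)
    then show ?thesis by (simp add: inner_prod_def algebra_simps)
  qed
  have s\<theta>: "smooth_on ?U (\<lambda>p. \<theta> (fst p))"
  proof (rule smooth_on_compose[where g=fst and F=\<theta> and V=UNIV])
    show "smooth_on ?U (\<lambda>p. complex_of_real (fst p \<bullet> e))" for e using fst'[of 0 1 e] by simp
  qed (use U \<theta> in \<open>auto simp: smooth_iff\<close>)
  have spowr: "smooth_on ?U (\<lambda>p. complex_of_real ((T - fst p) powr q))" for q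
  proof (rule smooth_on_compose[where g="\<lambda>p. T - fst p" and F="\<lambda>x. complex_of_real (x powr q)" and V="{0<..}"])
    show "smooth_on ?U (\<lambda>p. complex_of_real ((T - fst p) \<bullet> e))" for e using fst'[of T "-1" e] by simp
  qed (use U smooth_on_powr in auto)
  let ?L = "\<lambda>p :: real \<times> 'd heis. (fst (snd p), snd (snd p) + 2 * (fst a \<bullet> mult_i (fst (snd p))))"
  have L: "bounded_linear ?L"
    by (intro bounded_linear_Pair bounded_linear_add bounded_linear_const_mult
        bounded_linear_compose[OF bounded_linear_inner_right] bounded_linear_compose[OF bounded_linear_mult_i]
        bounded_linear_compose[OF bounded_linear_fst] bounded_linear_compose[OF bounded_linear_snd] bounded_linear_snd)
  have y: "heis_mult a (snd p) = a + ?L p" for p by (simp add: heis_mult_eq prod_eq_iff)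
  have sy: "smooth_on ?U (\<lambda>p. complex_of_real (heis_mult a (snd p) \<bullet> e))" for e
  proof -
    have "smooth_on ?U (\<lambda>p. complex_of_real (a \<bullet> e) + complex_of_real (?L p \<bullet> e))"
      by (intro smooth_on_add smooth_on_const U smooth_on_linear bounded_linear_compose[OF bounded_linear_of_real]
          bounded_linear_compose[OF bounded_linear_inner_left] L)
    then show ?thesis unfolding y by (simp only: inner_add_left of_real_add)
  qed
  have sb: "smooth_on ?U (\<lambda>p. bump (dil r (heis_mult a (snd p))))"
    by (rule smooth_on_compose[where g="\<lambda>p. heis_mult a (snd p)" and F="\<lambda>y. bump (dil r y)" and V=UNIV])
      (use U sy smooth_dil[OF smooth_bump] in \<open>auto simp: smooth_iff\<close>)
  have sh: "smooth_on ?U (\<lambda>p. h ((T - fst p) powr (- 1 / 2) *\<^sub>R fst (heis_mult a (snd p)),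
      (T - fst p) powr (- 1) * snd (heis_mult a (snd p))))"
  proof (rule smooth_on_compose[where F=h and V=UNIV])
    fix e :: "'d heis" assume e: "e \<in> Basis"
    have "smooth_on ?U (\<lambda>p. complex_of_real ((T - fst p) powr (- 1 / 2)) * complex_of_real (heis_mult a (snd p) \<bullet> (fst e, 0))
      + complex_of_real ((T - fst p) powr (- 1)) * complex_of_real (heis_mult a (snd p) \<bullet> (0, snd e)))"
      by (intro smooth_on_add smooth_on_mult U spowr sy)
    then show "smooth_on ?U (\<lambda>p. complex_of_real (((T - fst p) powr (- 1 / 2) *\<^sub>R fst (heis_mult a (snd p)),
      (T - fst p) powr (- 1) * snd (heis_mult a (snd p))) \<bullet> e))"
      by (simp add: inner_prod_def mult.assoc)
  qed (use U h in \<open>auto simp: smooth_iff\<close>)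
  have "smooth_on ?U (\<lambda>p. \<theta> (fst p) * (bump (dil r (heis_mult a (snd p))) *
    (complex_of_real ((T - fst p) powr (- (real CARD('d) + 1))) * h ((T - fst p) powr (- 1 / 2) *\<^sub>R fst (heis_mult a (snd p)),
      (T - fst p) powr (- 1) * snd (heis_mult a (snd p))))))"
    by (intro smooth_on_mult U s\<theta> sb spowr sh)
  then have "smooth_on ?U ?\<phi>"
  proof (rule smooth_on_cong[OF U, rotated])
    fix p assume p: "p \<in> ?U"
    then have t: "T - fst p > 0" by simp
    have pw: "1 / (T - fst p) ^ (CARD('d) + 1) = (T - fst p) powr (- (real CARD('d) + 1))"
      "1 / sqrt (T - fst p) = (T - fst p) powr (- 1 / 2)" "snd (heis_mult a (snd p)) / (T - fst p) = (T - fst p) powr (- 1) * snd (heis_mult a (snd p))"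
    proof -
      have "(T - fst p) powr (real CARD('d) + 1) = (T - fst p) ^ (CARD('d) + 1)"
        using powr_realpow[OF t, of "CARD('d) + 1"] by (simp add: add.commute)
      then show "1 / (T - fst p) ^ (CARD('d) + 1) = (T - fst p) powr (- (real CARD('d) + 1))"
        unfolding powr_minus inverse_eq_divide by (simp only:)
      show "1 / sqrt (T - fst p) = (T - fst p) powr (- 1 / 2)"
        unfolding minus_divide_left[symmetric] powr_minus inverse_eq_divide powr_half_sqrt[OF less_imp_le[OF t]] by (rule refl)
      show "snd (heis_mult a (snd p)) / (T - fst p) = (T - fst p) powr (- 1) * snd (heis_mult a (snd p))"
        unfolding powr_neg_one[OF t] by simp
    qed
    show "\<theta> (fst p) * (bump (dil r (heis_mult a (snd p))) *
    (complex_of_real ((T - fst p) powr (- (real CARD('d) + 1))) * h ((T - fst p) powr (- 1 / 2) *\<^sub>R fst (heis_mult a (snd p)),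
      (T - fst p) powr (- 1) * snd (heis_mult a (snd p))))) = ?\<phi> p"
      using t by (simp only: heis_dilate_def pw case_prod_beta) simp
  qed
  moreover have "smooth_on ?V ?\<phi>"
    by (rule smooth_on_cong[OF V, of "\<lambda>_. 0"]) (auto simp: supp)
  ultimately show ?thesis
    unfolding smooth_iff UV[symmetric] by (rule smooth_on_Un)
qed

lemma test_function_heat:
  fixes h :: "'d::finite heis \<Rightarrow> complex"
  assumes h: "smooth h" and \<theta>: "smooth \<theta>" and cd: "0 < c" "d < T" and r: "r > 0"
    and supp: "\<And>t. t \<notin> {c..d} \<Longrightarrow> \<theta> t = 0"
  shows "test_function (\<lambda>t v. if t < T then \<theta> t * (bump (dil r (heis_mult a v)) * heis_dilate (T - t) h (heis_mult a v)) else 0)"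
  unfolding test_function_def
proof (intro conjI exI allI impI)
  show "smooth (\<lambda>(t, v). if t < T then \<theta> t * (bump (dil r (heis_mult a v)) * heis_dilate (T - t) h (heis_mult a v)) else 0)"
    by (rule smooth_heat_test_function[OF h \<theta> cd(2)]) (use supp in auto)
  \<comment> \<open>The inverse of the map that sends (t, v) to (t,
    \<open>dil r (heis_mult a v)\<close>). It carries the interval times the unit ball onto a
    compact set outside which the function vanishes.\<close>
  let ?g = "\<lambda>p :: real \<times> 'd heis. (fst p, heis_mult (heis_inv a) (dil (1 / r) (snd p)))"
  let ?K = "?g ` ({c..d} \<times> cball 0 1)"
  show "compact ?K"
    by (intro compact_continuous_image compact_Times continuous_intros
        continuous_on_compose2[OF continuous_heis_mult[of UNIV]] continuous_on_compose2[OF continuous_dil[of UNIV]]) auto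
  show "?K \<subseteq> {0<..} \<times> UNIV" using cd by auto
  fix t v assume tv: "(t, v) \<notin> ?K"
  have "t \<notin> {c..d} \<or> norm (dil r (heis_mult a v)) > 1"
  proof (rule ccontr)
    assume "\<not> ?thesis"
    then have *: "(t, dil r (heis_mult a v)) \<in> {c..d} \<times> cball 0 1" by auto
    have "?g (t, dil r (heis_mult a v)) = (t, v)" using r by (simp add: dil_dil)
    with * have "(t, v) \<in> ?K" by (intro image_eqI[of _ ?g]) auto
    with tv show False by blast
  qed
  then show "(if t < T then \<theta> t * (bump (dil r (heis_mult a v)) * heis_dilate (T - t) h (heis_mult a v)) else 0) = 0"
    using supp bump_eq_0[of "dil r (heis_mult a v)"] by auto
qed

text \<open>The value of \<open>- (\<partial>\<^sub>t + \<Delta>)\<close> on the test function of the previous lemma, where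
  \<open>r\<close> is the inverse of the radius of the cutoff.\<close>

definition heat_residual ::
  "('d::finite heis \<Rightarrow> complex) \<Rightarrow> complex \<Rightarrow> complex \<Rightarrow> real \<Rightarrow> real \<Rightarrow> 'd heis \<Rightarrow> complex"
  where "heat_residual h \<theta> \<theta>' r t y = - (\<theta>' * (bump (dil r y) * heis_dilate t h y))
    - \<theta> * (complex_of_real (2 * r) * (\<Sum>e\<in>Basis. hderiv e bump (dil r y) * (complex_of_real (1 / sqrt t) * heis_dilate t (hderiv e h) y))
         + complex_of_real (r\<^sup>2) * (sublap bump (dil r y) * heis_dilate t h y))"

text \<open>The time derivative of the backward kernel is minus its sublaplacian and cancels the
  Leibniz term in which both derivatives fall on the kernel. What survives contains the derivative
  of \<open>\<theta>\<close>, or at least one derivative of the cutoff and with it a factor r or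
  r^2.\<close>

lemma heat_residual_eq:
  fixes h :: "'d::finite heis \<Rightarrow> complex" and r T :: real and a :: "'d heis" and \<theta> :: "real \<Rightarrow> complex"
  assumes h: "smooth h" "self_similar_heat h" and t: "t < T"
    and \<theta>: "(\<theta> has_vector_derivative \<theta>') (at t)"
  defines "\<phi> \<equiv> (\<lambda>t v. if t < T then \<theta> t * (bump (dil r (heis_mult a v)) * heis_dilate (T - t) h (heis_mult a v)) else 0)"
  shows "- vector_derivative (\<lambda>\<tau>. \<phi> \<tau> v) (at t) - heis_laplacian (\<phi> t) v =
    heat_residual h (\<theta> t) \<theta>' r (T - t) (heis_mult a v)"
proof -
  let ?y = "heis_mult a v"
  have T: "T - t > 0" using t by simp
  note sh = smooth_heis_dilate[OF T h(1)]
  note sb = smooth_dil[OF smooth_bump, of r]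
  have "((\<lambda>\<tau>. heis_dilate (T - \<tau>) h ?y) has_vector_derivative (- 1) *\<^sub>R sublap (heis_dilate (T - t) h) ?y) (at t)"
    using heis_dilate_has_vector_derivative[OF h T, of ?y]
    by (intro vector_diff_chain_at[of "\<lambda>\<tau>. T - \<tau>" "-1" t "\<lambda>s. heis_dilate s h ?y", unfolded comp_def])
      (auto intro!: derivative_eq_intros)
  then have "((\<lambda>\<tau>. heis_dilate (T - \<tau>) h ?y) has_vector_derivative - sublap (heis_dilate (T - t) h) ?y) (at t)"
    by simp
  then have "((\<lambda>\<tau>. \<theta> \<tau> * (bump (dil r ?y) * heis_dilate (T - \<tau>) h ?y)) has_vector_derivative
      \<theta> t * (bump (dil r ?y) * (- sublap (heis_dilate (T - t) h) ?y)) + \<theta>' * (bump (dil r ?y) * heis_dilate (T - t) h ?y)) (at t)"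
    by (intro has_vector_derivative_mult \<theta> has_vector_derivative_mult_right)
  then have "((\<lambda>\<tau>. \<phi> \<tau> v) has_vector_derivative
      \<theta> t * (bump (dil r ?y) * (- sublap (heis_dilate (T - t) h) ?y)) + \<theta>' * (bump (dil r ?y) * heis_dilate (T - t) h ?y)) (at t)"
    by (rule has_vector_derivative_transform_within_open[where S="{..<T}"]) (use t in \<open>auto simp: \<phi>_def\<close>)
  then have v: "vector_derivative (\<lambda>\<tau>. \<phi> \<tau> v) (at t) =
      \<theta> t * (bump (dil r ?y) * (- sublap (heis_dilate (T - t) h) ?y)) + \<theta>' * (bump (dil r ?y) * heis_dilate (T - t) h ?y)"
    by (rule vector_derivative_at)
  define f where "f = (\<lambda>y. bump (dil r y) * heis_dilate (T - t) h y)"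
  have sf: "smooth f" unfolding f_def by (intro smooth_mult sb sh)
  have "\<phi> t = (\<lambda>v. \<theta> t * f (heis_mult a v))" using t by (simp add: \<phi>_def f_def fun_eq_iff)
  then have "heis_laplacian (\<phi> t) v = \<theta> t * sublap f ?y"
    using heis_laplacian_eq_sublap[OF smooth_cmult[OF smooth_translate[OF sf]], of "\<theta> t" a v]
    by (simp only: sublap_cmult[OF smooth_translate[OF sf]] sublap_translate[OF sf])
  also have "sublap f ?y = bump (dil r ?y) * sublap (heis_dilate (T - t) h) ?y
      + 2 * (\<Sum>e\<in>Basis. hderiv e (\<lambda>y. bump (dil r y)) ?y * hderiv e (heis_dilate (T - t) h) ?y)
      + sublap (\<lambda>y. bump (dil r y)) ?y * heis_dilate (T - t) h ?y"
    unfolding f_def by (rule sublap_mult[OF sb sh])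
  also have "(\<Sum>e\<in>Basis. hderiv e (\<lambda>y. bump (dil r y)) ?y * hderiv e (heis_dilate (T - t) h) ?y)
     = complex_of_real r * (\<Sum>e\<in>Basis. hderiv e bump (dil r ?y) * (complex_of_real (1 / sqrt (T - t)) * heis_dilate (T - t) (hderiv e h) ?y))"
    by (simp only: hderiv_dil[OF smooth_bump] hderiv_heis_dilate[OF T h(1)] sum_distrib_left mult.assoc)
  also have "sublap (\<lambda>y. bump (dil r y)) ?y = complex_of_real (r\<^sup>2) * sublap bump (dil r ?y)"
    by (rule sublap_dil[OF smooth_bump])
  finally have l: "heis_laplacian (\<phi> t) v = \<theta> t * (bump (dil r ?y) * sublap (heis_dilate (T - t) h) ?y
      + 2 * (complex_of_real r * (\<Sum>e\<in>Basis. hderiv e bump (dil r ?y) * (complex_of_real (1 / sqrt (T - t)) * heis_dilate (T - t) (hderiv e h) ?y)))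
      + complex_of_real (r\<^sup>2) * sublap bump (dil r ?y) * heis_dilate (T - t) h ?y)" .
  show ?thesis unfolding v l heat_residual_def
    by (simp add: distrib_left mult.assoc)
qed

lemma unif_bounded_continuous:
  fixes k :: "real \<Rightarrow> complex"
  assumes "continuous_on {a..b} k"
  shows "unif_bounded (A \<times> {a..b}) (\<lambda>(r, t) w. k t)"
proof -
  have "bounded (k ` {a..b})" by (intro compact_imp_bounded compact_continuous_image assms) simp
  then obtain C where "\<forall>t\<in>{a..b}. norm (k t) \<le> C" by (auto simp: bounded_iff)
  then show ?thesis by (auto simp: unif_bounded_def)
qed

lemma unif_bounded_dil:
  assumes "\<exists>C. \<forall>w. norm (f w) \<le> C"
  shows "unif_bounded S (\<lambda>(r, t) v. f (dil r (heis_mult a v)))"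
proof -
  obtain C where C: "\<And>w. norm (f w) \<le> C" using assms by blast
  show ?thesis unfolding unif_bounded_def
    by (rule exI[of _ C]) (simp add: C split: prod.splits)
qed

lemma unif_weight_bounded_heis_dilate':
  fixes f :: "'d::finite heis \<Rightarrow> complex"
  assumes f: "weight_bounded f" and t': "t' < T"
  shows "unif_weight_bounded (A \<times> {0..t'}) (\<lambda>(r, t) v. heis_dilate (T - t) f (heis_mult a v))"
proof -
  obtain M where M: "\<forall>t\<in>{T - t'..T}. \<forall>v. norm (heis_dilate t f (heis_mult a v)) \<le> M * weight v"
    using unif_weight_bounded_heis_dilate[OF f, of "T - t'" T a] t' by (auto simp: unif_weight_bounded_def)
  show ?thesis unfolding unif_weight_bounded_def
    by (rule exI[of _ M]) (use M in auto)
qed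

lemma bump_bounded: "\<exists>C. \<forall>w. norm (bump w) \<le> C"
  by (intro bounded_if_compact_support smooth_continuous smooth_bump bump_eq_0) simp

lemma unif_weight_bounded_cong:
  "unif_weight_bounded S b \<Longrightarrow> (\<And>i w. i \<in> S \<Longrightarrow> c i w = b i w) \<Longrightarrow> unif_weight_bounded S c"
  by (auto simp: unif_weight_bounded_def)

text \<open>One constant for all r in [0, 1], including the limiting value r = 0, and for all times
  up to t'; this is what dominated convergence asks for when the cutoff is removed.\<close>

lemma heat_residual_bounded:
  fixes h :: "'d::finite heis \<Rightarrow> complex"
  assumes h: "schwartz h" and t': "t' < T"
    and \<theta>: "continuous_on UNIV \<theta>" "continuous_on UNIV \<theta>'"
  shows "unif_weight_bounded ({0..1} \<times> {0..t'})
    (\<lambda>(r, t) v. heat_residual h (\<theta> t) (\<theta>' t) r (T - t) (heis_mult a v))"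
proof -
  let ?S = "{0..1::real} \<times> {0..t'}"
  let ?y = "heis_mult a"
  note c = unif_bounded_continuous[where A="{0..1::real}"]
  note hb = unif_weight_bounded_heis_dilate'[OF _ t', where A="{0..1::real}" and a=a]
  have ur: "unif_bounded ?S (\<lambda>(r, t) (w :: 'd heis). complex_of_real (2 * r))"
    "unif_bounded ?S (\<lambda>(r, t) (w :: 'd heis). complex_of_real (r\<^sup>2))"
    unfolding unif_bounded_def by (rule exI[of _ 2], auto simp: norm_mult) (rule exI[of _ 1], auto simp: norm_power power_le_one)
  have us: "unif_bounded ?S (\<lambda>(r, t) (w :: 'd heis). complex_of_real (1 / sqrt (T - t)))"
    using t' by (intro c continuous_intros) auto
  have u\<theta>: "unif_bounded ?S (\<lambda>(r, t) (w :: 'd heis). - \<theta>' t)" "unif_bounded ?S (\<lambda>(r, t) (w :: 'd heis). - \<theta> t)"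
    by (intro c continuous_intros continuous_on_subset[OF \<theta>(1)] continuous_on_subset[OF \<theta>(2)] subset_UNIV)+
  \<comment> \<open>Each factor is written as a family over the pair (r, t), even if it depends on
    one component only, to match the pattern of the closure rules under products and sums.\<close>
  have e: "unif_weight_bounded ?S (\<lambda>i v. (case i of (r, t) \<Rightarrow> \<lambda>w. hderiv e bump (dil r (?y w))) v *
     ((case i of (r, t) \<Rightarrow> \<lambda>w. complex_of_real (1 / sqrt (T - t))) v * (case i of (r, t) \<Rightarrow> \<lambda>v. heis_dilate (T - t) (hderiv e h) (?y v)) v))"
    if "e \<in> Basis" for e
    by (intro unif_weight_bounded_mult unif_bounded_dil bump_hderiv_bounded that us hb schwartz_hderiv_weight_bounded h)
  have s: "unif_weight_bounded ?S (\<lambda>i v. \<Sum>e\<in>Basis. (case i of (r, t) \<Rightarrow> \<lambda>w. hderiv e bump (dil r (?y w))) v *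
     ((case i of (r, t) \<Rightarrow> \<lambda>w. complex_of_real (1 / sqrt (T - t))) v * (case i of (r, t) \<Rightarrow> \<lambda>v. heis_dilate (T - t) (hderiv e h) (?y v)) v))"
    by (rule unif_weight_bounded_sum[OF finite_Basis e])
  have "unif_weight_bounded ?S (\<lambda>i v.
    (case i of (r, t) \<Rightarrow> \<lambda>w. - \<theta>' t) v * ((case i of (r, t) \<Rightarrow> \<lambda>w. bump (dil r (?y w))) v * (case i of (r, t) \<Rightarrow> \<lambda>v. heis_dilate (T - t) h (?y v)) v)
    + (case i of (r, t) \<Rightarrow> \<lambda>w. - \<theta> t) v * (
       (case i of (r, t) \<Rightarrow> \<lambda>w. complex_of_real (2 * r)) v * (\<Sum>e\<in>Basis. (case i of (r, t) \<Rightarrow> \<lambda>w. hderiv e bump (dil r (?y w))) v *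
         ((case i of (r, t) \<Rightarrow> \<lambda>w. complex_of_real (1 / sqrt (T - t))) v * (case i of (r, t) \<Rightarrow> \<lambda>v. heis_dilate (T - t) (hderiv e h) (?y v)) v))
       + (case i of (r, t) \<Rightarrow> \<lambda>w. complex_of_real (r\<^sup>2)) v * ((case i of (r, t) \<Rightarrow> \<lambda>w. sublap bump (dil r (?y w))) v * (case i of (r, t) \<Rightarrow> \<lambda>v. heis_dilate (T - t) h (?y v)) v)))"
    by (intro unif_weight_bounded_add unif_weight_bounded_mult s ur u\<theta> unif_bounded_dil bump_bounded bump_sublap_bounded hb schwartz_weight_bounded h)
  then show ?thesis
    by (rule unif_weight_bounded_cong) (auto simp: heat_residual_def)
qed

lemma sublap_bump_continuous: "continuous_on A (sublap bump)"
  unfolding sublap_def[abs_def] by (intro continuous_on_sum smooth_continuous smooth_hderiv smooth_bump)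

text \<open>All arguments depend on a common parameter because continuity is used in v for
  measurability, in t for the paired integral, and in r at the value 0.\<close>

lemma heat_residual_continuous:
  fixes h :: "'d::finite heis \<Rightarrow> complex"
  assumes h: "smooth h" and "continuous_on S \<theta>" "continuous_on S \<theta>'" "continuous_on S r" "continuous_on S t" "continuous_on S y"
    and t: "\<And>x. x \<in> S \<Longrightarrow> t x > 0"
  shows "continuous_on S (\<lambda>x. heat_residual h (\<theta> x) (\<theta>' x) (r x) (t x) (y x))"
proof -
  note assms(2-6) [continuous_intros]
  have cd: "continuous_on S (\<lambda>x. dil (r x) (y x))"
    unfolding dil_def by (intro continuous_intros)
  have t0: "t x \<noteq> 0" if "x \<in> S" for x using t[OF that] by simp
  have ch: "continuous_on S (\<lambda>x. heis_dilate (t x) f (y x))" if "smooth f" for f :: "'d heis \<Rightarrow> complex"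
    unfolding heis_dilate_def
    by (intro continuous_intros continuous_on_compose2[OF smooth_continuous[OF that, of UNIV]]) (use t0 in auto)
  have cc: "continuous_on S (\<lambda>x. f (dil (r x) (y x)))" if "continuous_on UNIV f" for f :: "'d heis \<Rightarrow> complex"
    by (rule continuous_on_compose2[OF that cd]) simp
  show ?thesis
    unfolding heat_residual_def
    by (intro continuous_intros cc ch h smooth_hderiv sublap_bump_continuous smooth_continuous smooth_bump) (use t0 in auto)
qed

text \<open>As the cutoff is removed, testing the equation leaves only the derivative of
  \<open>\<theta>\<close> against \<open>F\<close>; so \<open>F\<close> has zero weak derivative on
  the open interval. Test functions vanish near time 0, which is why continuity on [0, T[ is stated
  separately: it carries the constant to the initial time.\<close>

lemma heat_pairing_constant:
  fixes h :: "'d::finite heis \<Rightarrow> complex" and u :: "real \<Rightarrow> 'd heis \<Rightarrow> complex" and T :: real and a :: "'d heis"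
  assumes h: "schwartz h" "self_similar_heat h" and u: "weighted_curve u" "weak_heat_equation u"
    and ab: "0 < \<alpha>" "\<alpha> < \<beta>" "\<beta> < T"
  defines "F \<equiv> (\<lambda>t. \<integral>v. u t v * heis_dilate (T - t) h (heis_mult a v) \<partial>lborel)"
  shows "continuous_on {0..<T} F" "F \<alpha> = F \<beta>"
proof -
  have sh: "smooth h" using h by (simp add: schwartz_smooth)
  have hm: "h \<in> borel_measurable borel" by (rule smooth_measurable[OF sh])
  have um: "u t \<in> borel_measurable borel" if "t \<ge> 0" for t
    using u(1) that by (auto simp: weighted_curve_def)
  show contF: "continuous_on {0..<T} F"
    unfolding F_def
  proof (rule weighted_curve_continuous[OF u(1)])
    show "(\<lambda>v. heis_dilate (T - t) h (heis_mult a v)) \<in> borel_measurable lborel" if "t \<in> {0..<T}" for t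
      using measurable_heis_dilate_translate[OF hm, of "T - t" a] that by simp
    show "unif_weight_bounded {0..t'} (\<lambda>t v. heis_dilate (T - t) h (heis_mult a v))" if "t' < T" for t'
      using unif_weight_bounded_heis_dilate'[OF schwartz_weight_bounded[OF h(1)] that, of "{0}" a]
      by (auto simp: unif_weight_bounded_def)
    show "continuous_on {0..<T} (\<lambda>t. heis_dilate (T - t) h (heis_mult a w))" for w
      by (intro continuous_heis_dilate smooth_continuous sh continuous_intros) auto
  qed
  show "F \<alpha> = F \<beta>"
  proof (rule du_Bois_Reymond[of 0 T F \<alpha> \<beta>])
    show "continuous_on {0<..<T} F" by (rule continuous_on_subset[OF contF]) auto
    fix \<theta> \<theta>' :: "real \<Rightarrow> complex" and c d :: real
    assume \<theta>: "smooth \<theta>" "\<And>t. (\<theta> has_vector_derivative \<theta>' t) (at t)" "continuous_on UNIV \<theta>'"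
      and cd: "0 < c" "c < d" "d < T" and supp: "\<And>t. t \<notin> {c..d} \<Longrightarrow> \<theta> t = 0"
    define b where "b r t v = heat_residual h (\<theta> t) (\<theta>' t) r (T - t) (heis_mult a v)" for r t v
    define G where "G r t = (\<integral>v. u t v * b r t v \<partial>lborel)" for r t
    note \<theta>c = smooth_continuous[OF \<theta>(1), of UNIV]
    obtain M where M0: "\<forall>i\<in>{0..1} \<times> {0..d}. \<forall>v. norm ((\<lambda>(r, t) v. b r t v) i v) \<le> M * weight v"
      using heat_residual_bounded[OF h(1) cd(3) \<theta>c \<theta>(3), of a] unfolding unif_weight_bounded_def b_def by blast
    have M: "norm (b r t v) \<le> M * weight v" if "r \<in> {0..1}" "t \<in> {0..d}" for r t v
      using M0[rule_format, of "(r, t)" v] that by simp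
    have bm: "b r t \<in> borel_measurable borel" if "t < T" for r t
      unfolding b_def using that
      by (intro borel_measurable_continuous_onI heat_residual_continuous sh continuous_heis_mult continuous_intros) auto
    have contG: "continuous_on {0..<T} (G r)" if r: "r \<in> {0..1}" for r
      unfolding G_def
    proof (rule weighted_curve_continuous[OF u(1)])
      show "b r t \<in> borel_measurable lborel" if "t \<in> {0..<T}" for t using bm that by simp
      show "unif_weight_bounded {0..t'} (b r)" if t': "t' < T" for t'
        using heat_residual_bounded[OF h(1) t' \<theta>c \<theta>(3), of a] r unfolding unif_weight_bounded_def b_def by fastforce
      show "continuous_on {0..<T} (\<lambda>t. b r t w)" for w
        unfolding b_def
        by (intro heat_residual_continuous sh continuous_intros continuous_on_subset[OF \<theta>c] continuous_on_subset[OF \<theta>(3)]) auto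
    qed
    have zero: "(\<integral>t\<in>{c..d}. G r t \<partial>lborel) = 0" if r: "0 < r" "r \<le> 1" for r
    proof -
      define \<phi> where "\<phi> = (\<lambda>t v. if t < T then \<theta> t * (bump (dil r (heis_mult a v)) * heis_dilate (T - t) h (heis_mult a v)) else 0)"
      have "test_function \<phi>"
        unfolding \<phi>_def by (rule test_function_heat[OF sh \<theta>(1) cd(1,3) r(1) supp])
      then have "(LINT t:{0<..}|lborel. (LINT w|lborel.
        u t w * (- vector_derivative (\<lambda>\<tau>. \<phi> \<tau> w) (at t) - heis_laplacian (\<phi> t) w))) = 0"
        using u(2) unfolding weak_heat_equation_def by blast
      moreover have "indicator {0<..} t *\<^sub>R (LINT w|lborel.
        u t w * (- vector_derivative (\<lambda>\<tau>. \<phi> \<tau> w) (at t) - heis_laplacian (\<phi> t) w)) = indicator {c..d} t *\<^sub>R G r t" for t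
      proof (cases "t \<in> {c..d}")
        case True
        then have t: "t < T" "t \<in> {0<..}" using cd by auto
        have "- vector_derivative (\<lambda>\<tau>. \<phi> \<tau> w) (at t) - heis_laplacian (\<phi> t) w = b r t w" for w
          unfolding \<phi>_def b_def by (rule heat_residual_eq[OF sh h(2) t(1) \<theta>(2)])
        then show ?thesis using True t by (simp add: G_def)
      next
        case False
        \<comment> \<open>Outside [c, d] the test function vanishes for all nearby times as well, so
          its time derivative is zero there too.\<close>
        have op: "open (- {c..d})" by (intro open_Compl closed_atLeastAtMost)
        have "((\<lambda>\<tau>. \<phi> \<tau> w) has_vector_derivative 0) (at t)" for w
          by (rule has_vector_derivative_transform_within_open[OF has_vector_derivative_const op])
            (use False supp in \<open>auto simp: \<phi>_def\<close>)
        then have "vector_derivative (\<lambda>\<tau>. \<phi> \<tau> w) (at t) = 0" for w by (rule vector_derivative_at)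
        moreover have "heis_laplacian (\<phi> t) w = 0" for w
        proof -
          have "\<phi> t = (\<lambda>v. 0 * bump v)" using supp[OF False] by (auto simp: \<phi>_def)
          then show ?thesis
            using heis_laplacian_eq_sublap[OF smooth_cmult[OF smooth_bump], of 0 w] sublap_cmult[OF smooth_bump, of 0 w] by simp
        qed
        ultimately show ?thesis using False by simp
      qed
      ultimately show ?thesis unfolding set_lebesgue_integral_def by simp
    qed
    define X where "X n = 1 / real (Suc n)" for n
    have X: "X n > 0" "X n \<le> 1" "X n \<in> {0..1}" for n by (auto simp: X_def)
    have X0: "X \<longlonglongrightarrow> 0" unfolding X_def by real_asymp
    have "(\<lambda>n. \<integral>t. indicator {c..d} t *\<^sub>R G (X n) t \<partial>lborel) \<longlonglongrightarrow> (\<integral>t. indicator {c..d} t *\<^sub>R G 0 t \<partial>lborel)"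
    \<comment> \<open>Two nested passages to the limit: this one in t, and inside it one in v at
      fixed t that yields the pointwise convergence. Both majorants rest on the same constant
      \<open>M\<close>.\<close>
    proof (rule integral_dominated_convergence[where w="\<lambda>t. indicator {c..d} t *\<^sub>R (M * (\<integral>w. norm (u t w) * weight w \<partial>lborel))"])
      have Gm: "(\<lambda>t. indicat_real {c..d} t *\<^sub>R G r t) \<in> borel_measurable lborel" if "r \<in> {0..1}" for r
      proof -
        have sub: "{c..d} \<subseteq> {0..<T}" using cd by auto
        show ?thesis
          using borel_measurable_continuous_on_indicator[OF _ continuous_on_subset[OF contG[OF that] sub]] by simp
      qed
      show "(\<lambda>t. indicat_real {c..d} t *\<^sub>R G 0 t) \<in> borel_measurable lborel" by (rule Gm) simp
      show "(\<lambda>t. indicat_real {c..d} t *\<^sub>R G (X n) t) \<in> borel_measurable lborel" for n by (rule Gm[OF X(3)])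
      have "continuous_on {c..d} (\<lambda>t. M * (\<integral>w. norm (u t w) * weight w \<partial>lborel))"
        by (intro continuous_intros continuous_on_subset[OF weighted_curve_norm_continuous[OF u(1)]]) (use cd in auto)
      from borel_integrable_atLeastAtMost'[OF this]
      show "integrable lborel (\<lambda>t. indicat_real {c..d} t *\<^sub>R (M * (\<integral>w. norm (u t w) * weight w \<partial>lborel)))"
        by (simp add: set_integrable_def)
      have wint: "integrable lborel (\<lambda>w. norm (u t w) * weight w)" if "t \<in> {c..d}" for t
        using u(1) that cd by (auto simp: weighted_curve_def)
      show "AE t in lborel. norm (indicat_real {c..d} t *\<^sub>R G (X n) t) \<le> indicat_real {c..d} t *\<^sub>R (M * (\<integral>w. norm (u t w) * weight w \<partial>lborel))" for n
      proof (rule AE_I2)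
        fix t
        show "norm (indicat_real {c..d} t *\<^sub>R G (X n) t) \<le> indicat_real {c..d} t *\<^sub>R (M * (\<integral>w. norm (u t w) * weight w \<partial>lborel))"
        proof (cases "t \<in> {c..d}")
          case True
          then have t: "t \<ge> 0" "t < T" "t \<in> {0..d}" using cd by auto
          have "norm (G (X n) t) \<le> M * (\<integral>w. norm (u t w) * weight w \<partial>lborel)"
            unfolding G_def
            by (rule integrable_weighted_mult(2)) (use um[OF t(1)] bm[OF t(2)] wint[OF True] M[OF X(3) t(3)] in auto)
          then show ?thesis using True by simp
        qed simp
      qed
      show "AE t in lborel. (\<lambda>n. indicat_real {c..d} t *\<^sub>R G (X n) t) \<longlonglongrightarrow> indicat_real {c..d} t *\<^sub>R G 0 t"
      proof (rule AE_I2)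
        fix t
        show "(\<lambda>n. indicat_real {c..d} t *\<^sub>R G (X n) t) \<longlonglongrightarrow> indicat_real {c..d} t *\<^sub>R G 0 t"
        proof (cases "t \<in> {c..d}")
          case True
          then have t: "t \<ge> 0" "t < T" "t \<in> {0..d}" using cd by auto
          have "(\<lambda>n. G (X n) t) \<longlonglongrightarrow> G 0 t"
            unfolding G_def
          proof (rule integral_dominated_convergence[where w="\<lambda>v. M * (norm (u t v) * weight v)"])
            show "integrable lborel (\<lambda>v. M * (norm (u t v) * weight v))" using wint[OF True] by simp
            show "AE v in lborel. (\<lambda>n. u t v * b (X n) t v) \<longlonglongrightarrow> u t v * b 0 t v"
            proof (rule AE_I2, intro tendsto_mult_left)
              fix v
              have "continuous_on UNIV (\<lambda>r. b r t v)"
                unfolding b_def using t by (intro heat_residual_continuous sh continuous_intros) auto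
              then have "isCont (\<lambda>r. b r t v) 0" by (simp add: continuous_on_eq_continuous_at)
              then show "(\<lambda>n. b (X n) t v) \<longlonglongrightarrow> b 0 t v" using X0 by (rule isCont_tendsto_compose)
            qed
            show "AE v in lborel. norm (u t v * b (X n) t v) \<le> M * (norm (u t v) * weight v)" for n
            proof (rule AE_I2)
              fix v show "norm (u t v * b (X n) t v) \<le> M * (norm (u t v) * weight v)"
                using mult_left_mono[OF M[OF X(3) t(3), of n v], of "norm (u t v)"] by (simp add: norm_mult mult_ac)
            qed
          qed (use um[OF t(1)] bm[OF t(2)] in auto)
          then show ?thesis using True by simp
        qed simp
      qed
    qed
    moreover have "(\<integral>t. indicator {c..d} t *\<^sub>R G (X n) t \<partial>lborel) = 0" for n
      using zero[OF X(1,2)] by (simp add: set_lebesgue_integral_def)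
    ultimately have "(\<integral>t. indicator {c..d} t *\<^sub>R G 0 t \<partial>lborel) = 0"
      by (simp add: LIMSEQ_const_iff)
    \<comment> \<open>At r = 0 the dilation maps everything to the origin, where the bump equals 1,
      and the factors r and r^2 remove all terms with derivatives of the cutoff.\<close>
    moreover have "G 0 t = - (\<theta>' t * F t)" for t
    proof -
      have "b 0 t v = - \<theta>' t * heis_dilate (T - t) h (heis_mult a v)" for v
      proof -
        have "dil 0 y = 0" for y :: "'d heis" by (simp add: dil_def prod_eq_iff)
        then show ?thesis by (simp add: b_def heat_residual_def)
      qed
      then have "G 0 t = (\<integral>v. (- \<theta>' t) * (u t v * heis_dilate (T - t) h (heis_mult a v)) \<partial>lborel)"
        by (simp add: G_def mult_ac)
      then show ?thesis by (simp only: integral_mult_right_zero F_def) simp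
    qed
    ultimately have "(\<integral>t. - (indicat_real {c..d} t *\<^sub>R (\<theta>' t * F t)) \<partial>lborel) = 0" by simp
    then show "(\<integral>t\<in>{c..d}. \<theta>' t * F t \<partial>lborel) = 0"
      unfolding set_lebesgue_integral_def by simp
  qed (use ab in auto)
qed

section \<open>Convolution with the rescaled kernels and its pairing with test functions\<close>

lemma heis_dilate_even:
  assumes "\<And>w. h (- w) = h w"
  shows "heis_dilate t h (- w) = heis_dilate t h w"
proof -
  have "((1 / sqrt t) *\<^sub>R fst (- w), snd (- w) / t) = - ((1 / sqrt t) *\<^sub>R fst w, snd w / t)"
    by (simp add: prod_eq_iff)
  then show ?thesis unfolding heis_dilate_def by (simp only: assms)
qed

lemma heis_conv_even:
  assumes "\<And>w. h (- w) = h w"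
  shows "heis_conv f (heis_dilate t h) w = (\<integral>v. f v * heis_dilate t h (heis_mult (heis_inv w) v) \<partial>lborel)"
  unfolding heis_conv_def heis_inv_mult_inv[of _ w] heis_dilate_even[where h=h, OF assms] by (rule refl)

lemma continuous_heis_mult2:
  assumes "continuous_on S f" "continuous_on S g"
  shows "continuous_on S (\<lambda>x. heis_mult (f x) (g x))"
proof -
  have "continuous_on S (\<lambda>x. mult_i (fst (g x)))"
    by (rule continuous_on_compose2[OF linear_continuous_on[OF bounded_linear_mult_i, of UNIV]])
      (auto intro!: continuous_intros assms)
  then show ?thesis unfolding heis_mult_eq by (intro continuous_intros assms)
qed

lemma continuous_heis_inv:
  assumes "continuous_on S f"
  shows "continuous_on S (\<lambda>x. heis_inv (f x))"
  unfolding heis_inv_def by (intro continuous_intros assms)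

lemma measurable_pair_continuous:
  fixes f :: "'a::euclidean_space \<times> 'b::euclidean_space \<Rightarrow> complex"
  assumes "continuous_on UNIV f"
  shows "f \<in> borel_measurable (lborel \<Otimes>\<^sub>M lborel)"
  unfolding lborel_prod using borel_measurable_continuous_onI[OF assms] by simp

lemma weight_continuous: "continuous_on A weight"
  unfolding weight_def
proof (intro continuous_intros)
  show "\<forall>x\<in>A. (1 + norm x) ^ (2 * DIM('a)) \<noteq> 0"
    using norm_ge_zero by (auto simp: add_nonneg_eq_0_iff)
qed

lemma weight_inverse: "weight (w :: 'a::euclidean_space) * (1 + norm w) ^ (2 * DIM('a)) = 1"
proof -
  have "(1 + norm w) ^ (2 * DIM('a)) > 0" by (simp add: add_pos_nonneg)
  moreover have "X > 0 \<Longrightarrow> 1 / X * X = 1" for X :: real by simp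
  ultimately show ?thesis unfolding weight_def by blast
qed

lemma schwartz_times_weight_inverse_integrable:
  fixes h :: "'a::euclidean_space \<Rightarrow> complex"
  assumes "schwartz h"
  shows "integrable lborel (\<lambda>x. norm (h x) * (1 + norm x) ^ (2 * DIM('a)))"
proof -
  let ?N = "2 * DIM('a)"
  \<comment> \<open>Twice the exponent of the weight: one half cancels the growing factor, the other
    leaves an integrable weight.\<close>
  have "\<exists>C. \<forall>x. (1 + norm x) ^ (?N + ?N) * norm (iter_deriv [] h x) \<le> C"
    using assms unfolding schwartz_def by (metis empty_set empty_subsetI)
  then obtain C where C: "\<And>x. (1 + norm x) ^ (?N + ?N) * norm (h x) \<le> C" by auto
  have hm[measurable]: "h \<in> borel_measurable borel" by (intro smooth_measurable schwartz_smooth assms)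
  show ?thesis
  proof (rule integrable_dominated[OF integrable_mult_right[OF integrable_weight']])
    show "norm (norm (h x) * (1 + norm x) ^ ?N) \<le> C * weight x" for x :: 'a
    proof -
      have p: "(1 + norm x) ^ ?N > 0" by (simp add: add_pos_nonneg)
      have "norm (h x) * (1 + norm x) ^ ?N = (norm (h x) * (1 + norm x) ^ ?N) * (weight x * (1 + norm x) ^ ?N)"
        by (simp only: weight_inverse mult_1_right)
      also have "\<dots> = ((1 + norm x) ^ (?N + ?N) * norm (h x)) * weight x" by (simp only: power_add mult_ac)
      also have "\<dots> \<le> C * weight x" by (intro mult_right_mono C weight_nonneg)
      finally show ?thesis using p by (simp add: abs_mult)
    qed
  qed measurable
qed

text \<open>Pairing with \<open>\<phi>\<close> moves the heat kernel from the curve to the test function.\<close>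

definition heat_smear :: "('d::finite heis \<Rightarrow> complex) \<Rightarrow> ('d heis \<Rightarrow> complex) \<Rightarrow> real \<Rightarrow> 'd heis \<Rightarrow> complex"
  where "heat_smear h \<phi> r v = (\<integral>x. h x * \<phi> (heis_mult v (dil r x)) \<partial>lborel)"

text \<open>Moving the weight from the translated point back to \<open>v\<close> costs a power of 1
  + norm (\<open>dil r x\<close>), hence a polynomial in x uniformly for bounded r, and the Schwartz
  kernel absorbs it.\<close>

lemma heat_smear_bound:
  fixes h :: "'d::finite heis \<Rightarrow> complex"
  assumes h: "schwartz h" and \<phi>: "\<And>w. norm (\<phi> w) \<le> weight w" "\<phi> \<in> borel_measurable borel"
  shows "\<exists>M. \<forall>r v. \<bar>r\<bar> \<le> R \<longrightarrow> norm (heat_smear h \<phi> r v) \<le> M * weight v"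
proof (intro exI allI impI)
  let ?N = "2 * DIM('d heis)"
  define I where "I = (\<integral>x. norm (h x) * (1 + norm x) ^ ?N \<partial>lborel)"
  note i = schwartz_times_weight_inverse_integrable[OF h]
  have hm[measurable]: "h \<in> borel_measurable borel" by (intro smooth_measurable schwartz_smooth h)
  fix r v assume r: "\<bar>r\<bar> \<le> R"
  note \<phi>(2)[measurable]
  have le: "norm (h x * \<phi> (heis_mult v (dil r x))) \<le> ((2 * (1 + R\<^sup>2)) ^ ?N * weight v) * (norm (h x) * (1 + norm x) ^ ?N)" for x
  proof -
    have r2: "r\<^sup>2 \<le> R\<^sup>2" using r by (metis abs_ge_zero abs_le_square_iff abs_of_nonneg order_trans)
    have "norm (dil r x) \<le> (1 + R\<^sup>2) * norm x"
      using r2 by (intro order_trans[OF norm_dil_le] mult_right_mono) auto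
    then have "1 + norm (dil r x) \<le> (1 + R\<^sup>2) * (1 + norm x)"
      by (simp add: distrib_left add_increasing)
    then have "2 * (1 + norm (dil r x)) \<le> 2 * (1 + R\<^sup>2) * (1 + norm x)"
      unfolding mult.assoc by (rule mult_left_mono) simp
    then have "(2 * (1 + norm (dil r x))) ^ ?N \<le> (2 * (1 + R\<^sup>2)) ^ ?N * (1 + norm x) ^ ?N"
      unfolding power_mult_distrib[of "2 * (1 + R\<^sup>2)", symmetric] by (intro power_mono) auto
    then have "norm (\<phi> (heis_mult v (dil r x))) \<le> ((2 * (1 + R\<^sup>2)) ^ ?N * (1 + norm x) ^ ?N) * weight v"
      by (intro order_trans[OF \<phi>(1)] order_trans[OF weight_right_translate] mult_right_mono weight_nonneg)
    from mult_left_mono[OF this, of "norm (h x)"] show ?thesis by (simp add: norm_mult mult_ac)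
  qed
  have "norm (heat_smear h \<phi> r v) \<le> (\<integral>x. norm (h x * \<phi> (heis_mult v (dil r x))) \<partial>lborel)"
    unfolding heat_smear_def by simp
  also have "\<dots> \<le> (\<integral>x. ((2 * (1 + R\<^sup>2)) ^ ?N * weight v) * (norm (h x) * (1 + norm x) ^ ?N) \<partial>lborel)"
  proof (rule integral_mono_AE)
    show "integrable lborel (\<lambda>x. norm (h x * \<phi> (heis_mult v (dil r x))))"
      by (rule integrable_dominated[OF integrable_mult_right[OF i, of "(2 * (1 + R\<^sup>2)) ^ ?N * weight v"]])
        (measurable, simp only: real_norm_def abs_norm_cancel le)
  qed (use i le in auto)
  also have "\<dots> = ((2 * (1 + R\<^sup>2)) ^ ?N * I) * weight v" by (simp add: I_def)
  finally show "norm (heat_smear h \<phi> r v) \<le> ((2 * (1 + R\<^sup>2)) ^ ?N * I) * weight v" .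
qed

text \<open>The rescaled kernel as an approximate identity: the dilations shrink every x to the
  origin, and the bounded \<open>\<phi>\<close> permits \<open>h\<close> itself as majorant.\<close>

lemma heat_smear_continuous:
  fixes h :: "'d::finite heis \<Rightarrow> complex"
  assumes h: "schwartz h" and \<phi>: "\<And>w. norm (\<phi> w) \<le> weight w" "continuous_on UNIV \<phi>"
    and X: "X \<longlonglongrightarrow> 0"
  shows "(\<lambda>n. heat_smear h \<phi> (X n) v) \<longlonglongrightarrow> (\<integral>x. h x \<partial>lborel) * \<phi> v"
proof -
  have hm[measurable]: "h \<in> borel_measurable borel" by (intro smooth_measurable schwartz_smooth h)
  have hi: "integrable lborel h" by (intro weight_bounded_integrable schwartz_weight_bounded h hm)
  have \<phi>m[measurable]: "\<phi> \<in> borel_measurable borel" using \<phi>(2) by (rule borel_measurable_continuous_onI)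
  have "(\<lambda>n. heat_smear h \<phi> (X n) v) \<longlonglongrightarrow> (\<integral>x. h x * \<phi> v \<partial>lborel)"
    unfolding heat_smear_def
  proof (rule integral_dominated_convergence[where w="\<lambda>x. norm (h x)"])
    show "integrable lborel (\<lambda>x. norm (h x))" using hi by simp
    show "AE x in lborel. (\<lambda>n. h x * \<phi> (heis_mult v (dil (X n) x))) \<longlonglongrightarrow> h x * \<phi> v"
    proof (rule AE_I2, intro tendsto_mult_left)
      fix x
      have "continuous_on UNIV (\<lambda>r. \<phi> (heis_mult v (dil r x)))"
        by (intro continuous_on_compose2[OF \<phi>(2)] continuous_heis_mult2 continuous_intros)
          (auto simp: dil_def intro!: continuous_intros)
      then have "isCont (\<lambda>r. \<phi> (heis_mult v (dil r x))) 0" by (simp add: continuous_on_eq_continuous_at)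
      from isCont_tendsto_compose[OF this X]
      show "(\<lambda>n. \<phi> (heis_mult v (dil (X n) x))) \<longlonglongrightarrow> \<phi> v"
        by (simp add: dil_def heis_mult_eq)
    qed
    show "AE x in lborel. norm (h x * \<phi> (heis_mult v (dil (X n) x))) \<le> norm (h x)" for n
      using order_trans[OF \<phi>(1) weight_le_1] by (intro AE_I2) (simp add: norm_mult mult_left_le)
  qed measurable
  then show ?thesis using hi by simp
qed

lemma heat_smear_measurable:
  fixes h :: "'d::finite heis \<Rightarrow> complex"
  assumes h: "schwartz h" and \<phi>: "continuous_on UNIV \<phi>"
  shows "heat_smear h \<phi> r \<in> borel_measurable borel"
proof -
  have "(\<lambda>(v, x). h x * \<phi> (heis_mult v (dil r x))) \<in> borel_measurable (lborel \<Otimes>\<^sub>M lborel)"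
    unfolding split_beta
    by (intro measurable_pair_continuous continuous_on_mult continuous_on_compose2[OF \<phi>] continuous_heis_mult2
        continuous_on_compose2[OF smooth_continuous[OF schwartz_smooth[OF h], of UNIV]]
        continuous_on_compose2[OF continuous_dil[of UNIV]] continuous_intros) auto
  then have "(\<lambda>v. \<integral>x. h x * \<phi> (heis_mult v (dil r x)) \<partial>lborel) \<in> borel_measurable lborel"
    by (rule lborel.borel_measurable_lebesgue_integral)
  then show ?thesis by (simp add: heat_smear_def[abs_def])
qed

lemma heat_kernel_translate_joint_continuous:
  assumes "schwartz h" "t > 0"
  shows "continuous_on UNIV (\<lambda>(w, v). heis_dilate t h (heis_mult (heis_inv w) v))"
  unfolding heis_dilate_eq[OF assms(2)] split_beta
  by (intro continuous_on_mult continuous_on_const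
      continuous_on_compose2[OF smooth_continuous[OF schwartz_smooth[OF assms(1)], of UNIV]]
      continuous_on_compose2[OF continuous_dil[of UNIV]] continuous_heis_mult2 continuous_heis_inv continuous_intros) auto

text \<open>The convolution may grow like the inverse of the weight. This is why
  \<open>\<phi>\<close> is bounded by the square of the weight: one factor compensates that growth,
  the other makes the double integral absolutely convergent. After Fubini, evenness of
  \<open>h\<close> and the substitution w = v y bring the integral into the form of
  \<open>heat_smear\<close>.\<close>

lemma heat_kernel_conv_props:
  fixes h f :: "'d::finite heis \<Rightarrow> complex"
  assumes h: "schwartz h" "\<And>w. h (- w) = h w" and t: "t > 0"
    and f: "f \<in> borel_measurable borel" "integrable lborel (\<lambda>w. norm (f w) * weight w)"
  defines "g \<equiv> (\<lambda>w. \<integral>v. f v * heis_dilate t h (heis_mult (heis_inv w) v) \<partial>lborel)"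
  shows "g \<in> borel_measurable borel"
    and "\<exists>K. \<forall>w. norm (g w) * weight w \<le> K"
    and "continuous_on UNIV \<phi> \<Longrightarrow> (\<And>w. norm (\<phi> w) \<le> (weight w)\<^sup>2) \<Longrightarrow>
      (\<integral>w. g w * \<phi> w \<partial>lborel) = (\<integral>v. f v * heat_smear h \<phi> (sqrt t) v \<partial>lborel)"
proof -
  let ?N = "2 * DIM('d heis)"
  let ?k = "\<lambda>w v. heis_dilate t h (heis_mult (heis_inv w) v)"
  have hm[measurable]: "h \<in> borel_measurable borel" by (intro smooth_measurable schwartz_smooth h)
  note f(1)[measurable]
  have km: "(\<lambda>(w, v). ?k w v) \<in> borel_measurable (lborel \<Otimes>\<^sub>M lborel)"
    by (intro measurable_pair_continuous heat_kernel_translate_joint_continuous h t)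
  have km1: "?k w \<in> borel_measurable borel" for w
    by (rule measurable_heis_dilate_translate[OF hm t])
  have fkm: "(\<lambda>(w, v). f v * ?k w v) \<in> borel_measurable (lborel \<Otimes>\<^sub>M lborel)"
    using km by measurable
  then have "g \<in> borel_measurable lborel"
    unfolding g_def by (rule lborel.borel_measurable_lebesgue_integral)
  then show gm: "g \<in> borel_measurable borel" by simp
  obtain M where M: "\<And>v. norm (heis_dilate t h (heis_mult 0 v)) \<le> M * weight v"
    using unif_weight_bounded_heis_dilate[OF schwartz_weight_bounded[OF h(1)] t, of t 0] by (auto simp: unif_weight_bounded_def)
  have M0: "M \<ge> 0"
    using order_trans[OF norm_ge_zero M[of 0]] weight_pos[of "0 :: 'd heis"] by (simp add: zero_le_mult_iff)
  have k: "norm (?k w v) \<le> (M * 2 ^ ?N * (1 + norm w) ^ ?N) * weight v" for w v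
  proof -
    have "heis_mult 0 y = y" for y :: "'d heis" by (simp add: heis_mult_eq)
    then have "norm (?k w v) \<le> M * weight (heis_mult (heis_inv w) v)" using M[of "heis_mult (heis_inv w) v"] by simp
    also have "\<dots> \<le> M * ((2 * (1 + norm w)) ^ ?N * weight v)"
      using weight_translate[of "heis_inv w" v] by (intro mult_left_mono M0) simp
    finally show ?thesis by (simp only: power_mult_distrib mult.assoc)
  qed
  define J where "J = (\<integral>v. norm (f v) * weight v \<partial>lborel)"
  have gb: "norm (g w) \<le> (M * 2 ^ ?N * (1 + norm w) ^ ?N) * J" for w
    unfolding g_def J_def by (rule integrable_weighted_mult(2)) (use f km1 k in auto)
  have "norm (g w) * weight w \<le> M * 2 ^ ?N * J" for w
  proof -
    have "norm (g w) * weight w \<le> ((M * 2 ^ ?N * (1 + norm w) ^ ?N) * J) * weight w"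
      by (intro mult_right_mono gb weight_nonneg)
    also have "\<dots> = (M * 2 ^ ?N * J) * (weight w * (1 + norm w) ^ ?N)" by (simp only: mult_ac)
    finally show ?thesis by (simp only: weight_inverse mult_1_right)
  qed
  then show "\<exists>K. \<forall>w. norm (g w) * weight w \<le> K" by blast
  assume \<phi>: "continuous_on UNIV \<phi>" "\<And>w. norm (\<phi> w) \<le> (weight w)\<^sup>2"
  have \<phi>m[measurable]: "\<phi> \<in> borel_measurable borel" using \<phi>(1) by (rule borel_measurable_continuous_onI)
  have bd: "norm (f v * ?k w v * \<phi> w) \<le> (M * 2 ^ ?N * weight w) * (norm (f v) * weight v)" for w v
  proof -
    have "norm (?k w v) * norm (\<phi> w) \<le> ((M * 2 ^ ?N * (1 + norm w) ^ ?N) * weight v) * (weight w)\<^sup>2"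
      using M0 weight_nonneg by (intro mult_mono k \<phi>) (auto intro!: mult_nonneg_nonneg)
    also have "\<dots> = (M * 2 ^ ?N * weight w) * weight v * (weight w * (1 + norm w) ^ ?N)"
      by (simp only: power2_eq_square mult_ac)
    also have "\<dots> = (M * 2 ^ ?N * weight w) * weight v" by (simp only: weight_inverse mult_1_right)
    finally have "norm (?k w v) * norm (\<phi> w) \<le> (M * 2 ^ ?N * weight w) * weight v" .
    from mult_left_mono[OF this, of "norm (f v)"] show ?thesis by (simp add: norm_mult mult_ac)
  qed
  have fi: "integrable lborel (\<lambda>v. f v * ?k w v * \<phi> w)" for w
    using f km1[of w]
    by (intro integrable_mult_left integrable_weighted_mult(1)[OF _ f(2) _ k]) auto
  have int: "integrable (lborel \<Otimes>\<^sub>M lborel) (\<lambda>(w, v). f v * ?k w v * \<phi> w)"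
  proof (rule lborel_pair.Fubini_integrable)
    show m: "(\<lambda>(w, v). f v * ?k w v * \<phi> w) \<in> borel_measurable (lborel \<Otimes>\<^sub>M lborel)"
      using fkm by measurable
    show "AE w in lborel. integrable lborel (\<lambda>v. case (w, v) of (w, v) \<Rightarrow> f v * ?k w v * \<phi> w)"
      using fi by simp
    show "integrable lborel (\<lambda>w. \<integral>v. norm (case (w, v) of (w, v) \<Rightarrow> f v * ?k w v * \<phi> w) \<partial>lborel)"
    proof (rule integrable_dominated[OF integrable_mult_right[OF integrable_weight']])
      have "(\<lambda>(w, v). norm (f v * ?k w v * \<phi> w)) \<in> borel_measurable (lborel \<Otimes>\<^sub>M lborel)"
        using m by measurable
      then show "(\<lambda>w. \<integral>v. norm (case (w, v) of (w, v) \<Rightarrow> f v * ?k w v * \<phi> w) \<partial>lborel) \<in> borel_measurable lborel"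
        unfolding prod.case by (rule lborel.borel_measurable_lebesgue_integral)
      show "norm (\<integral>v. norm (case (w, v) of (w, v) \<Rightarrow> f v * ?k w v * \<phi> w) \<partial>lborel) \<le> (M * 2 ^ ?N * J) * weight w" for w
      proof -
        have "(\<integral>v. norm (f v * ?k w v * \<phi> w) \<partial>lborel) \<le> (\<integral>v. (M * 2 ^ ?N * weight w) * (norm (f v) * weight v) \<partial>lborel)"
          by (intro integral_mono integrable_norm fi integrable_mult_right f bd)
        also have "\<dots> = (M * 2 ^ ?N * J) * weight w" by (simp add: J_def)
        finally show ?thesis
          unfolding prod.case by (simp only: real_norm_def abs_of_nonneg[OF Bochner_Integration.integral_nonneg[OF norm_ge_zero]])
      qed
    qed
  qed
  have "(\<integral>w. g w * \<phi> w \<partial>lborel) = (\<integral>w. (\<integral>v. f v * ?k w v * \<phi> w \<partial>lborel) \<partial>lborel)"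
    unfolding g_def by simp
  also have "\<dots> = (\<integral>v. (\<integral>w. f v * ?k w v * \<phi> w \<partial>lborel) \<partial>lborel)"
    by (rule lborel_pair.Fubini_integral[OF int, symmetric])
  also have "\<dots> = (\<integral>v. f v * heat_smear h \<phi> (sqrt t) v \<partial>lborel)"
  proof -
    have "(\<integral>w. f v * ?k w v * \<phi> w \<partial>lborel) = f v * heat_smear h \<phi> (sqrt t) v" for v
    proof -
      have e: "?k w v = heis_dilate t h (heis_mult (heis_inv v) w)" for w
        unfolding heis_inv_mult_inv[of w v] by (rule heis_dilate_even[where h=h, OF h(2)])
      have dm: "heis_dilate t h \<in> borel_measurable borel"
        unfolding heis_dilate_fun[OF t] by measurable
      have "(\<integral>w. heis_dilate t h (heis_mult (heis_inv v) w) * \<phi> w \<partial>lborel) =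
        (\<integral>w. heis_dilate t h (heis_mult (heis_inv v) w) * \<phi> (heis_mult v (heis_mult (heis_inv v) w)) \<partial>lborel)"
        by simp
      also have "\<dots> = (\<integral>y. heis_dilate t h y * \<phi> (heis_mult v y) \<partial>lborel)"
        by (rule integral_heis_mult[of "\<lambda>y. heis_dilate t h y * \<phi> (heis_mult v y)"]) (use dm in measurable)
      also have "\<dots> = heat_smear h \<phi> (sqrt t) v"
        unfolding heat_smear_def by (rule integral_heis_dilate[OF t hm]) measurable
      finally show ?thesis by (simp add: e mult.assoc)
    qed
    then show ?thesis by simp
  qed
  finally show "(\<integral>w. g w * \<phi> w \<partial>lborel) = (\<integral>v. f v * heat_smear h \<phi> (sqrt t) v \<partial>lborel)" .
qed

text \<open>At the final time the kernel concentrates, and a curve of L^p classes has no pointwise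
  limit there. Pairing with \<open>\<phi>\<close> puts the concentration on a continuous function,
  for which the limit exists pointwise; equality almost everywhere is recovered from all such
  pairings.\<close>

lemma heat_representation:
  fixes h :: "'d::finite heis \<Rightarrow> complex" and u :: "real \<Rightarrow> 'd heis \<Rightarrow> complex"
  assumes h: "schwartz h" "self_similar_heat h" "\<And>w. h (- w) = h w" "(\<integral>w. h w \<partial>lborel) = 1"
    and u: "weighted_curve u" "weak_heat_equation u" and T: "T > 0"
  shows "AE w in lborel. u T w = heis_conv (u 0) (heis_dilate T h) w"
proof -
  define g where "g t w = (\<integral>v. u t v * heis_dilate (T - t) h (heis_mult (heis_inv w) v) \<partial>lborel)" for t w
  have um[measurable]: "u t \<in> borel_measurable borel" and ui: "integrable lborel (\<lambda>w. norm (u t w) * weight w)"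
    if "t \<ge> 0" for t using u(1) that by (auto simp: weighted_curve_def)
  have const: "g t w = g 0 w" if t: "t \<in> {0..<T}" for t w
  proof -
    have cont: "continuous_on {0..<T} (\<lambda>t. g t w)"
      unfolding g_def by (rule heat_pairing_constant(1)[OF h(1,2) u, of "T / 3" "T / 2"]) (use T in auto)
    have eq: "g \<alpha> w = g \<beta> w" if "0 < \<alpha>" "\<alpha> < \<beta>" "\<beta> < T" for \<alpha> \<beta>
      unfolding g_def by (rule heat_pairing_constant(2)[OF h(1,2) u that])
    have half: "g s w = g (T / 2) w" if "s \<in> {0<..<T}" for s
    proof (cases s "T / 2" rule: linorder_cases)
      case less
      show ?thesis by (rule eq) (use that T less in auto)
    next
      case greater
      show ?thesis by (rule eq[symmetric]) (use that T greater in auto)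
    next
      case equal
      then show ?thesis by (rule arg_cong)
    qed
    \<comment> \<open>Constancy is known for positive times only; right continuity at 0 adds the
      initial time.\<close>
    have "((\<lambda>t. g t w) \<longlongrightarrow> g 0 w) (at 0 within {0<..<T})"
    proof (rule tendsto_within_subset)
      show "((\<lambda>t. g t w) \<longlongrightarrow> g 0 w) (at 0 within {0..<T})"
        using cont T unfolding continuous_on_def by auto
    qed auto
    moreover have "\<forall>\<^sub>F s in at 0 within {0<..<T}. g s w = g (T / 2) w"
      unfolding eventually_at_filter by (rule always_eventually) (use half in blast)
    ultimately have "((\<lambda>t. g (T / 2) w) \<longlongrightarrow> g 0 w) (at 0 within {0<..<T})"
      by (rule Lim_transform_eventually)
    moreover have "at 0 within {0<..<T} \<noteq> bot"
      using T by (simp add: trivial_limit_within islimpt_greaterThanLessThan1)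
    ultimately have "g (T / 2) w = g 0 w" by (simp add: tendsto_const_iff)
    then show ?thesis using half[of t] t by (cases "t = 0") auto
  qed
  have gm[measurable]: "g 0 \<in> borel_measurable borel"
    using heat_kernel_conv_props(1)[OF h(1,3) T um[of 0] ui[of 0]] by (simp add: g_def[abs_def])
  obtain K where K: "\<And>w. norm (g 0 w) * weight w \<le> K"
    using heat_kernel_conv_props(2)[OF h(1,3) T um[of 0] ui[of 0]] by (auto simp: g_def)
  have pair: "(\<integral>w. g 0 w * \<phi> w \<partial>lborel) = (\<integral>w. u T w * \<phi> w \<partial>lborel)"
    if \<phi>: "continuous_on UNIV \<phi>" "\<And>w. norm (\<phi> w) \<le> (weight w)\<^sup>2" for \<phi>
  proof -
    have \<phi>w: "norm (\<phi> w) \<le> weight w" for w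
      using \<phi>(2)[of w] weight_le_1[of w] weight_pos[of w] by (simp add: power2_eq_square) (smt (verit) mult_left_le)
    have \<phi>m: "\<phi> \<in> borel_measurable borel" using \<phi>(1) by (rule borel_measurable_continuous_onI)
    let ?a = "\<lambda>t. heat_smear h \<phi> (sqrt (T - t))"
    have eq: "(\<integral>w. g 0 w * \<phi> w \<partial>lborel) = (\<integral>v. u t v * ?a t v \<partial>lborel)" if t: "t \<in> {0..<T}" for t
    proof -
      have "(\<integral>w. g t w * \<phi> w \<partial>lborel) = (\<integral>v. u t v * ?a t v \<partial>lborel)"
        unfolding g_def using t by (intro heat_kernel_conv_props(3)[OF h(1,3) _ um ui \<phi>]) auto
      then show ?thesis using const[OF t] by simp
    qed
    obtain M where M: "\<And>r v. \<bar>r\<bar> \<le> sqrt T \<Longrightarrow> norm (heat_smear h \<phi> r v) \<le> M * weight v"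
      using heat_smear_bound[OF h(1) \<phi>w \<phi>m, of "sqrt T"] by blast
    have aT: "?a T v = \<phi> v" for v
    proof -
      have "dil 0 x = 0" "heis_mult v 0 = v" for x :: "'d heis"
        by (simp_all add: dil_def heis_mult_eq prod_eq_iff)
      then show ?thesis using h(4) by (simp add: heat_smear_def)
    qed
    have "((\<lambda>t. \<integral>v. u t v * ?a t v \<partial>lborel) \<longlongrightarrow> (\<integral>v. u T v * ?a T v \<partial>lborel)) (at T within {0..<T})"
    proof (rule weighted_curve_tendsto[OF u(1)])
      show "?a t \<in> borel_measurable lborel" for t using heat_smear_measurable[OF h(1) \<phi>(1)] by simp
      show "norm (?a t w) \<le> M * weight w" if "t \<in> insert T {0..<T}" for t w
        using that T by (intro M) auto
      show "((\<lambda>t. ?a t v) \<longlongrightarrow> ?a T v) (at T within {0..<T})" for v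
        unfolding tendsto_at_iff_sequentially comp_def
      proof (intro allI impI)
        fix X assume X: "\<forall>i::nat. X i \<in> {0..<T} - {T}" "X \<longlonglongrightarrow> T"
        have "(\<lambda>i. sqrt (T - X i)) \<longlonglongrightarrow> sqrt (T - T)" by (intro tendsto_intros X)
        then have "(\<lambda>i. sqrt (T - X i)) \<longlonglongrightarrow> 0" by simp
        from heat_smear_continuous[OF h(1) \<phi>w \<phi>(1) this, of v]
        show "(\<lambda>i. ?a (X i) v) \<longlonglongrightarrow> ?a T v" unfolding aT h(4) by simp
      qed
    qed (use T in auto)
    moreover have "\<forall>\<^sub>F t in at T within {0..<T}. (\<integral>v. u t v * ?a t v \<partial>lborel) = (\<integral>w. g 0 w * \<phi> w \<partial>lborel)"
      using eq by (auto simp: eventually_at_filter)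
    ultimately have "((\<lambda>t. \<integral>w. g 0 w * \<phi> w \<partial>lborel) \<longlongrightarrow> (\<integral>v. u T v * ?a T v \<partial>lborel)) (at T within {0..<T})"
      by (rule Lim_transform_eventually)
    moreover have "at T within {0..<T} \<noteq> bot"
    proof -
      have "at T within {0<..<T} \<noteq> bot"
        using T by (simp add: trivial_limit_within islimpt_greaterThanLessThan2)
      moreover have "at T within {0<..<T} \<le> at T within {0..<T}" by (rule at_le) auto
      ultimately show ?thesis by (metis bot.extremum_uniqueI)
    qed
    ultimately show ?thesis unfolding aT by (simp add: tendsto_const_iff)
  qed
  \<comment> \<open>Neither \<open>u T\<close> nor \<open>g 0\<close> need be integrable. The
    squared weight makes both so, and multiplied by a continuous function with values in [0, 1] it
    is an admissible \<open>\<phi>\<close>.\<close>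
  define f where "f w = complex_of_real ((weight w)\<^sup>2) * (u T w - g 0 w)" for w
  have uT[measurable]: "u T \<in> borel_measurable borel" using um T by simp
  have iu: "integrable lborel (\<lambda>w. complex_of_real ((weight w)\<^sup>2) * u T w)"
  proof (rule integrable_dominated[OF ui[OF less_imp_le[OF T]]])
    fix w
    have "(weight w)\<^sup>2 * norm (u T w) \<le> weight w * norm (u T w)"
      using weight_le_1[of w] weight_nonneg[of w] by (intro mult_right_mono) (auto simp: power2_eq_square mult_left_le)
    then show "norm (complex_of_real ((weight w)\<^sup>2) * u T w) \<le> norm (u T w) * weight w"
      by (simp add: norm_mult norm_power mult.commute)
  qed measurable
  have ig: "integrable lborel (\<lambda>w. complex_of_real ((weight w)\<^sup>2) * g 0 w)"
  proof (rule integrable_dominated[OF integrable_mult_right[OF integrable_weight', of K]])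
    fix w :: "'d heis"
    have "norm (complex_of_real ((weight w)\<^sup>2) * g 0 w) = (norm (g 0 w) * weight w) * weight w"
      by (simp add: norm_mult norm_power power2_eq_square mult_ac)
    also have "\<dots> \<le> K * weight w" by (intro mult_right_mono K weight_nonneg)
    finally show "norm (complex_of_real ((weight w)\<^sup>2) * g 0 w) \<le> K * weight w" .
  qed measurable
  have "AE w in lborel. f w = 0"
  proof (rule AE_zero_if_integral_continuous_zero)
    show "integrable lborel f" unfolding f_def[abs_def] right_diff_distrib using iu ig by simp
    fix \<psi> :: "'d heis \<Rightarrow> real" assume \<psi>: "continuous_on UNIV \<psi>" "\<And>x. 0 \<le> \<psi> x \<and> \<psi> x \<le> 1"
    define \<phi> where "\<phi> w = complex_of_real ((weight w)\<^sup>2 * \<psi> w)" for w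
    have \<psi>m[measurable]: "\<psi> \<in> borel_measurable borel" using \<psi>(1) by (rule borel_measurable_continuous_onI)
    have \<phi>: "continuous_on UNIV \<phi>" unfolding \<phi>_def by (intro continuous_intros weight_continuous \<psi>)
    have \<phi>b: "norm (\<phi> w) \<le> (weight w)\<^sup>2" for w
      using \<psi>(2)[of w] weight_nonneg[of w] by (simp add: \<phi>_def norm_mult norm_power mult_left_le)
    have bm: "integrable lborel (\<lambda>w. F w * complex_of_real (\<psi> w))" if "integrable lborel F" for F :: "'d heis \<Rightarrow> complex"
    proof (rule Bochner_Integration.integrable_bound[OF that])
      have [measurable]: "F \<in> borel_measurable borel" using that by auto
      show "(\<lambda>w. F w * complex_of_real (\<psi> w)) \<in> borel_measurable lborel" by measurable
      show "AE w in lborel. norm (F w * complex_of_real (\<psi> w)) \<le> norm (F w)"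
        using \<psi>(2) by (intro AE_I2) (simp add: norm_mult mult_left_le)
    qed
    have "\<psi> w *\<^sub>R f w = complex_of_real ((weight w)\<^sup>2) * u T w * complex_of_real (\<psi> w) - complex_of_real ((weight w)\<^sup>2) * g 0 w * complex_of_real (\<psi> w)" for w
      by (simp add: f_def scaleR_conv_of_real algebra_simps)
    then have "(\<integral>w. \<psi> w *\<^sub>R f w \<partial>lborel) = (\<integral>w. complex_of_real ((weight w)\<^sup>2) * u T w * complex_of_real (\<psi> w) \<partial>lborel) - (\<integral>w. complex_of_real ((weight w)\<^sup>2) * g 0 w * complex_of_real (\<psi> w) \<partial>lborel)"
      using bm[OF iu] bm[OF ig] by simp
    also have "\<dots> = (\<integral>w. u T w * \<phi> w \<partial>lborel) - (\<integral>w. g 0 w * \<phi> w \<partial>lborel)"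
      by (simp add: \<phi>_def mult_ac)
    finally show "(\<integral>w. \<psi> w *\<^sub>R f w \<partial>lborel) = 0" using pair[OF \<phi> \<phi>b] by simp
  qed
  then show ?thesis
  proof eventually_elim
    fix w assume "f w = 0"
    then have "u T w = g 0 w" using weight_pos[of w] by (simp add: f_def)
    then show "u T w = heis_conv (u 0) (heis_dilate T h) w"
      by (simp add: g_def heis_conv_even[where h=h, OF h(3)])
  qed
qed

theorem theorem8:
  shows "\<exists>h :: 'd::finite heis \<Rightarrow> complex. schwartz h \<and>
    (\<forall>p\<ge>1. \<forall>u0 u. mem_Lp p u0 \<longrightarrow> heat_solution p u0 u \<longrightarrow>
      (\<forall>t>0. AE w in lborel. u t w = heis_conv u0 (heis_dilate t h) w))"
proof -
  let ?k = "heat_kernel_int (\<lambda>l. 1) :: 'd heis \<Rightarrow> complex"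
  define m where "m = (\<integral>w. ?k w \<partial>lborel)"
  have m: "m \<noteq> 0" unfolding m_def by (rule heat_kernel_mass)
  define h where "h = (\<lambda>w. (1 / m) * ?k w)"
  have k: "heat_class ?k" by (intro heat_class.base amplitude.const)
  have sk: "smooth ?k" by (rule heat_class_smooth[OF k])
  have sch: "schwartz h" unfolding h_def by (intro heat_class_schwartz heat_class.cmult k)
  have even: "h (- w) = h w" for w unfolding h_def by (simp only: heat_kernel_int_even)
  have mass: "(\<integral>w. h w \<partial>lborel) = 1"
    unfolding h_def integral_mult_right_zero m_def[symmetric] using m by simp
  have heat: "self_similar_heat h"
    unfolding self_similar_heat_def
  proof
    fix w
    have d: "dir_deriv v h w = (1 / m) * dir_deriv v ?k w" for v
      unfolding h_def by (rule dir_deriv_eq[OF has_derivative_mult_right[OF smooth_has_derivative[OF sk]]])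
    have s: "sublap h w = (1 / m) * sublap ?k w"
      unfolding h_def by (rule sublap_cmult[OF sk])
    have k': "sublap ?k w = - dir_deriv ((1 / 2) *\<^sub>R fst w, snd w) ?k w - of_nat (CARD('d) + 1) * ?k w"
      using self_similar_heat_kernel_int unfolding self_similar_heat_def by blast
    show "sublap h w = - dir_deriv ((1 / 2) *\<^sub>R fst w, snd w) h w - of_nat (CARD('d) + 1) * h w"
      unfolding s k' d by (simp only: h_def right_diff_distrib mult_minus_right mult.left_commute)
  qed
  have "AE w in lborel. u t w = heis_conv u0 (heis_dilate t h) w"
    if p: "p \<ge> 1" and u0: "mem_Lp p u0" and u: "heat_solution p u0 u" and t: "t > 0" for p u0 u and t :: real
  proof -
    have weak: "weak_heat_equation u" and init: "AE w in lborel. u 0 w = u0 w"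
      and um: "u 0 \<in> borel_measurable borel"
      using u by (auto simp: heat_solution_def mem_Lp_def)
    have u0m: "u0 \<in> borel_measurable borel" using u0 by (auto simp: mem_Lp_def)
    have hm: "h \<in> borel_measurable borel" by (intro smooth_measurable schwartz_smooth sch)
    \<comment> \<open>The initial value is attained almost everywhere only. The convolution
      integrates it, so it is the same at every single point.\<close>
    have "heis_conv (u 0) (heis_dilate t h) w = heis_conv u0 (heis_dilate t h) w" for w
      unfolding heis_conv_even[where h=h, OF even]
    proof (rule integral_cong_AE)
      show "AE v in lborel. u 0 v * heis_dilate t h (heis_mult (heis_inv w) v) = u0 v * heis_dilate t h (heis_mult (heis_inv w) v)"
        using init by eventually_elim simp
    qed (use um u0m measurable_heis_dilate_translate[OF hm t, of "heis_inv w"] in auto)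
    then show ?thesis
      using heat_representation[OF sch heat even mass heat_solution_weighted_curve[OF p u] weak t] by simp
  qed
  then show ?thesis using sch by blast
qed

end
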